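(* Let $w$ be a generalised left eigenvector of rank $m\ge1$ of $C$ corresponding to the eigenvalue $\lambda$. (1) If $|\lambda|<R$, then $wF(N)=wK+(\log_qN)^mw\vartheta_m+O(N^{\log_qR})$. (2) If $|\lambda|=R$, then $wF(N)=wK+(\log_qN)^mw\vartheta_m+O(N^{\log_qR}(\log N)^m)$. (3) If $|\lambda|>R$, then there are $1$-periodic continuous functions $\Phi_k:\mathbb{R}\to\mathbb{C}^d$, $0\le k<m$, such that $$wF(N)=wK+(\log_qN)^mw\vartheta_m+N^{\log_q\lambda}\sum_{0\le k<m}(\log_qN)^k\Phi_k(\{\log_qN\})$$ for $N\ge q^{m-1}$. Each $\Phi_k$ is Hölder continuous with any exponent smaller than $\log_q(|\lambda|/R)$. If, additionally, the left eigenvector $w(C-\lambda I)^{m-1}$ of $C$ is a left eigenvector of each of $A_0,\dots,A_{q-1}$ associated with the eigenvalue $1$, then $\Phi_{m-1}(u)=\frac{1}{q^{m-1}(m-1)!}w(C-qI)^{m-1}$ is constant. Moreover, $wK=0$ if $\lambda=1$ and $w\vartheta_m=0$ if $\lambda\ne1$.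
   Context: Let $q\ge2$, $d\ge1$ be integers and $A_0,\dots,A_{q-1}\in\mathbb{C}^{d\times d}$. Define $f(0)=I$ and, for $n\ge1$ with $q$-ary expansion $r_{\ell-1}\dots r_0$ (digits $r_j\in\{0,\dots,q-1\}$, $r_{\ell-1}\ne0$), $f(n)=A_{r_0}A_{r_1}\cdots A_{r_{\ell-1}}$ (equivalently $f(qn+r)=A_rf(n)$ for $qn+r\ne0$). Let $F(N)=\sum_{0\le n<N}f(n)$. Fix a norm on $\mathbb{C}^d$ and its induced matrix norm; vectors $w$ are row vectors acting by $w\mapsto wM$. $C=\sum_{0\le r<q}A_r$. $\rho=\inf_\ell\sup\{\|A_{r_1}\cdots A_{r_\ell}\|^{1/\ell}: r_i\in\{0,\dots,q-1\}\}$ is the joint spectral radius. If the matrices have the finiteness property (there is $\ell>0$ with $\rho=\sup\{\|A_{r_1}\cdots A_{r_\ell}\|^{1/\ell}\}$), set $R=\rho$; otherwise fix $R>\rho$ such that no eigenvalue $\lambda$ of $C$ satisfies $\rho<|\lambda|\le R$. Choose a regular $T$ with $TCT^{-1}=J$ in Jordan form; let $D$ be diagonal with $j$th entry $1$ if the $j$th diagonal entry of $J$ is $\ne1$ and $0$ otherwise; $C'=T^{-1}DJT$; $K=T^{-1}DT(I-C')^{-1}(I-A_0)$; for $m\ge1$, $\vartheta_m=\frac1{m!}T^{-1}(I-D)T(C-I)^{m-1}(I-A_0)$. $\log$ is the principal logarithm, $\log_q z=\log z/\log q$, $\{z\}$ the fractional part. Implicit $O$-constants depend on $q,d,A_0,\dots,A_{q-1},R$.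 *)

theory Defs
  imports "HOL-Analysis.Analysis"
    "Jordan_Normal_Form.Jordan_Normal_Form"
    "Jordan_Normal_Form.Gauss_Jordan_Elimination"
begin

definition rvmult :: "complex vec \<Rightarrow> complex mat \<Rightarrow> complex vec" where
  "rvmult w M = vec (dim_col M) (\<lambda>j. w \<bullet> col M j)"

definition msum :: "nat \<Rightarrow> (nat \<Rightarrow> complex mat) \<Rightarrow> nat \<Rightarrow> complex mat" where
  "msum d g n = foldr (\<lambda>i acc. g i + acc) [0..<n] (0\<^sub>m d d)"

definition vsum :: "nat \<Rightarrow> (nat \<Rightarrow> complex vec) \<Rightarrow> nat \<Rightarrow> complex vec" where
  "vsum d g n = foldr (\<lambda>i acc. g i + acc) [0..<n] (0\<^sub>v d)"

function regf :: "nat \<Rightarrow> nat \<Rightarrow> (nat \<Rightarrow> complex mat) \<Rightarrow> nat \<Rightarrow> complex mat" where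
  "regf q d A n = (if n = 0 \<or> q < 2 then 1\<^sub>m d else A (n mod q) * regf q d A (n div q))"
  by auto
termination
  by (relation "Wellfounded.measure (\<lambda>(q,d,A,n). n)") auto

definition regF :: "nat \<Rightarrow> nat \<Rightarrow> (nat \<Rightarrow> complex mat) \<Rightarrow> nat \<Rightarrow> complex mat" where
  "regF q d A N = msum d (regf q d A) N"

definition sumC :: "nat \<Rightarrow> nat \<Rightarrow> (nat \<Rightarrow> complex mat) \<Rightarrow> complex mat" where
  "sumC q d A = msum d A q"

definition is_vec_norm :: "nat \<Rightarrow> (complex vec \<Rightarrow> real) \<Rightarrow> bool" where
  "is_vec_norm d nv \<longleftrightarrow>
     (\<forall>x\<in>carrier_vec d. nv x = 0 \<longleftrightarrow> x = 0\<^sub>v d) \<and>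
     (\<forall>x\<in>carrier_vec d. \<forall>y\<in>carrier_vec d. nv (x + y) \<le> nv x + nv y) \<and>
     (\<forall>x\<in>carrier_vec d. \<forall>c. nv (c \<cdot>\<^sub>v x) = cmod c * nv x)"

definition ind_norm :: "nat \<Rightarrow> (complex vec \<Rightarrow> real) \<Rightarrow> complex mat \<Rightarrow> real" where
  "ind_norm d nv M = (SUP x \<in> carrier_vec d - {0\<^sub>v d}. nv (rvmult x M) / nv x)"

definition prods :: "nat \<Rightarrow> nat \<Rightarrow> (nat \<Rightarrow> complex mat) \<Rightarrow> nat \<Rightarrow> complex mat set" where
  "prods q d A l = {foldr (*) (map A rs) (1\<^sub>m d) | rs. length rs = l \<and> set rs \<subseteq> {..<q}}"

definition jsr_l :: "nat \<Rightarrow> nat \<Rightarrow> (nat \<Rightarrow> complex mat) \<Rightarrow> (complex vec \<Rightarrow> real) \<Rightarrow> nat \<Rightarrow> real" where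
  "jsr_l q d A nv l = (SUP P \<in> prods q d A l. root l (ind_norm d nv P))"

definition jsr :: "nat \<Rightarrow> nat \<Rightarrow> (nat \<Rightarrow> complex mat) \<Rightarrow> (complex vec \<Rightarrow> real) \<Rightarrow> real" where
  "jsr q d A nv = (INF l \<in> {1..}. jsr_l q d A nv l)"

definition finiteness_property :: "nat \<Rightarrow> nat \<Rightarrow> (nat \<Rightarrow> complex mat) \<Rightarrow> (complex vec \<Rightarrow> real) \<Rightarrow> bool" where
  "finiteness_property q d A nv \<longleftrightarrow> (\<exists>l>0. jsr q d A nv = jsr_l q d A nv l)"

definition Dmat :: "nat \<Rightarrow> complex mat \<Rightarrow> complex mat" where
  "Dmat d J = mat d d (\<lambda>(i,j). if i = j \<and> J $$ (j,j) \<noteq> 1 then 1 else 0)"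

text \<open>\<open>K = T^{-1} D T (I - C')^{-1} (I - A_0)\<close> with \<open>C' = T^{-1} D J T\<close>;
  \<open>Ti\<close> is the inverse of \<open>T\<close>.\<close>
definition Kmat :: "nat \<Rightarrow> (nat \<Rightarrow> complex mat) \<Rightarrow> complex mat \<Rightarrow> complex mat \<Rightarrow> complex mat \<Rightarrow> complex mat" where
  "Kmat d A T Ti J =
     (let D = Dmat d J; C' = Ti * D * J * T
      in Ti * D * T * the (mat_inverse (1\<^sub>m d - C')) * (1\<^sub>m d - A 0))"

definition theta :: "nat \<Rightarrow> nat \<Rightarrow> (nat \<Rightarrow> complex mat) \<Rightarrow> complex mat \<Rightarrow> complex mat \<Rightarrow> complex mat \<Rightarrow> nat \<Rightarrow> complex mat" where
  "theta q d A T Ti J m =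
     (1 / of_nat (fact m)) \<cdot>\<^sub>m
       (Ti * (1\<^sub>m d - Dmat d J) * T * ((sumC q d A - 1\<^sub>m d) ^\<^sub>m (m - 1)) * (1\<^sub>m d - A 0))"

definition gen_left_eigvec :: "nat \<Rightarrow> complex mat \<Rightarrow> complex vec \<Rightarrow> nat \<Rightarrow> complex \<Rightarrow> bool" where
  "gen_left_eigvec d C w m lam \<longleftrightarrow> w \<in> carrier_vec d \<and>
     rvmult w ((C - lam \<cdot>\<^sub>m 1\<^sub>m d) ^\<^sub>m m) = 0\<^sub>v d \<and>
     rvmult w ((C - lam \<cdot>\<^sub>m 1\<^sub>m d) ^\<^sub>m (m - 1)) \<noteq> 0\<^sub>v d"

end

theory Submission
  imports Defs
begin

text \<open>Put \<open>v k = w (C - \<lambda>I)\<^sup>k\<close>. The identity \<open>f (q n + r) = A r f n\<close> gives \<open>F (q N) = C F N + (I - A 0)\<close>, so after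
  subtracting suitable constants \<open>dd k\<close> the coordinates \<open>a k N\<close> of \<open>v k F N\<close> satisfy \<open>a k (q N) = \<lambda> a k N + a (k + 1) N\<close>,
  while \<open>a k (N + 1) - a k N\<close>, a coordinate of \<open>v k f N\<close>, is \<open>O (R\<^sup>n)\<close> for \<open>q\<^sup>n \<le> N < q\<^sup>n\<^sup>+\<^sup>1\<close>. The chain ends with the
  constant \<open>a m\<close>, which is a coordinate of \<open>m! w \<theta>\<^sub>m\<close>.
  If \<open>|\<lambda>| \<le> R\<close>, the recursion alone bounds \<open>a 0\<close>, by downward induction on \<open>k\<close>.
  If \<open>|\<lambda>| > R\<close>, applying \<open>C\<close> to the power \<open>- log\<^sub>q N\<close> turns the chain into functions \<open>p k\<close> which are invariant under \<open>N \<mapsto> q N\<close>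
  and whose increments at \<open>N\<close> are \<open>O (N\<^sup>-\<^sup>\<alpha>)\<close>. Hence \<open>p k \<lfloor>q\<^sup>n\<^sup>+\<^sup>u\<rfloor>\<close> converges as \<open>n\<close> grows, to a limit which is 1-periodic and
  Hoelder continuous in \<open>u\<close> and which equals \<open>p k N\<close> at \<open>u = log\<^sub>q N\<close>.\<close>

no_notation Finite_Cartesian_Product.vec_nth (infixl "$" 90)

section \<open>Scale-invariant sequences and their periodic limits\<close>

text \<open>The dilation equation is inhomogeneous because f 0 = I differs from A 0 f 0. On the
  generalised eigenspaces of eigenvalues other than 1 its constant is absorbed by solving x (I - C)
  K = x (I - A 0). At the eigenvalue 1 this is not solvable in general; there the chain is continued
  one step beyond its last vector, and the extra constant entry produces the power (log_q N)^m and
  the vector theta_m. One chain of length m + 1 thus treats both cases. The joint spectral radius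
  enters through a single inequality: for some length l all products of l digit matrices have norm
  at most R^l. For |lam| > R two effects compete in the increments of p k: those of F, of relative
  size (R/|lam|)^n, and those of log_q N, of relative size q^(-n). The bound |lam| <= q R, obtained
  by expanding C^l into q^l products, makes the second harmless; the powers of n that remain are the
  reason why the Hoelder exponent stays strictly below log_q(|lam|/R). The powers of log_q N in the
  expansion come from binomial coefficients in t = log_q N, rearranged as polynomials in t.\<close>

definition qlim :: "nat \<Rightarrow> (nat \<Rightarrow> complex) \<Rightarrow> real \<Rightarrow> complex" where
  "qlim q p u = lim (\<lambda>n. p (nat \<lfloor>real q powr (real n + u)\<rfloor>))"

lemma qlim_add_one:
  assumes "convergent (\<lambda>n. p (nat \<lfloor>real q powr (real n + u)\<rfloor>))"
  shows "qlim q p (u + 1) = qlim q p u"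
proof -
  have "(\<lambda>n. p (nat \<lfloor>real q powr (real n + u)\<rfloor>)) \<longlonglongrightarrow> qlim q p u"
    using assms by (simp add: qlim_def convergent_LIMSEQ_iff)
  then have "(\<lambda>n. p (nat \<lfloor>real q powr (real (Suc n) + u)\<rfloor>)) \<longlonglongrightarrow> qlim q p u"
    by (rule LIMSEQ_Suc)
  then have "(\<lambda>n. p (nat \<lfloor>real q powr (real n + (u + 1))\<rfloor>)) \<longlonglongrightarrow> qlim q p u"
    by (simp add: algebra_simps)
  then show ?thesis
    unfolding qlim_def[of q p "u + 1"] by (rule limI)
qed

lemma qscale_power:
  fixes p :: "nat \<Rightarrow> 'a"
  assumes "\<And>N. N \<ge> 1 \<Longrightarrow> p (q * N) = p N" "N \<ge> 1" "q \<ge> 1"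
  shows "p (q ^ n * N) = p N"
proof (induction n)
  case (Suc n)
  have "p (q ^ Suc n * N) = p (q * (q ^ n * N))" by (simp add: ac_simps)
  also have "\<dots> = p (q ^ n * N)" using assms by (intro assms(1)) simp
  finally show ?case using Suc by simp
qed simp

text \<open>At u = log_q N the arguments in the limit are the integers q^n N, where \<open>p\<close>
  always takes the value \<open>p N\<close>. So evaluating the limit function recovers
  \<open>p\<close> with no error term.\<close>

lemma qlim_log:
  assumes "q \<ge> 2" "\<And>N. N \<ge> 1 \<Longrightarrow> p (q * N) = p N" "N \<ge> 1"
  shows "qlim q p (log (real q) (real N)) = p N"
proof -
  have "real q powr (real n + log (real q) (real N)) = real (q ^ n * N)" for n
    using assms by (simp add: powr_add powr_realpow)
  then have "p (nat \<lfloor>real q powr (real n + log (real q) (real N))\<rfloor>) = p N" for n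
    using qscale_power[of p q N n] assms by (metis floor_of_nat nat_int le_trans one_le_numeral)
  then show ?thesis unfolding qlim_def by (intro limI) simp
qed

text \<open>Telescoping; the bound on the increments decreases in N, so each of the \<open>k\<close>
  increments is at most the one allowed at \<open>M\<close>.\<close>

lemma increments_bound:
  fixes p :: "nat \<Rightarrow> complex"
  assumes inc: "\<And>N. N \<ge> 1 \<Longrightarrow> cmod (p (Suc N) - p N) \<le> c * real N powr - \<alpha>" and "\<alpha> > 0" "M \<ge> 1"
  shows "cmod (p (M + k) - p M) \<le> real k * (c * real M powr - \<alpha>)"
proof (induction k)
  case (Suc k)
  have "0 \<le> c * real M powr - \<alpha>"
    by (rule order_trans[OF norm_ge_zero inc]) (use assms in simp)
  then have c0: "c \<ge> 0" using assms by (simp add: zero_le_mult_iff)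
  have "cmod (p (M + Suc k) - p M) \<le> cmod (p (Suc (M + k)) - p (M + k)) + cmod (p (M + k) - p M)"
    using norm_triangle_ineq[of "p (Suc (M + k)) - p (M + k)" "p (M + k) - p M"] by simp
  also have "cmod (p (Suc (M + k)) - p (M + k)) \<le> c * real (M + k) powr - \<alpha>"
    using assms by (intro inc) simp
  also have "\<dots> \<le> c * real M powr - \<alpha>"
    using assms c0 by (intro mult_left_mono powr_mono2') auto
  finally show ?case using Suc by (simp add: algebra_simps)
qed simp

context
  fixes q :: nat and p :: "nat \<Rightarrow> complex" and c \<alpha> :: real
  assumes q: "q \<ge> 2" and p_scale: "\<And>N. N \<ge> 1 \<Longrightarrow> p (q * N) = p N"
    and inc: "\<And>N. N \<ge> 1 \<Longrightarrow> cmod (p (Suc N) - p N) \<le> c * real N powr - \<alpha>" and \<alpha>: "\<alpha> > 0"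
begin

private lemma c_nonneg: "c \<ge> 0"
proof -
  have "0 \<le> c * real 1 powr - \<alpha>"
    by (rule order_trans[OF norm_ge_zero inc]) simp
  then show ?thesis by simp
qed

private lemma floor_ge:
  assumes "u \<ge> 0" shows "nat \<lfloor>real q powr (real n + u)\<rfloor> \<ge> q ^ n"
proof -
  have "real (q ^ n) = real q powr real n" using q by (simp add: powr_realpow)
  also have "\<dots> \<le> real q powr (real n + u)" using q assms by (intro powr_mono) auto
  finally show ?thesis by (simp add: le_nat_floor)
qed

text \<open>Passing from x to q x appends one base-q digit: the new floor is q M + k with 0 <= k <=
  q. Since \<open>p (q * M) = p M\<close>, only the \<open>k\<close> increments beyond q M count,
  each at most c q^(-\<alpha> n).\<close>

private lemma digit_step:
  assumes u: "u \<ge> 0"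
  shows "cmod (p (nat \<lfloor>real q powr (real (Suc n) + u)\<rfloor>) - p (nat \<lfloor>real q powr (real n + u)\<rfloor>))
     \<le> real q * c * (real q powr - \<alpha>) ^ n"
proof -
  define x where "x = real q powr (real n + u)"
  define M where "M = nat \<lfloor>x\<rfloor>"
  have "real q powr (real (Suc n) + u) = real q * x"
    using q by (simp add: x_def powr_add algebra_simps)
  moreover have "q * M \<le> nat \<lfloor>real q * x\<rfloor>"
  proof -
    have "real (q * M) \<le> real q * x" unfolding M_def x_def using q by (simp add: of_nat_floor)
    then show ?thesis by (rule le_nat_floor)
  qed
  moreover have "nat \<lfloor>real q * x\<rfloor> \<le> q * M + q"
  proof -
    have "x < real M + 1" unfolding M_def x_def by linarith
    then have "real q * x < real q * (real M + 1)" using q by (intro mult_strict_left_mono) auto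
    then have "real q * x < real (q * M + q)" by (simp add: algebra_simps)
    then show ?thesis using floor_less_iff[of "real q * x" "int (q * M + q)"] by linarith
  qed
  ultimately obtain k where k: "nat \<lfloor>real q powr (real (Suc n) + u)\<rfloor> = q * M + k" "k \<le> q"
    by (metis add_le_cancel_left le_Suc_ex)
  have M: "M \<ge> q ^ n" unfolding M_def x_def using u by (rule floor_ge)
  then have M1: "M \<ge> 1" using q by (metis le_trans one_le_numeral one_le_power)
  have "cmod (p (q * M + k) - p (q * M)) \<le> real k * (c * real (q * M) powr - \<alpha>)"
    using q M1 by (intro increments_bound[OF inc \<alpha>]) auto
  also have "\<dots> \<le> real q * (c * real (q ^ n) powr - \<alpha>)"
  proof (intro mult_mono mult_nonneg_nonneg powr_mono2')
    show "real (q ^ n) \<le> real (q * M)" using M q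
      by (metis le_trans mult_le_mono1 mult_1 of_nat_le_iff one_le_numeral)
  qed (use k q \<alpha> c_nonneg in auto)
  also have "real (q ^ n) powr - \<alpha> = (real q powr - \<alpha>) ^ n"
    using q by (simp add: powr_realpow[symmetric] powr_powr mult.commute)
  finally show ?thesis
    using k p_scale[OF M1] by (simp add: M_def x_def algebra_simps)
qed

private lemma theta_lt1: "real q powr - \<alpha> < 1"
  using q \<alpha> by (simp add: powr_less_one)

text \<open>The digit steps form a geometric series. The bound is independent of \<open>k\<close>,
  so it survives the passage to the limit.\<close>

private lemma tail:
  assumes u: "u \<ge> 0"
  shows "cmod (p (nat \<lfloor>real q powr (real (n + k) + u)\<rfloor>) - p (nat \<lfloor>real q powr (real n + u)\<rfloor>))
     \<le> real q * c * (real q powr - \<alpha>) ^ n / (1 - real q powr - \<alpha>)"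
proof -
  define s where "s n = p (nat \<lfloor>real q powr (real n + u)\<rfloor>)" for n
  define \<theta> where "\<theta> = real q powr - \<alpha>"
  have th: "0 \<le> \<theta>" "\<theta> < 1" using theta_lt1 by (auto simp: \<theta>_def)
  have "s (n + k) - s n = (\<Sum>i<k. s (n + Suc i) - s (n + i))"
    by (subst sum_lessThan_telescope) simp
  also have "cmod \<dots> \<le> (\<Sum>i<k. real q * c * \<theta> ^ (n + i))"
  proof (rule sum_norm_le)
    fix i
    show "cmod (s (n + Suc i) - s (n + i)) \<le> real q * c * \<theta> ^ (n + i)"
      using digit_step[OF u, of "n + i"] by (simp only: s_def \<theta>_def add_Suc_right)
  qed
  also have "\<dots> = real q * c * \<theta> ^ n * (\<Sum>i<k. \<theta> ^ i)"
    by (simp add: sum_distrib_left power_add algebra_simps)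
  also have "\<dots> \<le> real q * c * \<theta> ^ n * (1 / (1 - \<theta>))"
  proof (rule mult_left_mono)
    have "(\<Sum>i<k. \<theta> ^ i) \<le> (\<Sum>i. \<theta> ^ i)"
      using th by (intro sum_le_suminf summable_geometric) auto
    then show "(\<Sum>i<k. \<theta> ^ i) \<le> 1 / (1 - \<theta>)" using th suminf_geometric[of \<theta>] by simp
  qed (use c_nonneg th q in auto)
  finally show ?thesis by (simp add: s_def \<theta>_def)
qed

private lemma qlim_convergent_nonneg:
  assumes u: "u \<ge> 0"
  shows "convergent (\<lambda>n. p (nat \<lfloor>real q powr (real n + u)\<rfloor>))"
proof -
  define s where "s n = p (nat \<lfloor>real q powr (real n + u)\<rfloor>)" for n
  have "summable (\<lambda>n. s (Suc n) - s n)"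
  proof (rule summable_comparison_test')
    show "summable (\<lambda>n. real q * c * (real q powr - \<alpha>) ^ n)"
      using theta_lt1 by (intro summable_mult summable_geometric) auto
    show "norm (s (Suc n) - s n) \<le> real q * c * (real q powr - \<alpha>) ^ n" for n
      unfolding s_def by (rule digit_step[OF u])
  qed
  then have "convergent (\<lambda>n. (s n - s 0) + s 0)"
    by (intro convergent_add convergent_const) (simp add: summable_iff_convergent sum_lessThan_telescope)
  then show ?thesis by (simp add: s_def[abs_def])
qed

lemma qlim_convergent: "convergent (\<lambda>n. p (nat \<lfloor>real q powr (real n + u)\<rfloor>))"
proof -
  \<comment> \<open>For negative \<open>u\<close> the first exponents are negative; dropping
    \<open>k\<close> terms amounts to replacing \<open>u\<close> by a nonnegative shift of
    it.\<close>
  define k where "k = nat \<lceil>-u\<rceil>"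
  have "convergent (\<lambda>n. p (nat \<lfloor>real q powr (real n + (real k + u))\<rfloor>))"
    by (rule qlim_convergent_nonneg) (unfold k_def, linarith)
  then have "convergent (\<lambda>n. p (nat \<lfloor>real q powr (real (n + k) + u)\<rfloor>))"
    by (simp add: algebra_simps)
  then show ?thesis by (subst (asm) convergent_ignore_initial_segment)
qed

private lemma qlim_approx:
  assumes u: "u \<ge> 0"
  shows "cmod (qlim q p u - p (nat \<lfloor>real q powr (real n + u)\<rfloor>))
     \<le> real q * c / (1 - real q powr - \<alpha>) * (real q powr - \<alpha>) ^ n"
proof -
  define s where "s n = p (nat \<lfloor>real q powr (real n + u)\<rfloor>)" for n
  have "s \<longlonglongrightarrow> qlim q p u"
    using qlim_convergent[of u] by (simp add: qlim_def convergent_LIMSEQ_iff s_def[abs_def])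
  then have "(\<lambda>k. s (n + k)) \<longlonglongrightarrow> qlim q p u" by (simp add: LIMSEQ_ignore_initial_segment add.commute[of n])
  then have "(\<lambda>k. cmod (s (n + k) - s n)) \<longlonglongrightarrow> cmod (qlim q p u - s n)"
    by (intro tendsto_intros)
  then have "cmod (qlim q p u - s n) \<le> real q * c / (1 - real q powr - \<alpha>) * (real q powr - \<alpha>) ^ n"
    by (rule LIMSEQ_le_const2) (use tail[OF u, of n] in \<open>auto simp: s_def\<close>)
  then show ?thesis by (simp add: s_def)
qed

lemma qlim_periodic: "qlim q p (u + 1) = qlim q p u"
  by (rule qlim_add_one[OF qlim_convergent])

lemma qlim_periodic_int: "qlim q p (u + of_int i) = qlim q p u"
proof (induction i rule: int_induct[where k=0])
  case (step1 i) then show ?case using qlim_periodic[of "u + of_int i"] by (simp add: algebra_simps)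
next
  case (step2 i) then show ?case using qlim_periodic[of "u + of_int (i - 1)"] by (simp add: algebra_simps)
qed simp

text \<open>Both limits are compared with values of \<open>p\<close> at one common level n. If q^n
  (v - u) <= 1, the two integers at that level differ by at most L + 1, so everything is
  O(\<theta>^n); the largest such n turns \<theta>^n into (v - u)^\<alpha> up to a constant. The
  window for \<open>u\<close> and \<open>v\<close> keeps the derivative of q^z bounded.\<close>

private lemma holder_near:
  obtains B where "B \<ge> 0" "\<And>u v. 0 \<le> u \<Longrightarrow> u \<le> 1 \<Longrightarrow> u \<le> v \<Longrightarrow> v \<le> u + 1 \<Longrightarrow>
    cmod (qlim q p u - qlim q p v) \<le> B * (v - u) powr \<alpha>"
proof -
  \<comment> \<open>A bound for the derivative of q^z on [0, 2], where \<open>u\<close> and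
    \<open>v\<close> lie.\<close>
  define L where "L = real q powr 2 * ln (real q)"
  have L: "L > 0" using q by (simp add: L_def)
  define \<theta> where "\<theta> = real q powr - \<alpha>"
  define E where "E = real q * c / (1 - \<theta>)"
  have th: "0 < \<theta>" "\<theta> < 1" using theta_lt1 q by (auto simp: \<theta>_def)
  have E0: "E \<ge> 0" using c_nonneg th by (simp add: E_def)
  \<comment> \<open>Two approximation errors \<open>E\<close>, one for each point, and at most 1 + L
    increments between the two integers.\<close>
  define B1 where "B1 = (2 * E + c * (1 + L))"
  define B where "B = B1 / \<theta>"
  have lip: "\<bar>real q powr v - real q powr u\<bar> \<le> L * (v - u)" if "0 \<le> u" "u \<le> v" "v \<le> 2" for u v
  proof (cases "u = v")
    case False
    then have "u < v" using that by simp
    have "\<exists>z>u. z < v \<and> real q powr v - real q powr u = (v - u) * (real q powr z * ln (real q))"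
      using q by (intro MVT2[OF \<open>u < v\<close>]) (auto intro!: derivative_eq_intros)
    then obtain z where z: "u < z" "z < v" "real q powr v - real q powr u = (v - u) * (real q powr z * ln (real q))"
      by blast
    have "real q powr z * ln (real q) \<le> L" unfolding L_def using q z that
      by (intro mult_right_mono powr_mono) auto
    then have "(v - u) * (real q powr z * ln (real q)) \<le> (v - u) * L"
      using that by (intro mult_left_mono) auto
    moreover have "real q powr v \<ge> real q powr u" using q that by (intro powr_mono) auto
    ultimately show ?thesis using z by (simp add: mult.commute)
  qed simp
  have main: "cmod (qlim q p u - qlim q p v) \<le> B * (v - u) powr \<alpha>"
    if uv: "0 \<le> u" "u \<le> 1" "u \<le> v" "v \<le> u + 1" for u v
  proof (cases "u = v")
    case False
    then have d: "v - u > 0" using uv by simp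
    have key: "cmod (qlim q p u - qlim q p v) \<le> B1 * \<theta> ^ n" if n: "real q ^ n * (v - u) \<le> 1" for n
    proof -
      define x where "x = nat \<lfloor>real q powr (real n + u)\<rfloor>"
      define y where "y = nat \<lfloor>real q powr (real n + v)\<rfloor>"
      have xq: "real (q ^ n) \<le> real x" unfolding x_def of_nat_le_iff by (rule floor_ge[OF uv(1)])
      have "real q powr (real n + u) \<le> real q powr (real n + v)"
        using q uv by (intro powr_mono) auto
      then have "x \<le> y" unfolding x_def y_def by (intro nat_mono floor_mono)
      then obtain k where k: "y = x + k" using le_Suc_ex by blast
      have "real y \<le> real q powr (real n + v)" "real q powr (real n + u) < real x + 1"
        unfolding x_def y_def by (simp_all add: of_nat_floor)
      then have "real k \<le> real q powr (real n + v) - real q powr (real n + u) + 1" using k by simp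
      also have "\<dots> = real q ^ n * (real q powr v - real q powr u) + 1"
        using q by (simp add: powr_add powr_realpow algebra_simps)
      also have "\<dots> \<le> real q ^ n * (L * (v - u)) + 1"
        using lip[of u v] uv q by (intro add_mono mult_left_mono) auto
      also have "\<dots> = L * (real q ^ n * (v - u)) + 1" by simp
      also have "\<dots> \<le> L * 1 + 1" using n L by (intro add_mono mult_left_mono) auto
      finally have kL: "real k \<le> L + 1" by simp
      have x1: "x \<ge> 1" using xq q by (metis le_trans of_nat_le_iff one_le_numeral one_le_power)
      have "cmod (p y - p x) \<le> real k * (c * real x powr - \<alpha>)"
        unfolding k by (rule increments_bound[OF inc \<alpha> x1])
      also have "\<dots> \<le> (L + 1) * (c * real (q ^ n) powr - \<alpha>)"
        using kL xq c_nonneg q \<alpha> L by (intro mult_mono mult_nonneg_nonneg powr_mono2') auto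
      also have "real (q ^ n) powr - \<alpha> = \<theta> ^ n"
        using q by (simp add: powr_realpow[symmetric] powr_powr mult.commute \<theta>_def)
      finally have a: "cmod (p y - p x) \<le> (c * (1 + L)) * \<theta> ^ n" by (simp add: algebra_simps)
      have b: "cmod (qlim q p u - p x) \<le> E * \<theta> ^ n" "cmod (qlim q p v - p y) \<le> E * \<theta> ^ n"
        using qlim_approx[of u n] qlim_approx[of v n] uv by (auto simp: x_def y_def E_def \<theta>_def)
      have "qlim q p u - qlim q p v = (qlim q p u - p x) - (qlim q p v - p y) - (p y - p x)" by simp
      also have "cmod \<dots> \<le> E * \<theta> ^ n + E * \<theta> ^ n + (c * (1 + L)) * \<theta> ^ n"
        by (rule order_trans[OF norm_triangle_ineq4 add_mono[OF order_trans[OF norm_triangle_ineq4 add_mono[OF b]] a]])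
      finally show ?thesis by (simp add: B1_def algebra_simps)
    qed
    \<comment> \<open>Chosen so that v - u = q^(-t). The integer part of \<open>t\<close> is then
      the largest level with q^n (v - u) <= 1, and rounding down costs the factor 1/\<theta> in
      \<open>B\<close>.\<close>
    define t where "t = - log (real q) (v - u)"
    have vu: "v - u \<le> 1" using uv by simp
    have t0: "t \<ge> 0" using q d vu by (simp add: t_def)
    define n where "n = nat \<lfloor>t\<rfloor>"
    have n: "real n \<le> t" "t < real n + 1" using t0 by (auto simp: n_def of_nat_floor)
    have vut: "v - u = real q powr - t" using q d by (simp add: t_def)
    have "real q ^ n * (v - u) = real q powr (real n - t)"
      using q by (simp add: vut powr_realpow[symmetric] powr_add[symmetric])
    also have "\<dots> \<le> real q powr 0" using q n by (intro powr_mono) auto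
    finally have "cmod (qlim q p u - qlim q p v) \<le> B1 * \<theta> ^ n" using q by (intro key) simp
    also have "\<theta> ^ n = real q powr (- \<alpha> * real n)"
      using q by (simp add: \<theta>_def powr_realpow[symmetric] powr_powr)
    also have "\<dots> \<le> real q powr (- \<alpha> * (t - 1))" using q n \<alpha> by (intro powr_mono) auto
    also have "\<dots> = (v - u) powr \<alpha> / \<theta>"
    proof -
      have "- \<alpha> * (t - 1) = - t * \<alpha> - - \<alpha>" by (simp add: algebra_simps)
      then show ?thesis by (simp only: vut powr_powr \<theta>_def powr_diff)
    qed
    finally have "cmod (qlim q p u - qlim q p v) \<le> B1 / \<theta> * (v - u) powr \<alpha>"
      using E0 c_nonneg L by (simp add: B1_def mult_left_mono)
    then show ?thesis by (simp add: B_def)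
  qed simp
  have "B \<ge> 0" using E0 c_nonneg L th by (simp add: B_def B1_def)
  then show ?thesis using main by (rule that)
qed

text \<open>Periodicity moves \<open>u\<close> into [0, 1). The approximation at level 0 then
  compares the limit with \<open>p\<close> at an integer not exceeding q, and there are finitely
  many of these.\<close>

lemma qlim_bounded: "\<exists>b. \<forall>u. cmod (qlim q p u) \<le> b"
proof -
  define E where "E = real q * c / (1 - real q powr - \<alpha>)"
  define S where "S = p ` {..q}"
  have "cmod (qlim q p u) \<le> E + Max (cmod ` S)" for u
  proof -
    have 1: "cmod (qlim q p (frac u) - p (nat \<lfloor>real q powr (real 0 + frac u)\<rfloor>)) \<le> E"
      using qlim_approx[of "frac u" 0] by (simp add: E_def)
    have "nat \<lfloor>real q powr (real 0 + frac u)\<rfloor> \<le> q"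
    proof -
      have "real q powr (real 0 + frac u) \<le> real q powr 1"
        using q frac_lt_1[of u] by (intro powr_mono) auto
      then have "real q powr (real 0 + frac u) \<le> real q" using q by simp
      then show ?thesis by linarith
    qed
    then have 2: "cmod (p (nat \<lfloor>real q powr (real 0 + frac u)\<rfloor>)) \<le> Max (cmod ` S)"
      by (intro Max_ge) (auto simp: S_def)
    have 3: "cmod (qlim q p (frac u)) \<le> cmod (qlim q p (frac u) - p (nat \<lfloor>real q powr (real 0 + frac u)\<rfloor>))
        + cmod (p (nat \<lfloor>real q powr (real 0 + frac u)\<rfloor>))"
      using norm_triangle_sub[of "qlim q p (frac u)" "p (nat \<lfloor>real q powr (real 0 + frac u)\<rfloor>)"] by simp
    have "qlim q p (frac u) = qlim q p u"
      using qlim_periodic_int[of "frac u" "\<lfloor>u\<rfloor>"] by (simp add: frac_def)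
    then show ?thesis using order_trans[OF 3 add_mono[OF 1 2]] by simp
  qed
  then show ?thesis by blast
qed

text \<open>Points at distance at most 1 are moved by an integer into the window of
  \<open>holder_near\<close>. For points further apart the power of the distance is at least 1, so
  boundedness suffices; this is the origin of 2 b.\<close>

lemma qlim_holder: "\<exists>B. \<forall>u v. cmod (qlim q p u - qlim q p v) \<le> B * \<bar>u - v\<bar> powr \<alpha>"
proof -
  obtain B1 where B1: "B1 \<ge> 0" "\<And>u v. 0 \<le> u \<Longrightarrow> u \<le> 1 \<Longrightarrow> u \<le> v \<Longrightarrow> v \<le> u + 1 \<Longrightarrow>
    cmod (qlim q p u - qlim q p v) \<le> B1 * (v - u) powr \<alpha>"
    using holder_near by blast
  obtain b where b: "\<And>u. cmod (qlim q p u) \<le> b" using qlim_bounded by blast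
  have b0: "b \<ge> 0" using b[of 0] norm_ge_zero order_trans by blast
  have le: "cmod (qlim q p u - qlim q p v) \<le> (B1 + 2 * b) * (v - u) powr \<alpha>" if "u \<le> v" for u v
  proof (cases "v \<le> u + 1")
    case True
    have "cmod (qlim q p (frac u) - qlim q p (v - of_int \<lfloor>u\<rfloor>)) \<le> B1 * ((v - of_int \<lfloor>u\<rfloor>) - frac u) powr \<alpha>"
      using True that frac_lt_1[of u] by (intro B1(2)) (auto simp: frac_def)
    moreover have "qlim q p (frac u) = qlim q p u" "qlim q p (v - of_int \<lfloor>u\<rfloor>) = qlim q p v"
      using qlim_periodic_int[of "frac u" "\<lfloor>u\<rfloor>"] qlim_periodic_int[of "v - of_int \<lfloor>u\<rfloor>" "\<lfloor>u\<rfloor>"]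
      by (simp_all add: frac_def)
    moreover have "(v - of_int \<lfloor>u\<rfloor>) - frac u = v - u" by (simp add: frac_def)
    moreover have "B1 * (v - u) powr \<alpha> \<le> (B1 + 2 * b) * (v - u) powr \<alpha>"
      using b0 by (intro mult_right_mono) auto
    ultimately show ?thesis by simp
  next
    case False
    have "cmod (qlim q p u - qlim q p v) \<le> b + b"
      using b by (intro order_trans[OF norm_triangle_ineq4] add_mono)
    also have "\<dots> \<le> (B1 + 2 * b) * 1" using B1 by simp
    also have "\<dots> \<le> (B1 + 2 * b) * (v - u) powr \<alpha>"
      using False \<alpha> b0 B1 by (intro mult_left_mono ge_one_powr_ge_zero) auto
    finally show ?thesis .
  qed
  have "cmod (qlim q p u - qlim q p v) \<le> (B1 + 2 * b) * \<bar>u - v\<bar> powr \<alpha>" for u v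
    using le[of u v] le[of v u] by (cases "u \<le> v") (auto simp: norm_minus_commute abs_real_def)
  then show ?thesis by blast
qed

end

lemma holder_imp_continuous:
  fixes f :: "real \<Rightarrow> complex"
  assumes h: "\<And>u v. cmod (f u - f v) \<le> B * \<bar>u - v\<bar> powr \<alpha>" and \<alpha>: "\<alpha> > 0"
  shows "continuous_on UNIV f"
proof (rule continuous_at_imp_continuous_on, intro ballI)
  fix u :: real
  have "((\<lambda>v. \<bar>v - u\<bar>) \<longlongrightarrow> \<bar>u - u\<bar>) (at u)"
    by (intro tendsto_rabs tendsto_diff tendsto_ident_at tendsto_const)
  then have "((\<lambda>v. \<bar>v - u\<bar> powr \<alpha>) \<longlongrightarrow> \<bar>u - u\<bar> powr \<alpha>) (at u)"
    by (rule tendsto_powr2) (use \<alpha> in auto)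
  then have "((\<lambda>v. B * \<bar>v - u\<bar> powr \<alpha>) \<longlongrightarrow> B * 0) (at u)"
    using \<alpha> by (intro tendsto_intros) simp
  then have "((\<lambda>v. B * \<bar>v - u\<bar> powr \<alpha>) \<longlongrightarrow> 0) (at u)" by simp
  then have "((\<lambda>v. f v - f u) \<longlongrightarrow> 0) (at u)"
    by (rule Lim_null_comparison[rotated]) (auto intro!: always_eventually h)
  then show "isCont f u" by (simp add: isCont_def LIM_zero_iff)
qed

section \<open>Growth on the levels \<open>q\<^sup>n \<le> N < q\<^sup>n\<^sup>+\<^sup>1\<close>\<close>

text \<open>Growth is measured in n, one less than the number of base-q digits of N, because the
  recursion strips digits and the inductions run on n. For q >= 1 the index 0 lies on no level and
  is unconstrained.\<close>

definition level_O :: "nat \<Rightarrow> (nat \<Rightarrow> real) \<Rightarrow> (nat \<Rightarrow> complex) \<Rightarrow> bool" where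
  "level_O q g x \<longleftrightarrow> (\<exists>B\<ge>0. \<forall>n N. q ^ n \<le> N \<and> N < q ^ Suc n \<longrightarrow> cmod (x N) \<le> B * g n)"

lemma level_OI:
  assumes g: "\<And>n. g n \<ge> 0" and "\<And>n N. q ^ n \<le> N \<Longrightarrow> N < q ^ Suc n \<Longrightarrow> cmod (x N) \<le> B * g n"
  shows "level_O q g x"
proof -
  have "cmod (x N) \<le> max B 0 * g n" if "q ^ n \<le> N" "N < q ^ Suc n" for n N
    using assms(2)[OF that] mult_right_mono[OF max.cobounded1[of B 0] g[of n]] by simp
  then show ?thesis unfolding level_O_def by (intro exI[of _ "max B 0"]) auto
qed

lemma level_OE:
  assumes "level_O q g x"
  obtains B where "B \<ge> 0" "\<And>n N. q ^ n \<le> N \<Longrightarrow> N < q ^ Suc n \<Longrightarrow> cmod (x N) \<le> B * g n"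
  using assms unfolding level_O_def by blast

lemma level_O_mono:
  assumes "level_O q g x" "\<And>n. g n \<le> K * h n" "\<And>n. h n \<ge> 0"
  shows "level_O q h x"
proof -
  obtain B where B: "B \<ge> 0" "\<And>n N. q ^ n \<le> N \<Longrightarrow> N < q ^ Suc n \<Longrightarrow> cmod (x N) \<le> B * g n"
    using level_OE[OF assms(1)] by metis
  show ?thesis
  proof (rule level_OI[OF assms(3), where B = "B * K"])
    fix n N assume "q ^ n \<le> N" "N < q ^ Suc n"
    then have "cmod (x N) \<le> B * g n" by (rule B)
    also have "\<dots> \<le> B * (K * h n)" by (intro mult_left_mono assms B)
    finally show "cmod (x N) \<le> B * K * h n" by simp
  qed
qed

lemma level_O_mult:
  assumes "level_O q g x" "level_O q h y"
  shows "level_O q (\<lambda>n. g n * h n) (\<lambda>N. x N * y N)"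
proof -
  obtain B where B: "B \<ge> 0" "\<And>n N. q ^ n \<le> N \<Longrightarrow> N < q ^ Suc n \<Longrightarrow> cmod (x N) \<le> B * g n"
    using level_OE[OF assms(1)] by metis
  obtain C where C: "C \<ge> 0" "\<And>n N. q ^ n \<le> N \<Longrightarrow> N < q ^ Suc n \<Longrightarrow> cmod (y N) \<le> C * h n"
    using level_OE[OF assms(2)] by metis
  have "cmod (x N * y N) \<le> B * C * (g n * h n)" if "q ^ n \<le> N" "N < q ^ Suc n" for n N
  proof -
    have "cmod (x N) * cmod (y N) \<le> (B * g n) * (C * h n)"
      using B(2)[OF that] C(2)[OF that] by (intro mult_mono order_trans[OF norm_ge_zero]) auto
    then show ?thesis by (simp add: norm_mult ac_simps)
  qed
  then show ?thesis unfolding level_O_def using B(1) C(1) by (intro exI[of _ "B * C"]) auto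
qed

lemma level_O_add:
  assumes "level_O q g x" "level_O q g y"
  shows "level_O q g (\<lambda>N. x N + y N)"
proof -
  obtain B where B: "B \<ge> 0" "\<And>n N. q ^ n \<le> N \<Longrightarrow> N < q ^ Suc n \<Longrightarrow> cmod (x N) \<le> B * g n"
    using level_OE[OF assms(1)] by metis
  obtain C where C: "C \<ge> 0" "\<And>n N. q ^ n \<le> N \<Longrightarrow> N < q ^ Suc n \<Longrightarrow> cmod (y N) \<le> C * g n"
    using level_OE[OF assms(2)] by metis
  have "cmod (x N + y N) \<le> (B + C) * g n" if "q ^ n \<le> N" "N < q ^ Suc n" for n N
    using order_trans[OF norm_triangle_ineq add_mono[OF B(2)[OF that] C(2)[OF that]]]
    by (simp add: algebra_simps)
  then show ?thesis unfolding level_O_def using B(1) C(1) by (intro exI[of _ "B + C"]) auto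
qed

lemma level_O_sum:
  assumes "finite I" "\<And>i. i \<in> I \<Longrightarrow> level_O q g (x i)" "\<And>n. g n \<ge> 0"
  shows "level_O q g (\<lambda>N. \<Sum>i\<in>I. x i N)"
  using assms(1,2)
proof (induction I rule: finite_induct)
  case empty
  show ?case by (rule level_OI[where B=0]) (use assms in auto)
next
  case (insert i I)
  then show ?case by (simp add: level_O_add)
qed

lemma level_O_const_mult:
  assumes "level_O q g x"
  shows "level_O q g (\<lambda>N. c * x N)"
proof -
  obtain B where B: "B \<ge> 0" "\<And>n N. q ^ n \<le> N \<Longrightarrow> N < q ^ Suc n \<Longrightarrow> cmod (x N) \<le> B * g n"
    using level_OE[OF assms] by metis
  have "cmod (c * x N) \<le> cmod c * B * g n" if "q ^ n \<le> N" "N < q ^ Suc n" for n N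
    using mult_left_mono[OF B(2)[OF that], of "cmod c"] by (simp add: norm_mult ac_simps)
  then show ?thesis unfolding level_O_def using B(1) by (intro exI[of _ "cmod c * B"]) auto
qed

text \<open>The last bound places log_q(N + 1), like log_q N, in [n, n + 1], so that differences
  between consecutive arguments can be estimated on a single level.\<close>

lemma level_log:
  assumes "q \<ge> 2" "q ^ n \<le> N" "N < q ^ Suc n"
  shows "real n \<le> log (real q) (real N)" "log (real q) (real N) < real n + 1" "N \<ge> 1"
    "log (real q) (real (Suc N)) \<le> real n + 1"
proof -
  show N: "N \<ge> 1" using assms by (metis le_trans one_le_numeral one_le_power)
  have "real q powr real n \<le> real N" using assms by (simp add: powr_realpow flip: of_nat_power)
  then show "real n \<le> log (real q) (real N)" using assms N by (simp add: le_log_iff)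
  have "real N < real q powr (real n + 1)"
    using assms of_nat_less_iff[of N "q ^ Suc n", where ?'a = real] by (simp add: powr_add powr_realpow mult.commute)
  then show "log (real q) (real N) < real n + 1" using assms N by (simp add: log_less_iff)
  have "real (Suc N) \<le> real q powr (real n + 1)"
    using assms of_nat_le_iff[of "Suc N" "q ^ Suc n", where ?'a = real] by (simp add: powr_add powr_realpow mult.commute)
  then show "log (real q) (real (Suc N)) \<le> real n + 1" using assms N by (simp add: log_le_iff)
qed

lemma level_exists:
  fixes q N :: nat
  assumes "q \<ge> 2" "N \<ge> 1"
  obtains n where "q ^ n \<le> N" "N < q ^ Suc n"
  using ex_power_ivl1[OF assms] by auto

subsection \<open>Growth of solutions of the dilation recursion\<close>

lemma level_div:
  fixes q n N :: nat
  assumes q: "q \<ge> 2" and N: "q ^ Suc n \<le> N" "N < q ^ Suc (Suc n)"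
  shows "q ^ n \<le> N div q" "N div q < q ^ Suc n"
proof -
  show "q ^ n \<le> N div q" using div_le_mono[OF N(1), of q] q by simp
  show "N div q < q ^ Suc n" using N(2) q by (intro less_mult_imp_div_less) (simp add: mult.commute)
qed

text \<open>Write N = q M + r with M = N div q. The integers from q M to N all lie on the level of
  N, so going back to q M costs at most q increments, and at q M the recursion applies.\<close>

lemma dilation_step:
  fixes x y :: "nat \<Rightarrow> complex"
  assumes q: "q \<ge> 2" and scale: "\<And>N. N \<ge> 1 \<Longrightarrow> x (q * N) = lam * x N + y N"
    and inc: "\<And>n N. q ^ n \<le> N \<Longrightarrow> N < q ^ Suc n \<Longrightarrow> cmod (x (Suc N) - x N) \<le> C * g n"
    and N: "q ^ Suc n \<le> N" "N < q ^ Suc (Suc n)"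
  shows "cmod (x N) \<le> cmod lam * cmod (x (N div q)) + cmod (y (N div q)) + real q * (C * g (Suc n))"
proof -
  note 1 = level_div(1)[OF q N] and 2 = level_div(2)[OF q N]
  have M1: "N div q \<ge> 1" using level_log(3)[OF q 1 2] .
  have Cg: "0 \<le> C * g (Suc n)"
    by (rule order_trans[OF norm_ge_zero inc]) (use N in auto)
  have "cmod (x (q * (N div q) + k) - x (q * (N div q))) \<le> real k * (C * g (Suc n))" if "k \<le> N mod q" for k
    using that
  proof (induction k)
    case (Suc k)
    have "q * (N div q) + k < N" using Suc.prems mult_div_mod_eq[of q N] by linarith
    moreover have "q ^ Suc n \<le> q * (N div q) + k"
      unfolding power_Suc by (rule trans_le_add1[OF mult_le_mono2[OF 1]])
    ultimately have "cmod (x (Suc (q * (N div q) + k)) - x (q * (N div q) + k)) \<le> C * g (Suc n)"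
      using N(2) by (intro inc) linarith+
    moreover have "cmod (x (q * (N div q) + k) - x (q * (N div q))) \<le> real k * (C * g (Suc n))"
      using Suc by simp
    ultimately show ?case
      using norm_triangle_ineq[of "x (Suc (q * (N div q) + k)) - x (q * (N div q) + k)" "x (q * (N div q) + k) - x (q * (N div q))"]
      by (simp add: algebra_simps)
  qed simp
  from this[of "N mod q"] have "cmod (x N - x (q * (N div q))) \<le> real (N mod q) * (C * g (Suc n))" by simp
  also have "\<dots> \<le> real q * (C * g (Suc n))" using q Cg by (intro mult_right_mono) (auto simp: less_imp_le)
  finally have "cmod (x N) \<le> cmod (x (q * (N div q))) + real q * (C * g (Suc n))"
    using norm_triangle_sub[of "x N" "x (q * (N div q))"] by linarith
  also have "cmod (x (q * (N div q))) \<le> cmod lam * cmod (x (N div q)) + cmod (y (N div q))"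
    unfolding scale[OF M1] by (metis norm_mult norm_triangle_ineq)
  finally show ?thesis by simp
qed

lemma base_bound:
  fixes x :: "nat \<Rightarrow> complex"
  shows "\<exists>B\<ge>0. \<forall>N<q. cmod (x N) \<le> B"
  by (intro exI[of _ "\<Sum>N<q. cmod (x N)"]) (auto intro: member_le_sum sum_nonneg)

text \<open>Because |lam| < S, the recursion divided by S^n is a contraction; a bound of order S^n
  reproduces itself from level to level once its constant is large enough.\<close>

lemma dilation_growth_less:
  assumes q: "q \<ge> 2" and scale: "\<And>N. N \<ge> 1 \<Longrightarrow> x (q * N) = lam * x N + y N"
    and inc: "level_O q (\<lambda>n. S ^ n) (\<lambda>N. x (Suc N) - x N)"
    and y: "level_O q (\<lambda>n. S ^ n) y" and lam: "cmod lam < S"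
  shows "level_O q (\<lambda>n. S ^ n) x"
proof -
  have S: "S > 0" using lam norm_ge_zero[of lam] by linarith
  obtain C where C: "C \<ge> 0" "\<And>n N. q ^ n \<le> N \<Longrightarrow> N < q ^ Suc n \<Longrightarrow> cmod (x (Suc N) - x N) \<le> C * S ^ n"
    using level_OE[OF inc] by metis
  obtain B where B: "B \<ge> 0" "\<And>n N. q ^ n \<le> N \<Longrightarrow> N < q ^ Suc n \<Longrightarrow> cmod (y N) \<le> B * S ^ n"
    using level_OE[OF y] by metis
  obtain Z where Z: "Z \<ge> 0" "\<And>N. N < q \<Longrightarrow> cmod (x N) \<le> Z" using base_bound[of q x] by blast
  \<comment> \<open>The second summand is the fixed point of Y = (|lam| Y + B + q C S) / S; adding
    \<open>Z\<close> covers level 0.\<close>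
  define Y where "Y = Z + (B + real q * C * S) / (S - cmod lam)"
  have "(B + real q * C * S) / (S - cmod lam) \<ge> 0" using B C S lam by simp
  then have YZ: "Z \<le> Y" "Y \<ge> 0" using Z by (auto simp: Y_def)
  define D where "D = S - cmod lam"
  have D: "D > 0" using lam by (simp add: D_def)
  then have "Y * D = Z * D + (B + real q * C * S)"
    unfolding Y_def D_def[symmetric] by (simp add: distrib_right[of Z])
  then have "Y * (S - cmod lam) \<ge> B + real q * C * S" using Z D by (simp add: D_def[symmetric])
  then have Y: "cmod lam * Y + B + real q * C * S \<le> Y * S" by (simp add: algebra_simps)
  have "cmod (x N) \<le> Y * S ^ n" if "q ^ n \<le> N" "N < q ^ Suc n" for n N
    using that
  proof (induction n arbitrary: N)
    case 0 then show ?case using Z(2)[of N] YZ by simp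
  next
    case (Suc n)
    note st = level_div[OF q Suc.prems]
    have "cmod (x N) \<le> cmod lam * cmod (x (N div q)) + cmod (y (N div q)) + real q * (C * S ^ Suc n)"
      by (rule dilation_step[OF q scale C(2) Suc.prems])
    also have "\<dots> \<le> cmod lam * (Y * S ^ n) + B * S ^ n + real q * (C * S ^ Suc n)"
      by (intro order_refl add_mono mult_left_mono Suc.IH[OF st(1,2)] B(2)[OF st(1,2)]) auto
    also have "\<dots> = (cmod lam * Y + B + real q * C * S) * S ^ n" by (simp add: algebra_simps)
    also have "\<dots> \<le> (Y * S) * S ^ n" using Y S by (intro mult_right_mono) auto
    finally show ?case by simp
  qed
  then show ?thesis unfolding level_O_def using YZ by blast
qed

text \<open>When |lam| reaches S there is no contraction left: relative to S^n each level adds a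
  term of order n^p, and summing over the levels costs one further power of n.\<close>

lemma dilation_growth_le:
  assumes q: "q \<ge> 2" and scale: "\<And>N. N \<ge> 1 \<Longrightarrow> x (q * N) = lam * x N + y N"
    and inc: "level_O q (\<lambda>n. S ^ n) (\<lambda>N. x (Suc N) - x N)"
    and y: "level_O q (\<lambda>n. S ^ n * (real n + 1) ^ p) y" and lam: "cmod lam \<le> S" and S: "S > 0"
  shows "level_O q (\<lambda>n. S ^ n * (real n + 1) ^ Suc p) x"
proof -
  obtain C where C: "C \<ge> 0" "\<And>n N. q ^ n \<le> N \<Longrightarrow> N < q ^ Suc n \<Longrightarrow> cmod (x (Suc N) - x N) \<le> C * S ^ n"
    using level_OE[OF inc] by metis
  obtain B where B: "B \<ge> 0" "\<And>n N. q ^ n \<le> N \<Longrightarrow> N < q ^ Suc n \<Longrightarrow> cmod (y N) \<le> B * (S ^ n * (real n + 1) ^ p)"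
    using level_OE[OF y] by metis
  obtain Z where Z: "Z \<ge> 0" "\<And>N. N < q \<Longrightarrow> cmod (x N) \<le> Z" using base_bound[of q x] by blast
  \<comment> \<open>The cost of one level relative to S^(n+1). The value of \<open>y\<close> is
    taken one level lower, whence the division by \<open>S\<close>.\<close>
  define E where "E = B / S + real q * C"
  define Y where "Y = Z + E"
  have E0: "E \<ge> 0" using B C S by (simp add: E_def)
  have Y0: "Y \<ge> 0" using Z E0 by (simp add: Y_def)
  have "cmod (x N) \<le> Y * (S ^ n * (real n + 1) ^ Suc p)" if "q ^ n \<le> N" "N < q ^ Suc n" for n N
    using that
  proof (induction n arbitrary: N)
    case 0 then show ?case using Z(2)[of N] E0 by (simp add: Y_def)
  next
    case (Suc n)
    note st = level_div[OF q Suc.prems]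
    define u where "u = real n + 1"
    have u: "u \<ge> 1" by (simp add: u_def)
    have "cmod (x N) \<le> cmod lam * cmod (x (N div q)) + cmod (y (N div q)) + real q * (C * S ^ Suc n)"
      by (rule dilation_step[OF q scale C(2) Suc.prems])
    also have "\<dots> \<le> S * (Y * (S ^ n * u ^ Suc p)) + B * (S ^ n * u ^ p) + real q * (C * S ^ Suc n)"
      using S by (intro order_refl add_mono mult_mono Suc.IH[OF st(1,2), folded u_def]
          B(2)[OF st(1,2), folded u_def] lam) auto
    also have "\<dots> = S ^ Suc n * (Y * u ^ Suc p + B / S * u ^ p + real q * C)"
      using S by (simp add: algebra_simps)
    also have "\<dots> \<le> S ^ Suc n * (Y * u ^ Suc p + B / S * (u + 1) ^ p + real q * C * (u + 1) ^ p)"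
    proof -
      have "u ^ p \<le> (u + 1) ^ p" "1 \<le> (u + 1) ^ p" using u by (auto intro: power_mono one_le_power)
      then have "B / S * u ^ p \<le> B / S * (u + 1) ^ p" "real q * C * 1 \<le> real q * C * (u + 1) ^ p"
        using B(1) C(1) S by (blast intro: mult_left_mono divide_nonneg_pos mult_nonneg_nonneg of_nat_0_le_iff)+
      then show ?thesis using S by (intro mult_left_mono) auto
    qed
    also have "\<dots> = S ^ Suc n * (Y * u ^ Suc p + E * (u + 1) ^ p)" by (simp add: E_def algebra_simps)
    \<comment> \<open>Replace u^p by (u+1)^p and \<open>E\<close> by the larger \<open>Y\<close>;
      then u (u+1)^p + (u+1)^p = (u+1)^(p+1).\<close>
    also have "\<dots> \<le> S ^ Suc n * (Y * (u + 1) ^ Suc p)"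
    proof (rule mult_left_mono)
      have "Y * u ^ Suc p \<le> Y * (u * (u + 1) ^ p)"
        using u Y0 by (intro mult_left_mono) (auto intro!: mult_left_mono power_mono)
      moreover have "E * (u + 1) ^ p \<le> Y * (u + 1) ^ p" using Z u by (intro mult_right_mono) (auto simp: Y_def)
      ultimately show "Y * u ^ Suc p + E * (u + 1) ^ p \<le> Y * (u + 1) ^ Suc p" by (simp add: algebra_simps)
    qed (use S in auto)
    also have "\<dots> = Y * (S ^ Suc n * (real (Suc n) + 1) ^ Suc p)" by (simp add: u_def algebra_simps)
    finally show ?case .
  qed
  then show ?thesis unfolding level_O_def using Y0 by blast
qed

text \<open>Serves the degenerate case lam = R = 0. An eventually constant sequence is determined by
  any single late value, and at a multiple of q that value is supplied by \<open>y\<close>.\<close>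

lemma dilation_eventually_zero:
  assumes q: "q \<ge> 2" and scale: "\<And>N. N \<ge> 1 \<Longrightarrow> x (q * N) = y N"
    and inc: "\<forall>\<^sub>F N in sequentially. x (Suc N) = (x N :: complex)" and y: "\<forall>\<^sub>F N in sequentially. y N = 0"
  shows "\<forall>\<^sub>F N in sequentially. x N = 0"
proof -
  obtain N0 where N0: "\<And>N. N \<ge> N0 \<Longrightarrow> x (Suc N) = x N" using inc by (auto simp: eventually_sequentially)
  obtain N1 where N1: "\<And>N. N \<ge> N1 \<Longrightarrow> y N = 0" using y by (auto simp: eventually_sequentially)
  \<comment> \<open>\<open>M\<close> has to be late enough for \<open>x\<close> to be constant from
    there on, and M / q late enough for \<open>y\<close> to vanish.\<close>
  define M where "M = q * (N0 + N1 + 1)"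
  have "x M = 0" unfolding M_def by (subst scale) (auto intro: N1)
  have "1 * (N0 + N1 + 1) \<le> M" unfolding M_def using q by (intro mult_right_mono) auto
  then have MN: "M \<ge> N0" by simp
  have "x (M + k) = 0" for k
    by (induction k) (use \<open>x M = 0\<close> N0 MN in auto)
  then have "x N = 0" if "N \<ge> M" for N using that le_Suc_ex by metis
  then show ?thesis by (auto simp: eventually_sequentially)
qed

section \<open>Generalised binomial coefficients and complex powers\<close>

text \<open>The binomial coefficient of t over k as a polynomial in t. The expansion is wanted in
  powers of log_q N, so the individual coefficients are needed.\<close>

fun gbpoly :: "nat \<Rightarrow> real poly" where
  "gbpoly 0 = 1"
| "gbpoly (Suc k) = Polynomial.smult (1 / real (Suc k)) ([:- real k, 1:] * gbpoly k)"

lemma poly_gbpoly: "poly (gbpoly k) t = t gchoose k"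
proof (induction k)
  case (Suc k)
  have "t * (t gchoose k) = real k * (t gchoose k) + real (Suc k) * (t gchoose Suc k)"
    by (rule gbinomial_mult_1)
  then have "t gchoose Suc k = (1 / real (Suc k)) * ((t - real k) * (t gchoose k))"
    by (simp add: field_simps)
  with Suc show ?case by (simp add: algebra_simps)
qed simp

lemma degree_gbpoly: "Polynomial.degree (gbpoly k) \<le> k"
proof (induction k)
  case (Suc k)
  have "Polynomial.degree ([:- real k, 1:] * gbpoly k) \<le> 1 + k"
    using degree_mult_le[of "[:- real k, 1:]" "gbpoly k"] Suc by simp
  then show ?case using degree_smult_le order_trans by (fastforce simp del: mult_pCons_left)
qed simp

text \<open>This coefficient matches the factor 1/m! of \<open>theta\<close> and yields the 1/(m-1)!
  in the constant value of the last fluctuation.\<close>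

lemma coeff_gbpoly_top: "Polynomial.coeff (gbpoly k) k = 1 / fact k"
proof (induction k)
  case (Suc k)
  have "Polynomial.coeff (gbpoly k) (Suc k) = 0" using degree_gbpoly[of k] by (intro coeff_eq_0) simp
  with Suc show ?case by (simp add: mult.commute)
qed simp

lemma gchoose_expand:
  assumes "k \<le> m"
  shows "t gchoose k = (\<Sum>i\<le>m. Polynomial.coeff (gbpoly k) i * t ^ i)"
proof -
  have "t gchoose k = (\<Sum>i\<le>Polynomial.degree (gbpoly k). Polynomial.coeff (gbpoly k) i * t ^ i)"
    by (simp add: poly_gbpoly[symmetric] poly_altdef)
  also have "\<dots> = (\<Sum>i\<le>m. Polynomial.coeff (gbpoly k) i * t ^ i)"
    using degree_gbpoly[of k] assms by (intro sum.mono_neutral_left) (auto simp: coeff_eq_0)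
  finally show ?thesis .
qed

text \<open>Each step multiplies the absolute value by (t + k) / (k + 1), which is at most 1 +
  t.\<close>

lemma abs_gchoose_le:
  fixes t :: real
  assumes "t \<ge> 0" shows "\<bar>- t gchoose k\<bar> \<le> (1 + t) ^ k"
proof (induction k)
  case (Suc k)
  have "real (Suc k) * (- t gchoose Suc k) = (- t - real k) * (- t gchoose k)"
    using gbinomial_mult_1[of "- t" k] by (simp add: algebra_simps)
  then have "\<bar>real (Suc k) * (- t gchoose Suc k)\<bar> = \<bar>(- t - real k) * (- t gchoose k)\<bar>" by simp
  then have "real (Suc k) * \<bar>- t gchoose Suc k\<bar> = (t + real k) * \<bar>- t gchoose k\<bar>"
    using assms by (simp only: abs_mult abs_of_nat) simp
  also have "\<dots> \<le> (real (Suc k) * (1 + t)) * (1 + t) ^ k"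
    using assms Suc by (intro mult_mono) (auto simp: algebra_simps)
  finally have "real (Suc k) * \<bar>- t gchoose Suc k\<bar> \<le> real (Suc k) * (1 + t) ^ Suc k" by (simp add: mult.assoc)
  then show ?case by (subst (asm) mult_le_cancel_left_pos) auto
qed simp

text \<open>Product rule in the recursion (k + 1) binom(x, k + 1) = (x - k) binom(x, k): either the
  old coefficient changes or the linear factor does.\<close>

lemma gchoose_lipschitz:
  fixes s t :: real
  assumes "t \<ge> 0" "t \<le> s"
  shows "\<bar>(- s gchoose k) - (- t gchoose k)\<bar> \<le> real k * (1 + s) ^ k * (s - t)"
proof (induction k)
  case (Suc k)
  let ?D = "(- s gchoose k) - (- t gchoose k)"
  have "real (Suc k) * ((- s gchoose Suc k) - (- t gchoose Suc k)) =
    ?D * (- (s + real k)) + (- t gchoose k) * (t - s)"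
    using gbinomial_mult_1[of "- t" k] gbinomial_mult_1[of "- s" k] by (simp add: algebra_simps)
  then have "\<bar>real (Suc k) * ((- s gchoose Suc k) - (- t gchoose Suc k))\<bar> \<le>
    \<bar>?D * (- (s + real k))\<bar> + \<bar>(- t gchoose k) * (t - s)\<bar>"
    using abs_triangle_ineq[of "?D * (- (s + real k))" "(- t gchoose k) * (t - s)"] by presburger
  also have "\<bar>?D * (- (s + real k))\<bar> = \<bar>?D\<bar> * (s + real k)"
    unfolding abs_mult abs_minus_cancel using assms by simp
  also have "\<bar>(- t gchoose k) * (t - s)\<bar> = \<bar>- t gchoose k\<bar> * (s - t)"
    unfolding abs_mult using assms by simp
  also have "\<bar>?D\<bar> * (s + real k) + \<bar>- t gchoose k\<bar> * (s - t)
      \<le> (real k * (1 + s) ^ k * (s - t)) * (real (Suc k) * (1 + s)) + (1 + s) ^ k * (s - t)"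
  proof (intro add_mono mult_mono Suc)
    show "s + real k \<le> real (Suc k) * (1 + s)" using assms by (simp add: algebra_simps)
    show "\<bar>- t gchoose k\<bar> \<le> (1 + s) ^ k"
      using abs_gchoose_le[OF assms(1), of k] power_mono[of "1 + t" "1 + s" k] assms by simp
  qed (use assms in auto)
  also have "\<dots> \<le> (real k * (1 + s) ^ k * (s - t)) * (real (Suc k) * (1 + s)) + real (Suc k) * ((1 + s) * (1 + s) ^ k * (s - t))"
  proof -
    have "1 * ((1 + s) ^ k * (s - t)) \<le> (real (Suc k) * (1 + s)) * ((1 + s) ^ k * (s - t))"
      using assms by (intro mult_right_mono) (auto simp: algebra_simps intro: add_nonneg_nonneg)
    then show ?thesis by (simp add: algebra_simps)
  qed
  also have "\<dots> = real (Suc k) * (real (Suc k) * (1 + s) ^ Suc k * (s - t))" by (simp add: algebra_simps)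
  finally have "real (Suc k) * \<bar>(- s gchoose Suc k) - (- t gchoose Suc k)\<bar> \<le> real (Suc k) * (real (Suc k) * (1 + s) ^ Suc k * (s - t))"
    by (simp only: abs_mult abs_of_nat)
  then show ?case by (subst (asm) mult_le_cancel_left_pos) auto
qed simp

text \<open>Pascal's rule under the sum, leaving one boundary term. With sigma the shift of the
  sequence \<open>b\<close>, it expresses (1 + sigma)^s (1 + sigma) = (1 + sigma)^(s+1).\<close>

lemma gchoose_sum_shift:
  fixes b :: "nat \<Rightarrow> complex" and s :: real
  shows "(\<Sum>j\<le>M. of_real (s gchoose j) * (b j + b (Suc j))) =
    (\<Sum>j\<le>M. of_real ((s + 1) gchoose j) * b j) + of_real (s gchoose M) * b (Suc M)"
proof (induction M)
  case (Suc M)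
  have "complex_of_real ((s + 1) gchoose Suc M) = of_real (s gchoose M) + of_real (s gchoose Suc M)"
    by (simp add: gbinomial_Suc_Suc)
  with Suc show ?case by (simp add: ring_distribs)
qed simp

text \<open>With the nilpotent shift sigma of \<open>b\<close> this is (1 + sigma)^t (1 +
  sigma)^(-t) = 1; coefficientwise it is Vandermonde's identity for t + (-t) = 0.\<close>

lemma gchoose_inversion:
  fixes b :: "nat \<Rightarrow> complex" and t :: real
  assumes "\<And>i. i > m \<Longrightarrow> b i = 0"
  shows "(\<Sum>k\<le>m. of_real (t gchoose k) * (\<Sum>j\<le>m. of_real (- t gchoose j) * b (k + j))) = b 0"
proof -
  define g where "g k j = of_real (t gchoose k) * of_real (- t gchoose j) * b (k + j)" for k j
  have "(\<Sum>k\<le>m. of_real (t gchoose k) * (\<Sum>j\<le>m. of_real (- t gchoose j) * b (k + j))) = (\<Sum>(k,j)\<in>{..m}\<times>{..m}. g k j)"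
    by (simp add: sum.cartesian_product[symmetric] sum_distrib_left g_def mult.assoc)
  \<comment> \<open>Since \<open>b\<close> vanishes beyond m, the square shrinks to a triangle,
    which can be summed along its diagonals.\<close>
  also have "\<dots> = (\<Sum>(k,j)\<in>{(k,j). k + j \<le> m}. g k j)"
  proof (rule sum.mono_neutral_right)
    have "g k j = 0" if "\<not> k + j \<le> m" for k j using that assms[of "k + j"] by (simp add: g_def)
    then show "\<forall>i\<in>{..m} \<times> {..m} - {(k, j). k + j \<le> m}. (case i of (k, j) \<Rightarrow> g k j) = 0" by auto
  qed auto
  also have "\<dots> = (\<Sum>s\<le>m. \<Sum>k\<le>s. g k (s - k))" by (rule sum.triangle_reindex_eq)
  also have "\<dots> = (\<Sum>s\<le>m. of_real (0 gchoose s) * b s)"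
  proof (rule sum.cong[OF refl])
    fix s
    have "(\<Sum>k\<le>s. g k (s - k)) = (\<Sum>k\<le>s. of_real ((t gchoose k) * (- t gchoose (s - k))) * b s)"
      by (intro sum.cong) (auto simp: g_def)
    also have "\<dots> = of_real (\<Sum>k\<le>s. (t gchoose k) * (- t gchoose (s - k))) * b s"
      by (simp add: sum_distrib_right)
    also have "(\<Sum>k\<le>s. (t gchoose k) * (- t gchoose (s - k))) = (t + - t) gchoose s"
      using gbinomial_Vandermonde[of t "- t" s] by (simp add: atLeast0AtMost)
    finally show "(\<Sum>k\<le>s. g k (s - k)) = of_real (0 gchoose s) * b s" by simp
  qed
  also have "\<dots> = (\<Sum>s\<in>{0}. of_real (0 gchoose s) * b s)"
    by (intro sum.mono_neutral_right) (auto simp: gbinomial_0_left)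
  finally show ?thesis by simp
qed

section \<open>Real powers of a complex number\<close>

definition cpow :: "complex \<Rightarrow> real \<Rightarrow> complex" where
  "cpow lam t = exp (of_real t * Ln lam)"

lemma cpow_add: "cpow lam (s + t) = cpow lam s * cpow lam t"
  by (simp add: cpow_def ring_distribs exp_add)

lemma cpow_0 [simp]: "cpow lam 0 = 1" by (simp add: cpow_def)

lemma cpow_1 [simp]: "lam \<noteq> 0 \<Longrightarrow> cpow lam 1 = lam" by (simp add: cpow_def)

lemma cpow_minus: "cpow lam (- t) = inverse (cpow lam t)"
  by (simp add: cpow_def exp_minus)

lemma cpow_nonzero [simp]: "cpow lam t \<noteq> 0" by (simp add: cpow_def)

text \<open>Exchanges base and exponent, N^(log_q lam) = lam^(log_q N): both are the exponential of
  Ln lam ln N / ln q. The second form simply gains a factor lam when N becomes q N.\<close>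

lemma cpow_powr:
  assumes "N \<ge> 1" "q \<ge> 2"
  shows "of_nat N powr (Ln lam / of_real (ln (real q))) = cpow lam (log (real q) (real N))"
proof -
  have "Ln (of_nat N) = of_real (ln (real N))" using assms Ln_of_real[of "real N"] by simp
  then show ?thesis using assms by (simp add: powr_def cpow_def log_def mult.commute)
qed

lemma norm_exp_minus_1_le: "cmod (exp z - 1) \<le> cmod z * exp (cmod z)"
proof -
  have "cmod (exp z - exp 0) \<le> exp (cmod z) * cmod (z - 0)"
  proof (rule field_differentiable_bound[of "cball 0 (cmod z)"])
    show "(exp has_field_derivative exp w) (at w within cball 0 (cmod z))" for w
      by (rule DERIV_exp[THEN has_field_derivative_at_within])
    show "cmod (exp w) \<le> exp (cmod z)" if "w \<in> cball 0 (cmod z)" for w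
      using that norm_exp[of w] by (simp add: order_trans)
  qed auto
  then show ?thesis by (simp add: mult.commute)
qed

text \<open>Split off the integer n from the exponent; the rest lies in [0, 1] and costs only a
  constant.\<close>

lemma norm_cpow_minus_le:
  assumes "lam \<noteq> 0" "real n \<le> t" "t \<le> real n + 1"
  shows "cmod (cpow lam (- t)) \<le> exp (cmod (Ln lam)) * (1 / cmod lam) ^ n"
proof -
  have "cpow lam (- t) = cpow lam (- (t - real n)) * cpow lam (- real n)"
    by (simp add: cpow_add[symmetric])
  moreover have "cpow lam (- real n) = (1 / lam) ^ n"
    using assms by (simp add: cpow_def exp_minus exp_of_nat_mult field_simps)
  moreover have "cmod (cpow lam (- (t - real n))) \<le> exp (cmod (Ln lam))"
  proof -
    have "cmod (cpow lam (- (t - real n))) \<le> exp (cmod (of_real (- (t - real n)) * Ln lam))"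
      unfolding cpow_def by (rule norm_exp)
    also have "cmod (of_real (- (t - real n)) * Ln lam) \<le> 1 * cmod (Ln lam)"
      unfolding norm_mult norm_of_real using assms by (intro mult_right_mono) auto
    finally show ?thesis by simp
  qed
  ultimately show ?thesis
    by (simp add: norm_mult norm_divide norm_power divide_right_mono power_one_over)
qed

lemma level_log_diff:
  assumes "q \<ge> 2" "q ^ n \<le> N"
  shows "0 \<le> log (real q) (real (Suc N)) - log (real q) (real N)"
    "log (real q) (real (Suc N)) - log (real q) (real N) \<le> (1 / ln (real q)) * (1 / real q) ^ n"
proof -
  have N: "N \<ge> 1" using assms by (metis le_trans one_le_numeral one_le_power)
  show "0 \<le> log (real q) (real (Suc N)) - log (real q) (real N)" using assms N by simp
  have "ln (real (Suc N)) - ln (real N) = ln (1 + 1 / real N)"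
  proof -
    have "1 + 1 / real N = real (Suc N) / real N" using N by (simp add: field_simps)
    then show ?thesis using N by (simp only: ln_div) simp
  qed
  also have "\<dots> \<le> 1 / real N" using N by (intro ln_add_one_self_le_self) auto
  also have "\<dots> \<le> 1 / real q ^ n" using assms N by (intro divide_left_mono) (auto simp flip: of_nat_power)
  finally have "(ln (real (Suc N)) - ln (real N)) / ln (real q) \<le> (1 / real q ^ n) / ln (real q)"
    using assms by (intro divide_right_mono) auto
  then show "log (real q) (real (Suc N)) - log (real q) (real N) \<le> (1 / ln (real q)) * (1 / real q) ^ n"
    by (simp add: log_def diff_divide_distrib power_one_over mult.commute)
qed

text \<open>The coefficients of \<open>C\<^sup>-\<^sup>t\<close> in the basis \<open>(C - \<lambda>)\<^sup>j\<close> of the generalised eigenspace, up to a factor \<open>\<lambda>\<^sup>j\<close>.\<close>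

definition cbin :: "complex \<Rightarrow> nat \<Rightarrow> real \<Rightarrow> complex" where
  "cbin lam j t = of_real (- t gchoose j) * cpow lam (- t)"

text \<open>Taken at N + 1 because in the discrete product rule the increment of the chain entry is
  multiplied by the new value of its coefficient.\<close>

lemma cbin_level:
  assumes q: "q \<ge> 2" and lam: "lam \<noteq> 0"
  shows "level_O q (\<lambda>n. (real n + 2) ^ j * (1 / cmod lam) ^ n) (\<lambda>N. cbin lam j (log (real q) (real (Suc N))))"
proof (rule level_OI[where B = "exp (cmod (Ln lam))"])
  fix n N assume N: "q ^ n \<le> N" "N < q ^ Suc n"
  define s where "s = log (real q) (real (Suc N))"
  have s: "real n \<le> s" "s \<le> real n + 1"
    using level_log[OF q N] level_log_diff[OF q N(1)] by (auto simp: s_def)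
  have "\<bar>- s gchoose j\<bar> \<le> (real n + 2) ^ j"
    using abs_gchoose_le[of s j] power_mono[of "1 + s" "real n + 2" j] s by simp
  then have "cmod (cbin lam j s) \<le> (real n + 2) ^ j * (exp (cmod (Ln lam)) * (1 / cmod lam) ^ n)"
    unfolding cbin_def norm_mult norm_of_real using norm_cpow_minus_le[OF lam s]
    by (intro mult_mono) auto
  then show "cmod (cbin lam j s) \<le> exp (cmod (Ln lam)) * ((real n + 2) ^ j * (1 / cmod lam) ^ n)"
    by (simp add: ac_simps)
qed auto

text \<open>The coefficient is Lipschitz in t with a constant of the same order as the bound in
  \<open>cbin_level\<close>, and log_q N moves only by O(q^(-n)) from N to N + 1.\<close>

lemma cbin_diff_level:
  assumes q: "q \<ge> 2" and lam: "lam \<noteq> 0"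
  shows "level_O q (\<lambda>n. ((real n + 2) ^ j * (1 / cmod lam) ^ n) * (1 / real q) ^ n)
    (\<lambda>N. cbin lam j (log (real q) (real (Suc N))) - cbin lam j (log (real q) (real N)))"
proof (rule level_OI)
  fix n N assume N: "q ^ n \<le> N" "N < q ^ Suc n"
  define E where "E = exp (cmod (Ln lam))"
  define s where "s = log (real q) (real (Suc N))"
  define t where "t = log (real q) (real N)"
  define L where "L = (1 / cmod lam) ^ n"
  define P where "P = (real n + 2) ^ j"
  have st: "real n \<le> t" "t \<le> s" "s \<le> real n + 1" "s - t \<le> (1 / ln (real q)) * (1 / real q) ^ n"
    using level_log[OF q N] level_log_diff[OF q N(1)] by (auto simp: s_def t_def)
  have P0: "P \<ge> 0" "L \<ge> 0" by (auto simp: P_def L_def)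
  have ct: "cmod (cpow lam (- t)) \<le> E * L"
    unfolding E_def L_def by (rule norm_cpow_minus_le[OF lam]) (use st in auto)
  have Ps: "(1 + s) ^ j \<le> P" unfolding P_def using st by (intro power_mono) auto
  \<comment> \<open>Product rule after extracting lam^(-t): the first summand is the change of the
    power, the second that of the binomial coefficient.\<close>
  have "cbin lam j s - cbin lam j t =
    cpow lam (- t) * (of_real (- s gchoose j) * (cpow lam (- (s - t)) - 1) + of_real ((- s gchoose j) - (- t gchoose j)))"
    using cpow_add[of lam "- t" "- (s - t)"] by (simp add: cbin_def algebra_simps)
  also have "cmod \<dots> \<le> (E * L) * (P * (cmod (Ln lam) * E * (s - t)) + real j * P * (s - t))"
    unfolding norm_mult
  proof (intro mult_mono ct order_trans[OF norm_triangle_ineq] add_mono)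
    have "cmod (cpow lam (- (s - t)) - 1) \<le> cmod (of_real (- (s - t)) * Ln lam) * exp (cmod (of_real (- (s - t)) * Ln lam))"
      unfolding cpow_def by (rule norm_exp_minus_1_le)
    also have "\<dots> \<le> (cmod (Ln lam) * (s - t)) * E"
    proof -
      have "cmod (of_real (- (s - t)) * Ln lam) = cmod (Ln lam) * (s - t)"
        unfolding norm_mult norm_of_real using st by simp
      moreover have "cmod (Ln lam) * (s - t) \<le> cmod (Ln lam) * 1" using st by (intro mult_left_mono) auto
      ultimately show ?thesis using st by (auto simp: E_def intro!: mult_left_mono)
    qed
    finally have *: "cmod (cpow lam (- (s - t)) - 1) \<le> cmod (Ln lam) * E * (s - t)" by (simp add: ac_simps)
    have "\<bar>- s gchoose j\<bar> \<le> P" using abs_gchoose_le[of s j] Ps st by simp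
    with * show "cmod (of_real (- s gchoose j) * (cpow lam (- (s - t)) - 1)) \<le> P * (cmod (Ln lam) * E * (s - t))"
      unfolding norm_mult norm_of_real using P0 by (intro mult_mono) auto
    have "\<bar>(- s gchoose j) - (- t gchoose j)\<bar> \<le> real j * (1 + s) ^ j * (s - t)"
      using st by (intro gchoose_lipschitz) auto
    also have "\<dots> \<le> real j * P * (s - t)" using st Ps by (intro mult_right_mono mult_left_mono) auto
    finally show "cmod (of_real ((- s gchoose j) - (- t gchoose j))) \<le> real j * P * (s - t)"
      unfolding norm_of_real .
  qed (use P0 in \<open>auto simp: E_def\<close>)
  also have "\<dots> = (E * (cmod (Ln lam) * E + real j)) * (P * L) * (s - t)" by (simp add: algebra_simps)
  also have "\<dots> \<le> (E * (cmod (Ln lam) * E + real j)) * (P * L) * ((1 / ln (real q)) * (1 / real q) ^ n)"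
    using st P0 by (intro mult_left_mono mult_nonneg_nonneg add_nonneg_nonneg) (auto simp: E_def)
  finally show "cmod (cbin lam j s - cbin lam j t) \<le>
    (exp (cmod (Ln lam)) * (cmod (Ln lam) * exp (cmod (Ln lam)) + real j) / ln (real q)) * (((real n + 2) ^ j * (1 / cmod lam) ^ n) * (1 / real q) ^ n)"
    by (simp add: E_def P_def L_def)
qed auto

section \<open>Periodic fluctuations of a dilation chain\<close>

text \<open>On the chain scaled by lam^(-k), the map N to q N acts as lam (1 + sigma), with sigma
  the shift to the next entry. With t = log_q N this is the binomial series of (lam (1 +
  sigma))^(-t) applied to entry k; it may stop at j = m because the chain does.\<close>

definition dil_p :: "nat \<Rightarrow> nat \<Rightarrow> complex \<Rightarrow> (nat \<Rightarrow> nat \<Rightarrow> complex) \<Rightarrow> nat \<Rightarrow> nat \<Rightarrow> complex" where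
  "dil_p q m lam a k N = (\<Sum>j\<le>m. cbin lam j (log (real q) (real N)) * (a (k + j) N / lam ^ (k + j)))"

text \<open>The coefficient of t^i when the sum over k of binom(t, k) times the limit of p k is
  rearranged by powers of t.\<close>

definition dil_phi :: "nat \<Rightarrow> nat \<Rightarrow> complex \<Rightarrow> (nat \<Rightarrow> nat \<Rightarrow> complex) \<Rightarrow> nat \<Rightarrow> real \<Rightarrow> complex" where
  "dil_phi q m lam a i u = (\<Sum>k\<le>m. of_real (Polynomial.coeff (gbpoly k) i) * qlim q (dil_p q m lam a k) u)"

text \<open>The strict inequality leaves room: \<theta>^n is q^(-\<alpha> n) times \<tau>^n with
  \<tau> < 1, and \<tau>^n absorbs the polynomial factor.\<close>

lemma level_O_powr:
  assumes q: "q \<ge> 2" and x: "level_O q (\<lambda>n. (real n + 2) ^ E * \<theta> ^ n) x"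
    and \<theta>: "0 < \<theta>" "\<theta> * real q powr \<alpha> < 1"
  shows "\<exists>c. \<forall>N\<ge>1. cmod (x N) \<le> c * real N powr - \<alpha>"
proof -
  define \<tau> where "\<tau> = \<theta> * real q powr \<alpha>"
  have \<tau>: "0 < \<tau>" "\<tau> < 1" using q \<theta> by (auto simp: \<tau>_def)
  obtain P where P: "\<And>n. 1 * \<tau> ^ n * real n ^ E \<le> P"
    using poly_exp_constant_bound[OF \<tau>, of 1 E] by blast
  obtain B where B: "B \<ge> 0" "\<And>n N. q ^ n \<le> N \<Longrightarrow> N < q ^ Suc n \<Longrightarrow> cmod (x N) \<le> B * ((real n + 2) ^ E * \<theta> ^ n)"
    using level_OE[OF x] by metis
  have P0: "P \<ge> 0" using P[of 1] \<tau> by (simp add: order_trans[OF less_imp_le])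
  \<comment> \<open>Dividing by the square of \<tau> undoes the shift from n to n + 2; the maximum
    compares q^(-\<alpha> n) with N^(-\<alpha>) within a level, for either sign of \<alpha>.\<close>
  define c where "c = B * (P / \<tau>\<^sup>2) * max 1 (real q powr \<alpha>)"
  have "cmod (x N) \<le> c * real N powr - \<alpha>" if N1: "N \<ge> 1" for N
  proof -
    obtain n where n: "q ^ n \<le> N" "N < q ^ Suc n" using level_exists[OF q N1] .
    define t where "t = log (real q) (real N)"
    have t: "real n \<le> t" "t < real n + 1" using level_log[OF q n] by (auto simp: t_def)
    have Nt: "real N = real q powr t" using q N1 by (simp add: t_def)
    have "\<theta> = \<tau> * real q powr - \<alpha>" using q by (simp add: \<tau>_def powr_minus field_simps)
    then have "(real n + 2) ^ E * \<theta> ^ n = (\<tau> ^ n * (real n + 2) ^ E) * (real q powr - \<alpha>) ^ n"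
      by (simp add: power_mult_distrib)
    also have "\<tau> ^ n * (real n + 2) ^ E = (1 * \<tau> ^ (n + 2) * real (n + 2) ^ E) / \<tau>\<^sup>2"
      using \<tau> by (simp add: power_add power2_eq_square add.commute)
    also have "\<dots> * (real q powr - \<alpha>) ^ n \<le> (P / \<tau>\<^sup>2) * (max 1 (real q powr \<alpha>) * real N powr - \<alpha>)"
    proof (intro mult_mono divide_right_mono P)
      have "(real q powr - \<alpha>) ^ n = real q powr (- \<alpha> * real n)"
        using q by (simp add: powr_realpow[symmetric] powr_powr)
      also have "\<dots> = real q powr (\<alpha> * (t - real n)) * real N powr - \<alpha>"
        by (simp add: Nt powr_powr powr_add[symmetric] algebra_simps)
      also have "real q powr (\<alpha> * (t - real n)) \<le> max 1 (real q powr \<alpha>)"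
      proof (cases "\<alpha> \<ge> 0")
        case True
        have "\<alpha> * (t - real n) \<le> \<alpha> * 1" using t True by (intro mult_left_mono) auto
        then show ?thesis using q by (intro max.coboundedI2 powr_mono) auto
      next
        case False
        then have "\<alpha> * (t - real n) \<le> 0" using t by (simp add: mult_nonpos_nonneg)
        then have "real q powr (\<alpha> * (t - real n)) \<le> real q powr 0" using q by (intro powr_mono) auto
        then show ?thesis using q by simp
      qed
      finally show "(real q powr - \<alpha>) ^ n \<le> max 1 (real q powr \<alpha>) * real N powr - \<alpha>"
        by (simp add: mult_right_mono)
    qed (use P0 in auto)
    finally have "B * ((real n + 2) ^ E * \<theta> ^ n) \<le> B * ((P / \<tau>\<^sup>2) * (max 1 (real q powr \<alpha>) * real N powr - \<alpha>))"
      using B(1) by (intro mult_left_mono) auto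
    with B(2)[OF n] show ?thesis by (simp add: c_def ac_simps)
  qed
  then show ?thesis by blast
qed

lemma qlim_const:
  assumes q: "q \<ge> 2" and p: "\<And>N. N \<ge> 1 \<Longrightarrow> p N = b"
  shows "qlim q p u = b"
proof -
  have "\<forall>\<^sub>F n in sequentially. p (nat \<lfloor>real q powr (real n + u)\<rfloor>) = b"
    using eventually_ge_at_top[of "nat \<lceil>-u\<rceil>"]
  proof eventually_elim
    case (elim n)
    then have "real n + u \<ge> 0" by linarith
    then have "real q powr (real n + u) \<ge> 1" using q by (intro ge_one_powr_ge_zero) auto
    then have "nat \<lfloor>real q powr (real n + u)\<rfloor> \<ge> 1" by linarith
    then show ?case by (rule p)
  qed
  then have "(\<lambda>n. p (nat \<lfloor>real q powr (real n + u)\<rfloor>)) \<longlonglongrightarrow> b" by (rule tendsto_eventually)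
  then show ?thesis unfolding qlim_def by (rule limI)
qed

lemma dil_p_last:
  assumes "\<And>i. i > k \<Longrightarrow> a i N = 0"
  shows "dil_p q m lam a k N = cpow lam (- log (real q) (real N)) * (a k N / lam ^ k)"
proof -
  have "dil_p q m lam a k N = (\<Sum>j\<in>{0}. cbin lam j (log (real q) (real N)) * (a (k + j) N / lam ^ (k + j)))"
    unfolding dil_p_def using assms by (intro sum.mono_neutral_right) auto
  then show ?thesis by (simp add: cbin_def)
qed

text \<open>Only k = i contributes: below i the polynomial binom(t, k) has no term t^i, above i the
  chain is zero. The remaining p i is constant, and 1/i! is the leading coefficient.\<close>

lemma dil_phi_last:
  assumes q: "q \<ge> 2" and i: "i \<le> m" and z: "\<And>k N. i < k \<Longrightarrow> N \<ge> 1 \<Longrightarrow> a k N = 0"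
    and b: "\<And>N. N \<ge> 1 \<Longrightarrow> cpow lam (- log (real q) (real N)) * (a i N / lam ^ i) = b"
  shows "dil_phi q m lam a i u = b / fact i"
proof -
  have "of_real (Polynomial.coeff (gbpoly k) i) * qlim q (dil_p q m lam a k) u = 0" if "k \<noteq> i" for k
  proof (cases "k < i")
    case True
    then have "Polynomial.coeff (gbpoly k) i = 0" using degree_gbpoly[of k] by (intro coeff_eq_0) simp
    then show ?thesis by simp
  next
    case False
    then have "k > i" using that by simp
    then have "dil_p q m lam a k N = 0" if "N \<ge> 1" for N
      using dil_p_last[of k a N q m lam] z that by simp
    then have "qlim q (dil_p q m lam a k) u = 0" by (rule qlim_const[OF q])
    then show ?thesis by simp
  qed
  then have "dil_phi q m lam a i u = of_real (Polynomial.coeff (gbpoly i) i) * qlim q (dil_p q m lam a i) u"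
    unfolding dil_phi_def using i by (subst sum.mono_neutral_right[of _ "{i}"]) auto
  moreover have "qlim q (dil_p q m lam a i) u = b"
    using z b by (intro qlim_const[OF q]) (simp add: dil_p_last)
  ultimately show ?thesis by (simp add: coeff_gbpoly_top)
qed

context
  fixes q m :: nat and lam :: complex and a :: "nat \<Rightarrow> nat \<Rightarrow> complex" and R :: real
  assumes q: "q \<ge> 2"
    and scale: "\<And>k N. N \<ge> 1 \<Longrightarrow> a k (q * N) = lam * a k N + a (Suc k) N"
    and inc: "\<And>k. level_O q (\<lambda>n. R ^ n) (\<lambda>N. a k (Suc N) - a k N)"
    and top: "\<And>k N. k > m \<Longrightarrow> a k N = 0"
    and R: "R > 0" "R < cmod lam" "cmod lam \<le> real q * R"
begin

private lemma lam0: "lam \<noteq> 0" using R by auto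

text \<open>The increments are O(R^n), hence O(|lam|^n), so each step down from the zero entry with
  index m + 1 costs at most one power of n. The exponent is generous, since powers of n are absorbed
  later.\<close>

private lemma a_level: "level_O q (\<lambda>n. cmod lam ^ n * (real n + 2) ^ Suc m) (a k)"
proof -
  have *: "level_O q (\<lambda>n. cmod lam ^ n * (real n + 1) ^ i) (a (Suc m - i))" if "i \<le> Suc m" for i
    using that
  proof (induction i)
    case 0
    show ?case by (rule level_OI[where B = 0]) (auto simp: top)
  next
    case (Suc i)
    have e: "Suc (Suc m - Suc i) = Suc m - i" using Suc.prems by simp
    show ?case
    proof (rule dilation_growth_le[OF q])
      show "a (Suc m - Suc i) (q * N) = lam * a (Suc m - Suc i) N + a (Suc m - i) N" if "N \<ge> 1" for N
        using scale[OF that, of "Suc m - Suc i"] unfolding e .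
      show "level_O q (\<lambda>n. cmod lam ^ n) (\<lambda>N. a (Suc m - Suc i) (Suc N) - a (Suc m - Suc i) N)"
        by (rule level_O_mono[OF inc, where K = 1]) (use R in \<open>auto intro!: power_mono\<close>)
    qed (use Suc R in auto)
  qed
  show ?thesis
  proof (cases "k \<le> m")
    case True
    have "level_O q (\<lambda>n. cmod lam ^ n * (real n + 1) ^ (Suc m - k)) (a k)"
      using *[of "Suc m - k"] True by simp
    then show ?thesis
    proof (rule level_O_mono[where K = 1])
      fix n
      have "(real n + 1) ^ (Suc m - k) \<le> (real n + 2) ^ (Suc m - k)" by (intro power_mono) auto
      also have "\<dots> \<le> (real n + 2) ^ Suc m" by (intro power_increasing) auto
      finally show "cmod lam ^ n * (real n + 1) ^ (Suc m - k) \<le> 1 * (cmod lam ^ n * (real n + 2) ^ Suc m)"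
        by (simp add: mult_left_mono)
    qed auto
  next
    case False
    then show ?thesis by (intro level_OI[where B = 0]) (auto simp: top)
  qed
qed

text \<open>Passing to q N adds 1 to the logarithm and applies lam (1 + sigma) to the chain; the two
  effects cancel by Pascal's rule. The boundary term contains an entry beyond m, which is
  zero.\<close>

lemma dil_p_scale:
  assumes N: "N \<ge> 1"
  shows "dil_p q m lam a k (q * N) = dil_p q m lam a k N"
proof -
  define t where "t = log (real q) (real N)"
  define b where "b j = a (k + j) N / lam ^ (k + j)" for j
  have t: "log (real q) (real (q * N)) = t + 1" using q N by (simp add: t_def log_mult)
  have b: "a (k + j) (q * N) / lam ^ (k + j) = lam * (b j + b (Suc j))" for j
    using scale[OF N, of "k + j"] lam0 by (simp add: b_def field_simps)
  have c: "cpow lam (- (t + 1)) * lam = cpow lam (- t)"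
    using lam0 cpow_add[of lam "- (t + 1)" 1] by simp
  have "dil_p q m lam a k (q * N) = (\<Sum>j\<le>m. (cpow lam (- (t + 1)) * lam) * (of_real (- (t + 1) gchoose j) * (b j + b (Suc j))))"
    unfolding dil_p_def t b cbin_def by (intro sum.cong) (auto simp: ac_simps)
  also have "\<dots> = cpow lam (- t) * (\<Sum>j\<le>m. of_real (- (t + 1) gchoose j) * (b j + b (Suc j)))"
    unfolding c sum_distrib_left ..
  also have "(\<Sum>j\<le>m. of_real (- (t + 1) gchoose j) * (b j + b (Suc j))) = (\<Sum>j\<le>m. of_real (- t gchoose j) * b j)"
    using gchoose_sum_shift[where s = "- (t + 1)" and M = m and b = b] top by (simp add: b_def)
  finally show ?thesis
    by (simp add: dil_p_def sum_distrib_left cbin_def b_def t_def ac_simps)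
qed

text \<open>Discrete product rule. Up to powers of n, a change of the chain entry contributes
  (R/|lam|)^n, while a change of the coefficient contributes q^(-n), as the factors |lam|^n cancel.
  The bound |lam| <= q R says that 1/q <= R/|lam|, so the first rate dominates.\<close>

private lemma dil_p_level:
  "level_O q (\<lambda>n. (real n + 2) ^ (m + Suc m) * (R / cmod lam) ^ n) (\<lambda>N. dil_p q m lam a k (Suc N) - dil_p q m lam a k N)"
proof -
  define c1 where "c1 j N = cbin lam j (log (real q) (real (Suc N)))" for j N
  define c0 where "c0 j N = cbin lam j (log (real q) (real N))" for j N
  have eq: "dil_p q m lam a k (Suc N) - dil_p q m lam a k N =
    (\<Sum>j\<le>m. 1 / lam ^ (k + j) * (c1 j N * (a (k + j) (Suc N) - a (k + j) N)) + 1 / lam ^ (k + j) * ((c1 j N - c0 j N) * a (k + j) N))" for N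
    unfolding dil_p_def sum_subtractf[symmetric] c1_def c0_def
    by (intro sum.cong refl) (simp add: diff_divide_distrib algebra_simps)
  have up: "(real n + 2) ^ j \<le> (real n + 2) ^ i" if "j \<le> i" for n i j using that by (intro power_increasing) auto
  show ?thesis unfolding eq
  proof (intro level_O_sum level_O_add level_O_const_mult)
    fix j assume "j \<in> {..m}"
    then have j: "j \<le> m" by simp
    show "level_O q (\<lambda>n. (real n + 2) ^ (m + Suc m) * (R / cmod lam) ^ n) (\<lambda>N. c1 j N * (a (k + j) (Suc N) - a (k + j) N))"
      unfolding c1_def
    proof (rule level_O_mono[OF level_O_mult[OF cbin_level[OF q lam0] inc], where K = 1])
      fix n
      have "(real n + 2) ^ j * (1 / cmod lam) ^ n * R ^ n = (real n + 2) ^ j * (R / cmod lam) ^ n"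
        by (simp add: power_divide)
      also have "\<dots> \<le> (real n + 2) ^ (m + Suc m) * (R / cmod lam) ^ n"
        using j R by (intro mult_right_mono up) auto
      finally show "(real n + 2) ^ j * (1 / cmod lam) ^ n * R ^ n \<le> 1 * ((real n + 2) ^ (m + Suc m) * (R / cmod lam) ^ n)" by simp
    qed (use R in auto)
    show "level_O q (\<lambda>n. (real n + 2) ^ (m + Suc m) * (R / cmod lam) ^ n) (\<lambda>N. (c1 j N - c0 j N) * a (k + j) N)"
      unfolding c1_def c0_def
    proof (rule level_O_mono[OF level_O_mult[OF cbin_diff_level[OF q lam0] a_level], where K = 1])
      fix n
      have "(real n + 2) ^ j * (1 / cmod lam) ^ n * (1 / real q) ^ n * (cmod lam ^ n * (real n + 2) ^ Suc m) =
        ((real n + 2) ^ j * (real n + 2) ^ Suc m) * (1 / real q) ^ n"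
        using lam0 by (simp add: power_divide)
      also have "\<dots> = (real n + 2) ^ (j + Suc m) * (1 / real q) ^ n" by (simp only: power_add)
      also have "\<dots> \<le> (real n + 2) ^ (m + Suc m) * (R / cmod lam) ^ n"
      proof (intro mult_mono up power_mono)
        show "1 / real q \<le> R / cmod lam" using R q lam0 by (simp add: field_simps)
      qed (use j in auto)
      finally show "(real n + 2) ^ j * (1 / cmod lam) ^ n * (1 / real q) ^ n * (cmod lam ^ n * (real n + 2) ^ Suc m)
        \<le> 1 * ((real n + 2) ^ (m + Suc m) * (R / cmod lam) ^ n)" by simp
    qed (use R in auto)
  qed (use R in auto)
qed

private lemma dil_p_inc:
  assumes "R * real q powr \<alpha> < cmod lam"
  shows "\<exists>c. \<forall>N\<ge>1. cmod (dil_p q m lam a k (Suc N) - dil_p q m lam a k N) \<le> c * real N powr - \<alpha>"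
  by (rule level_O_powr[OF q dil_p_level]) (use assms R lam0 in \<open>auto simp: field_simps\<close>)

text \<open>Half of log_q(|lam|/R) will do. Periodicity, continuity and the expansion need just one
  positive exponent.\<close>

private lemma exponent_exists: "\<exists>\<alpha>>0. R * real q powr \<alpha> < cmod lam"
proof -
  define L where "L = log (real q) (cmod lam / R)"
  have "cmod lam / R > 1" using R by simp
  then have L: "L > 0" unfolding L_def using q by (intro zero_less_log_cancel_iff[THEN iffD2]) auto
  have "real q powr (L / 2) < real q powr L" using q L by (intro powr_less_mono) auto
  also have "\<dots> = cmod lam / R" using q R lam0 by (simp add: L_def)
  finally show ?thesis using R L by (intro exI[of _ "L / 2"]) (simp add: field_simps)
qed

lemma dil_phi_periodic: "dil_phi q m lam a i (u + 1) = dil_phi q m lam a i u"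
proof -
  obtain \<alpha> where \<alpha>: "\<alpha> > 0" "R * real q powr \<alpha> < cmod lam" using exponent_exists by blast
  have "qlim q (dil_p q m lam a k) (u + 1) = qlim q (dil_p q m lam a k) u" for k
  proof -
    obtain c where "\<And>N. N \<ge> 1 \<Longrightarrow> cmod (dil_p q m lam a k (Suc N) - dil_p q m lam a k N) \<le> c * real N powr - \<alpha>"
      using dil_p_inc[OF \<alpha>(2)] by blast
    from qlim_periodic[OF q dil_p_scale this \<alpha>(1)] show ?thesis by simp
  qed
  then show ?thesis by (simp add: dil_phi_def)
qed

lemma dil_phi_holder:
  assumes \<alpha>: "\<alpha> > 0" "R * real q powr \<alpha> < cmod lam"
  shows "\<exists>B. \<forall>u v. cmod (dil_phi q m lam a i u - dil_phi q m lam a i v) \<le> B * \<bar>u - v\<bar> powr \<alpha>"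
proof -
  have "\<exists>B. \<forall>u v. cmod (qlim q (dil_p q m lam a k) u - qlim q (dil_p q m lam a k) v) \<le> B * \<bar>u - v\<bar> powr \<alpha>" for k
  proof -
    obtain c where "\<And>N. N \<ge> 1 \<Longrightarrow> cmod (dil_p q m lam a k (Suc N) - dil_p q m lam a k N) \<le> c * real N powr - \<alpha>"
      using dil_p_inc[OF \<alpha>(2)] by blast
    from qlim_holder[OF q dil_p_scale this \<alpha>(1)] show ?thesis by simp
  qed
  then obtain B where B: "\<And>k u v. cmod (qlim q (dil_p q m lam a k) u - qlim q (dil_p q m lam a k) v) \<le> B k * \<bar>u - v\<bar> powr \<alpha>"
    by metis
  have "cmod (dil_phi q m lam a i u - dil_phi q m lam a i v) \<le> (\<Sum>k\<le>m. \<bar>Polynomial.coeff (gbpoly k) i\<bar> * B k) * \<bar>u - v\<bar> powr \<alpha>" for u v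
  proof -
    have "cmod (dil_phi q m lam a i u - dil_phi q m lam a i v) =
      cmod (\<Sum>k\<le>m. of_real (Polynomial.coeff (gbpoly k) i) * (qlim q (dil_p q m lam a k) u - qlim q (dil_p q m lam a k) v))"
      by (simp add: dil_phi_def sum_subtractf[symmetric] right_diff_distrib)
    also have "\<dots> \<le> (\<Sum>k\<le>m. \<bar>Polynomial.coeff (gbpoly k) i\<bar> * (B k * \<bar>u - v\<bar> powr \<alpha>))"
      by (rule sum_norm_le) (simp add: norm_mult mult_left_mono B)
    finally show ?thesis by (simp add: sum_distrib_right mult.assoc)
  qed
  then show ?thesis by blast
qed

lemma dil_phi_continuous: "continuous_on UNIV (dil_phi q m lam a i)"
proof -
  obtain \<alpha> where \<alpha>: "\<alpha> > 0" "R * real q powr \<alpha> < cmod lam" using exponent_exists by blast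
  show ?thesis using dil_phi_holder[OF \<alpha>, of i] holder_imp_continuous[OF _ \<alpha>(1)] by blast
qed

text \<open>At u = log_q N the limits are the values p k N themselves, and (1 + sigma)^t undoes the
  (1 + sigma)^(-t) in them. Expanding binom(t, k) in powers of t and exchanging the sums gives this
  form.\<close>

lemma dil_expansion:
  assumes N: "N \<ge> 1"
  shows "a 0 N = cpow lam (log (real q) (real N)) *
    (\<Sum>i\<le>m. of_real (log (real q) (real N) ^ i) * dil_phi q m lam a i (log (real q) (real N)))"
proof -
  define t where "t = log (real q) (real N)"
  define b where "b j = a j N / lam ^ j" for j
  obtain \<alpha> where \<alpha>: "\<alpha> > 0" "R * real q powr \<alpha> < cmod lam" using exponent_exists by blast
  have ql: "qlim q (dil_p q m lam a k) t = dil_p q m lam a k N" for k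
    unfolding t_def by (rule qlim_log[OF q _ N]) (rule dil_p_scale)
  have "(\<Sum>i\<le>m. of_real (t ^ i) * dil_phi q m lam a i t) =
    (\<Sum>i\<le>m. \<Sum>k\<le>m. of_real (Polynomial.coeff (gbpoly k) i * t ^ i) * dil_p q m lam a k N)"
    by (simp add: dil_phi_def ql sum_distrib_left ac_simps)
  also have "\<dots> = (\<Sum>k\<le>m. of_real (\<Sum>i\<le>m. Polynomial.coeff (gbpoly k) i * t ^ i) * dil_p q m lam a k N)"
    by (subst sum.swap) (simp add: sum_distrib_right)
  also have "\<dots> = (\<Sum>k\<le>m. of_real (t gchoose k) * dil_p q m lam a k N)"
    by (intro sum.cong) (auto simp: gchoose_expand)
  also have "\<dots> = (\<Sum>k\<le>m. cpow lam (- t) * (of_real (t gchoose k) * (\<Sum>j\<le>m. of_real (- t gchoose j) * b (k + j))))"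
    by (simp add: dil_p_def cbin_def sum_distrib_left b_def t_def ac_simps)
  also have "\<dots> = cpow lam (- t) * b 0"
    unfolding sum_distrib_left[symmetric] by (subst gchoose_inversion) (auto simp: b_def top)
  finally show ?thesis by (simp add: t_def[symmetric] b_def cpow_minus)
qed

end

section \<open>Row vectors, Jordan form and spectral projection\<close>

lemma rvmult_transpose:
  assumes "w \<in> carrier_vec n" "M \<in> carrier_mat n k"
  shows "rvmult w M = transpose_mat M *\<^sub>v w"
  using assms by (intro eq_vecI) (auto simp: rvmult_def comm_scalar_prod[of _ n])

lemma rvmult_carrier [simp]:
  "M \<in> carrier_mat n k \<Longrightarrow> rvmult w M \<in> carrier_vec k"
  by (simp add: rvmult_def)

lemma rvmult_index:
  assumes "w \<in> carrier_vec n" "M \<in> carrier_mat n k" "j < k"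
  shows "rvmult w M $ j = (\<Sum>i<n. w $ i * M $$ (i, j))"
  using assms by (auto simp: rvmult_def scalar_prod_def atLeast0LessThan intro!: sum.cong)

lemma rvmult_mult:
  assumes "w \<in> carrier_vec n" "M \<in> carrier_mat n n" "N \<in> carrier_mat n n"
  shows "rvmult w (M * N) = rvmult (rvmult w M) N"
proof -
  have "transpose_mat M *\<^sub>v w \<in> carrier_vec n" using assms by simp
  then show ?thesis using assms
    by (simp add: rvmult_transpose[of _ n _ n] transpose_mult[of _ n n _ n] assoc_mult_mat_vec[of _ n n _ n])
qed

lemma rvmult_add_mat:
  assumes "w \<in> carrier_vec n" "M \<in> carrier_mat n n" "N \<in> carrier_mat n n"
  shows "rvmult w (M + N) = rvmult w M + rvmult w N"
proof (rule eq_vecI)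
  fix j assume "j < dim_vec (rvmult w M + rvmult w N)"
  then have "j < n" using assms by (simp add: rvmult_def)
  then show "rvmult w (M + N) $ j = (rvmult w M + rvmult w N) $ j"
    using assms by (simp add: rvmult_index[of _ n _ n] ring_distribs sum.distrib carrier_vecD[OF rvmult_carrier[of N n n]])
qed (use assms in \<open>simp add: rvmult_def\<close>)

lemma rvmult_minus_mat:
  assumes "w \<in> carrier_vec n" "M \<in> carrier_mat n n" "N \<in> carrier_mat n n"
  shows "rvmult w (M - N) = rvmult w M - rvmult w N"
proof (rule eq_vecI)
  fix j assume "j < dim_vec (rvmult w M - rvmult w N)"
  then have "j < n" using assms by (simp add: rvmult_def)
  then show "rvmult w (M - N) $ j = (rvmult w M - rvmult w N) $ j"
    using assms by (simp add: rvmult_index[of _ n _ n] right_diff_distrib sum_subtractf carrier_vecD[OF rvmult_carrier[of N n n]] minus_carrier_mat)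
qed (use assms in \<open>simp add: rvmult_def\<close>)

lemma rvmult_smult_mat:
  assumes "w \<in> carrier_vec n" "M \<in> carrier_mat n n"
  shows "rvmult w (c \<cdot>\<^sub>m M) = c \<cdot>\<^sub>v rvmult w M"
proof (rule eq_vecI)
  fix j assume "j < dim_vec (c \<cdot>\<^sub>v rvmult w M)"
  then have "j < n" using assms by (simp add: rvmult_def)
  then show "rvmult w (c \<cdot>\<^sub>m M) $ j = (c \<cdot>\<^sub>v rvmult w M) $ j"
    using assms by (simp add: rvmult_index[of _ n _ n] carrier_vecD[OF rvmult_carrier[of M n n]] sum_distrib_left ac_simps)
qed (use assms in \<open>simp add: rvmult_def\<close>)

lemma rvmult_one [simp]: "w \<in> carrier_vec n \<Longrightarrow> rvmult w (1\<^sub>m n) = w"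
  by (intro eq_vecI) (auto simp: rvmult_def)

lemma rvmult_add_vec:
  assumes "v \<in> carrier_vec n" "w \<in> carrier_vec n" "M \<in> carrier_mat n n"
  shows "rvmult (v + w) M = rvmult v M + rvmult w M"
  using assms by (simp add: rvmult_transpose[of _ n _ n] mult_add_distrib_mat_vec[of _ n n])

lemma rvmult_smult_vec:
  assumes "v \<in> carrier_vec n" "M \<in> carrier_mat n n"
  shows "rvmult (c \<cdot>\<^sub>v v) M = c \<cdot>\<^sub>v rvmult v M"
  using assms by (simp add: rvmult_transpose[of _ n _ n] mult_mat_vec[of _ n n])

lemma rvmult_zero_vec [simp]:
  assumes "M \<in> carrier_mat n n"
  shows "rvmult (0\<^sub>v n) M = 0\<^sub>v n"
  using assms by (intro eq_vecI) (auto simp: rvmult_def)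

lemma rvmult_pow_Suc:
  assumes "w \<in> carrier_vec n" "B \<in> carrier_mat n n"
  shows "rvmult w (B ^\<^sub>m Suc k) = rvmult (rvmult w (B ^\<^sub>m k)) B"
  using assms by (simp add: rvmult_mult[of _ n])

lemma rvmult_intertwine:
  assumes w: "w \<in> carrier_vec n" and M: "X \<in> carrier_mat n n" "B \<in> carrier_mat n n" "B' \<in> carrier_mat n n"
    and X: "X * B = B' * X"
  shows "rvmult (rvmult w X) (B ^\<^sub>m k) = rvmult (rvmult w (B' ^\<^sub>m k)) X"
proof (induction k)
  case 0
  then show ?case using w M rvmult_one[of "rvmult w X" n] by (simp add: carrier_matD)
next
  case (Suc k)
  have c: "rvmult w (B' ^\<^sub>m k) \<in> carrier_vec n" using M by (auto intro!: rvmult_carrier)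
  have "rvmult (rvmult w X) (B ^\<^sub>m Suc k) = rvmult (rvmult (rvmult w (B' ^\<^sub>m k)) X) B"
    using M Suc by (simp add: rvmult_pow_Suc[of _ n] del: pow_mat.simps)
  also have "\<dots> = rvmult (rvmult w (B' ^\<^sub>m k)) (B' * X)"
    using c M by (simp add: rvmult_mult[of _ n, symmetric] X)
  also have "\<dots> = rvmult (rvmult w (B' ^\<^sub>m Suc k)) X"
    using c M w by (simp add: rvmult_mult[of _ n] rvmult_pow_Suc[of _ n] del: pow_mat.simps)
  finally show ?case .
qed

subsection \<open>The spectral projection of the Jordan form\<close>

text \<open>A row vector times an upper triangular matrix keeps its leading zeros, and the
  coordinate following them is merely multiplied by the diagonal entry.\<close>

lemma rvmult_upper_triangular_first:
  fixes y :: "complex vec"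
  assumes y: "y \<in> carrier_vec n" and B: "B \<in> carrier_mat n n" and ut: "\<And>i j. i < n \<Longrightarrow> j < i \<Longrightarrow> B $$ (i,j) = 0"
    and i: "i < n" and z: "\<And>k. k < i \<Longrightarrow> y $ k = 0"
  shows "(\<forall>k<i. rvmult y (B ^\<^sub>m l) $ k = 0) \<and> rvmult y (B ^\<^sub>m l) $ i = y $ i * (B $$ (i,i)) ^ l"
proof (induction l)
  case 0
  then show ?case using y B z by simp
next
  case (Suc l)
  let ?x = "rvmult y (B ^\<^sub>m l)"
  have c: "?x \<in> carrier_vec n" using B by (auto intro!: rvmult_carrier)
  have "rvmult ?x B $ k = 0" if "k < i" for k
  proof -
    have "?x $ j * B $$ (j, k) = 0" if "j < n" for j
      using Suc ut[of j k] that \<open>k < i\<close> by (cases "j < i") auto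
    then have "(\<Sum>j<n. ?x $ j * B $$ (j, k)) = 0" by (intro sum.neutral) auto
    then show ?thesis using c B i that by (simp add: rvmult_index[of _ n _ n])
  qed
  moreover have "rvmult ?x B $ i = ?x $ i * B $$ (i,i)"
  proof -
    have "?x $ j * B $$ (j, i) = 0" if "j < n" "j \<noteq> i" for j
      using Suc ut[of j i] that by (cases "j < i") auto
    then have "(\<Sum>j<n. ?x $ j * B $$ (j, i)) = (\<Sum>j\<in>{i}. ?x $ j * B $$ (j, i))"
      using i by (intro sum.mono_neutral_right) auto
    then show ?thesis using c B i by (simp add: rvmult_index[of _ n _ n])
  qed
  ultimately show ?case using Suc y B by (simp add: rvmult_pow_Suc[of _ n] del: pow_mat.simps)
qed

text \<open>At the first nonzero coordinate i, applying (J - lam)^m would multiply by the m-th power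
  of J_ii - lam, which is nonzero by \<open>supp\<close>.\<close>

lemma gen_eigvec_upper_triangular_zero:
  fixes z :: "complex vec"
  assumes z: "z \<in> carrier_vec n" and J: "J \<in> carrier_mat n n" and ut: "\<And>i j. i < n \<Longrightarrow> j < i \<Longrightarrow> J $$ (i,j) = 0"
    and ev: "rvmult z ((J - lam \<cdot>\<^sub>m 1\<^sub>m n) ^\<^sub>m m) = 0\<^sub>v n"
    and supp: "\<And>i. i < n \<Longrightarrow> z $ i \<noteq> 0 \<Longrightarrow> J $$ (i,i) \<noteq> lam"
  shows "z = 0\<^sub>v n"
proof (rule ccontr)
  assume "z \<noteq> 0\<^sub>v n"
  then have ex: "\<exists>i. i < n \<and> z $ i \<noteq> 0" using z by (metis eq_vecI index_zero_vec carrier_vecD)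
  define i where "i = (LEAST i. i < n \<and> z $ i \<noteq> 0)"
  have i: "i < n" "z $ i \<noteq> 0" using LeastI_ex[OF ex] by (auto simp: i_def)
  have less: "z $ k = 0" if "k < i" for k using not_less_Least[of k "\<lambda>i. i < n \<and> z $ i \<noteq> 0"] that i by (auto simp: i_def)
  let ?B = "J - lam \<cdot>\<^sub>m 1\<^sub>m n"
  have "rvmult z (?B ^\<^sub>m m) $ i = z $ i * (?B $$ (i,i)) ^ m"
    by (rule rvmult_upper_triangular_first[OF z, THEN conjunct2]) (use J ut i less in auto)
  moreover have "?B $$ (i,i) \<noteq> 0" using J i supp[of i] by simp
  ultimately show False using ev i by simp
qed

text \<open>Nonzero entries stay inside one Jordan block, whose diagonal is constant. This is what
  makes \<open>Dmat\<close> commute with J.\<close>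

lemma jordan_matrix_diag_eq:
  assumes "i < sum_list (map fst n_as)" "j < sum_list (map fst n_as)" "jordan_matrix n_as $$ (i,j) \<noteq> 0"
  shows "jordan_matrix n_as $$ (i,i) = jordan_matrix n_as $$ (j,j)"
  using assms
proof (induction n_as arbitrary: i j)
  case (Cons na n_as)
  obtain n a where na: "na = (n, a)" by force
  let ?s = "n + sum_list (map fst n_as)"
  have idx: "jordan_matrix (na # n_as) $$ (k,l) =
      (if k < n then if l < n then jordan_block n a $$ (k,l) else 0
       else if l < n then 0 else jordan_matrix n_as $$ (k - n, l - n))" if "k < ?s" "l < ?s" for k l
    using that unfolding na jordan_matrix_Cons by auto
  have ij: "i < ?s" "j < ?s" using Cons.prems by (auto simp: na)
  consider "i < n" "j < n" | "\<not> i < n" "\<not> j < n"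
    using Cons.prems(3) unfolding idx[OF ij] by (auto split: if_splits)
  then show ?case
  proof cases
    case 1
    then show ?thesis using ij by (simp add: idx)
  next
    case 2
    then have "jordan_matrix n_as $$ (i - n, i - n) = jordan_matrix n_as $$ (j - n, j - n)"
      using Cons.prems(3) ij unfolding idx[OF ij] by (intro Cons.IH) auto
    then show ?thesis using ij 2 by (simp add: idx)
  qed
qed simp

lemma Dmat_carrier [simp]: "Dmat n J \<in> carrier_mat n n"
  by (simp add: Dmat_def)

lemma Dmat_mult_index:
  assumes "M \<in> carrier_mat n n" "i < n" "j < n"
  shows "(Dmat n J * M) $$ (i,j) = (if J $$ (i,i) = 1 then 0 else M $$ (i,j))"
    "(M * Dmat n J) $$ (i,j) = (if J $$ (j,j) = 1 then 0 else M $$ (i,j))"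
proof -
  have "(Dmat n J * M) $$ (i,j) = (\<Sum>k<n. Dmat n J $$ (i,k) * M $$ (k,j))"
    using assms by (auto simp: scalar_prod_def Dmat_def atLeast0LessThan intro!: sum.cong)
  also have "\<dots> = (\<Sum>k\<in>{i}. Dmat n J $$ (i,k) * M $$ (k,j))"
    using assms by (intro sum.mono_neutral_right) (auto simp: Dmat_def)
  finally show "(Dmat n J * M) $$ (i,j) = (if J $$ (i,i) = 1 then 0 else M $$ (i,j))"
    using assms by (simp add: Dmat_def)
  have "(M * Dmat n J) $$ (i,j) = (\<Sum>k<n. M $$ (i,k) * Dmat n J $$ (k,j))"
    using assms by (auto simp: scalar_prod_def Dmat_def atLeast0LessThan intro!: sum.cong)
  also have "\<dots> = (\<Sum>k\<in>{j}. M $$ (i,k) * Dmat n J $$ (k,j))"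
    using assms by (intro sum.mono_neutral_right) (auto simp: Dmat_def)
  finally show "(M * Dmat n J) $$ (i,j) = (if J $$ (j,j) = 1 then 0 else M $$ (i,j))"
    using assms by (simp add: Dmat_def)
qed

lemma Dmat_idem: "Dmat n J * Dmat n J = Dmat n J"
proof (rule eq_matI)
  fix i j assume "i < dim_row (Dmat n J)" "j < dim_col (Dmat n J)"
  then have "i < n" "j < n" by (auto simp: Dmat_def)
  then show "(Dmat n J * Dmat n J) $$ (i,j) = Dmat n J $$ (i,j)"
    by (subst Dmat_mult_index) (auto simp: Dmat_def)
qed (auto simp: Dmat_def)

locale jordan_data =
  fixes d :: nat and C T Ti J :: "complex mat"
  assumes C: "C \<in> carrier_mat d d" and T: "T \<in> carrier_mat d d" and Ti: "Ti \<in> carrier_mat d d"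
    and TTi: "T * Ti = 1\<^sub>m d" and TiT: "Ti * T = 1\<^sub>m d"
    and J: "J \<in> carrier_mat d d" and TCTi: "T * C * Ti = J"
    and ut: "\<And>i j. i < d \<Longrightarrow> j < i \<Longrightarrow> J $$ (i,j) = 0"
    and blk: "\<And>i j. i < d \<Longrightarrow> j < d \<Longrightarrow> J $$ (i,j) \<noteq> 0 \<Longrightarrow> J $$ (i,i) = J $$ (j,j)"
begin

abbreviation "D \<equiv> Dmat d J"

text \<open>The spectral projection of C for the eigenvalues other than 1: acting on row vectors it
  kills the generalised eigenspace of 1 and fixes the other ones.\<close>

definition "P = Ti * D * T"

lemmas carr = C T Ti J

lemma P_carrier [simp]: "P \<in> carrier_mat d d"
  using carr by (auto simp: P_def)

lemma TiJ: "Ti * J = C * Ti"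
proof -
  have "T * (C * Ti) = J" using carr by (simp add: TCTi[symmetric] assoc_mult_mat[of _ d d _ d _ d])
  then have "Ti * J = Ti * (T * (C * Ti))" by simp
  also have "\<dots> = (Ti * T) * (C * Ti)" using carr by (intro assoc_mult_mat[symmetric]) auto
  also have "\<dots> = C * Ti" using carr by (simp add: TiT left_mult_one_mat[of _ d d])
  finally show ?thesis .
qed

lemma C_eq: "C = Ti * J * T"
proof -
  have "Ti * J * T = C * (Ti * T)" unfolding TiJ using carr by (intro assoc_mult_mat) auto
  then show ?thesis using carr by (simp add: TiT)
qed

lemma D_comm: "D * J = J * D"
proof (rule eq_matI)
  fix i j assume "i < dim_row (J * D)" "j < dim_col (J * D)"
  then have "i < d" "j < d" using J by (auto simp: Dmat_def)
  then show "(D * J) $$ (i,j) = (J * D) $$ (i,j)"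
    using blk[of i j] by (cases "J $$ (i,j) = 0") (auto simp: Dmat_mult_index[OF J] simp del: index_mult_mat)
qed (use J in \<open>auto simp: Dmat_def\<close>)

lemma P_conj:
  assumes "M \<in> carrier_mat d d" "N \<in> carrier_mat d d"
  shows "(Ti * M * T) * (Ti * N * T) = Ti * (M * N) * T"
proof -
  have "(Ti * M * T) * (Ti * N * T) = Ti * M * ((T * Ti) * (N * T))"
    using carr assms by (simp add: assoc_mult_mat[of _ d d _ d _ d])
  also have "\<dots> = Ti * (M * N) * T"
    using carr assms by (simp add: TTi left_mult_one_mat[of _ d d] assoc_mult_mat[of _ d d _ d _ d])
  finally show ?thesis .
qed

lemma P_idem: "P * P = P" unfolding P_def by (subst P_conj) (auto simp: Dmat_idem)

text \<open>So the matrix C' in \<open>Kmat\<close> is P C, that is, C with its part at the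
  eigenvalue 1 replaced by zero.\<close>

lemma PC: "P * C = Ti * D * J * T"
  unfolding P_def by (subst C_eq, subst P_conj) (use carr in \<open>auto simp: assoc_mult_mat[of _ d d _ d _ d]\<close>)

lemma P_comm: "P * C = C * P"
  unfolding P_def by (subst (1 2) C_eq, subst (1 2) P_conj) (use carr D_comm in auto)

lemma shift_comm:
  fixes X B B' :: "complex mat"
  assumes "X \<in> carrier_mat d d" "B \<in> carrier_mat d d" "B' \<in> carrier_mat d d" "X * B = B' * X"
  shows "X * (B - c \<cdot>\<^sub>m 1\<^sub>m d) = (B' - c \<cdot>\<^sub>m 1\<^sub>m d) * X"
proof -
  have "X * (B - c \<cdot>\<^sub>m 1\<^sub>m d) = X * B - X * (c \<cdot>\<^sub>m 1\<^sub>m d)"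
    using assms by (intro mult_minus_distrib_mat) auto
  also have "X * (c \<cdot>\<^sub>m 1\<^sub>m d) = (c \<cdot>\<^sub>m 1\<^sub>m d) * X"
    using assms by (simp add: mult_smult_distrib[of _ d d _ d] mult_smult_assoc_mat[of _ d d _ d])
  also have "X * B - (c \<cdot>\<^sub>m 1\<^sub>m d) * X = (B' - c \<cdot>\<^sub>m 1\<^sub>m d) * X"
    unfolding assms(4) using assms by (intro minus_mult_distrib_mat[symmetric]) auto
  finally show ?thesis .
qed

text \<open>The vector w Ti X is annihilated by (J - lam)^m, since Ti intertwines C with J and X
  commutes with J. By \<open>supp\<close> its nonzero coordinates avoid the diagonal entries lam, so
  triangularity makes it vanish. It is used with X = D and with X = I - D.\<close>

lemma gen_eig_zero:
  assumes w: "w \<in> carrier_vec d" "rvmult w ((C - lam \<cdot>\<^sub>m 1\<^sub>m d) ^\<^sub>m m) = 0\<^sub>v d"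
    and X: "X \<in> carrier_mat d d" "X * J = J * X"
    and supp: "\<And>i y. i < d \<Longrightarrow> y \<in> carrier_vec d \<Longrightarrow> rvmult y X $ i \<noteq> 0 \<Longrightarrow> J $$ (i,i) \<noteq> lam"
  shows "rvmult (rvmult w Ti) X = 0\<^sub>v d"
proof -
  have c: "rvmult w Ti \<in> carrier_vec d" using Ti by simp
  have "(Ti * X) * J = Ti * (J * X)"
    using carr X(1) by (simp add: X(2)[symmetric] assoc_mult_mat[of _ d d _ d _ d])
  also have "\<dots> = (Ti * J) * X" using carr X(1) by (intro assoc_mult_mat[symmetric]) auto
  also have "\<dots> = C * (Ti * X)" unfolding TiJ using carr X(1) by (intro assoc_mult_mat) auto
  finally have "(Ti * X) * J = C * (Ti * X)" .
  then have *: "(Ti * X) * (J - lam \<cdot>\<^sub>m 1\<^sub>m d) = (C - lam \<cdot>\<^sub>m 1\<^sub>m d) * (Ti * X)"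
    using carr X by (intro shift_comm) auto
  have "rvmult (rvmult w (Ti * X)) ((J - lam \<cdot>\<^sub>m 1\<^sub>m d) ^\<^sub>m m) = rvmult (rvmult w ((C - lam \<cdot>\<^sub>m 1\<^sub>m d) ^\<^sub>m m)) (Ti * X)"
    by (rule rvmult_intertwine[OF w(1) _ _ _ *]) (use carr X in auto)
  also have "\<dots> = 0\<^sub>v d" unfolding w(2) using carr X by (intro rvmult_zero_vec) auto
  finally have ev: "rvmult (rvmult (rvmult w Ti) X) ((J - lam \<cdot>\<^sub>m 1\<^sub>m d) ^\<^sub>m m) = 0\<^sub>v d"
    unfolding rvmult_mult[OF w(1) Ti X(1)] .
  show ?thesis
  proof (rule gen_eigvec_upper_triangular_zero[where J = J and lam = lam and m = m])
    show "rvmult (rvmult w Ti) X \<in> carrier_vec d" using X(1) by (rule rvmult_carrier)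
    show "J $$ (i,j) = 0" if "i < d" "j < i" for i j using that by (rule ut)
    show "J $$ (i,i) \<noteq> lam" if "i < d" "rvmult (rvmult w Ti) X $ i \<noteq> 0" for i
      using that(1) c that(2) by (rule supp)
  qed (fact J ev)+
qed

lemma rvmult_D_index:
  assumes "y \<in> carrier_vec d" "i < d"
  shows "rvmult y D $ i = (if J $$ (i,i) = 1 then 0 else y $ i)"
proof -
  have "rvmult y D $ i = (\<Sum>k<d. y $ k * D $$ (k,i))" using assms by (intro rvmult_index) auto
  also have "\<dots> = (\<Sum>k\<in>{i}. y $ k * D $$ (k,i))"
    using assms by (intro sum.mono_neutral_right) (auto simp: Dmat_def)
  finally show ?thesis using assms by (simp add: Dmat_def)
qed

lemma rvmult_P_eig1:
  assumes w: "w \<in> carrier_vec d" "rvmult w ((C - 1 \<cdot>\<^sub>m 1\<^sub>m d) ^\<^sub>m m) = 0\<^sub>v d"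
  shows "rvmult w P = 0\<^sub>v d"
proof -
  have "rvmult (rvmult w Ti) D = 0\<^sub>v d"
    by (rule gen_eig_zero[OF w]) (auto simp: D_comm rvmult_D_index split: if_splits)
  then show ?thesis using w carr by (simp add: P_def rvmult_mult[of _ d])
qed

lemma rvmult_P_eig:
  assumes w: "w \<in> carrier_vec d" "rvmult w ((C - lam \<cdot>\<^sub>m 1\<^sub>m d) ^\<^sub>m m) = 0\<^sub>v d" and lam: "lam \<noteq> 1"
  shows "rvmult w P = w"
proof -
  have c: "rvmult w Ti \<in> carrier_vec d" using Ti by simp
  have "rvmult (rvmult w Ti) (1\<^sub>m d - D) = 0\<^sub>v d"
  proof (rule gen_eig_zero[OF w])
    show "(1\<^sub>m d - D) * J = J * (1\<^sub>m d - D)"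
      using J by (simp add: mult_minus_distrib_mat[of _ d d _ d] minus_mult_distrib_mat[of _ d d _ _ d] D_comm)
    show "J $$ (i,i) \<noteq> lam" if "i < d" "y \<in> carrier_vec d" "rvmult y (1\<^sub>m d - D) $ i \<noteq> 0" for i y
      using that lam by (auto simp: rvmult_minus_mat[of _ d] rvmult_D_index carrier_vecD[OF rvmult_carrier[of D d d]] split: if_splits)
  qed (auto intro: minus_carrier_mat)
  then have "rvmult w Ti - rvmult (rvmult w Ti) D = 0\<^sub>v d"
    using c by (simp add: rvmult_minus_mat[of _ d])
  then have "rvmult (rvmult w Ti) D = rvmult w Ti"
  proof (intro eq_vecI)
    fix i assume "i < dim_vec (rvmult w Ti)"
    then have "i < d" using c by simp
    then show "rvmult (rvmult w Ti) D $ i = rvmult w Ti $ i"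
      using arg_cong[OF \<open>rvmult w Ti - rvmult (rvmult w Ti) D = 0\<^sub>v d\<close>, of "\<lambda>v. v $ i"]
      by (simp add: carrier_vecD[OF rvmult_carrier[of D d d]])
  qed (use c in \<open>simp add: carrier_vecD[OF rvmult_carrier[of D d d]]\<close>)
  then have "rvmult w P = rvmult w (Ti * T)" using w carr by (simp add: P_def rvmult_mult[of _ d])
  then show ?thesis using w by (simp add: TiT)
qed

text \<open>I - C' is conjugate to I - D J, which is upper triangular with diagonal entries 1 - J_ii
  where J_ii differs from 1, and 1 elsewhere. Hence its determinant is nonzero.\<close>

lemma inverse_exists:
  obtains L where "mat_inverse (1\<^sub>m d - Ti * D * J * T) = Some L" "L \<in> carrier_mat d d"
    "(1\<^sub>m d - Ti * D * J * T) * L = 1\<^sub>m d"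
proof -
  let ?U = "1\<^sub>m d - D * J"
  have U: "?U \<in> carrier_mat d d" using J by (auto intro!: minus_carrier_mat mult_carrier_mat[of _ d d])
  have Ui: "?U $$ (i,j) = (if i = j then 1 else 0) - (if J $$ (i,i) = 1 then 0 else J $$ (i,j))" if "i < d" "j < d" for i j
    using that J by (simp add: Dmat_mult_index carrier_matD[OF Dmat_carrier] del: index_mult_mat(1))
  have "?U $$ (i,j) = 0" if "i < d" "j < i" for i j
    using that by (simp only: Ui) (use ut in auto)
  then have "upper_triangular ?U" unfolding upper_triangular_def using U by (metis carrier_matD(1))
  then have "det ?U = prod_list (diag_mat ?U)" by (rule det_upper_triangular[OF _ U])
  also have "\<dots> \<noteq> 0"
    using U Ui by (auto simp: diag_mat_def prod_list_zero_iff split: if_splits)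
  finally have dU: "det ?U \<noteq> 0" .
  have "Ti * ?U * T = 1\<^sub>m d - Ti * D * J * T"
  proof -
    have DJ: "D * J \<in> carrier_mat d d" using J by (auto intro!: mult_carrier_mat[of _ d d])
    have "Ti * ?U = Ti - Ti * (D * J)"
      using Ti DJ by (subst mult_minus_distrib_mat[of _ d d _ d]) auto
    moreover have "(Ti - Ti * (D * J)) * T = Ti * T - Ti * (D * J) * T"
      using Ti T DJ by (intro minus_mult_distrib_mat) auto
    moreover have "Ti * (D * J) = Ti * D * J" using Ti J by (intro assoc_mult_mat[symmetric]) auto
    ultimately show ?thesis by (simp add: TiT)
  qed
  moreover have "det Ti * det T = 1" using det_mult[OF Ti T] by (simp add: TiT)
  then have "det (Ti * ?U * T) \<noteq> 0"
    using dU U carr by (auto simp: det_mult[of _ d])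
  ultimately have "det (1\<^sub>m d - Ti * D * J * T) \<noteq> 0" by simp
  moreover have c: "1\<^sub>m d - Ti * D * J * T \<in> carrier_mat d d" using carr by (auto intro!: minus_carrier_mat)
  ultimately have "1\<^sub>m d - Ti * D * J * T \<in> Units (ring_mat TYPE(complex) d ())" by (intro det_non_zero_imp_unit)
  then obtain L where "mat_inverse (1\<^sub>m d - Ti * D * J * T) = Some L"
    using mat_inverse(1)[OF c, where b = "()"] by (cases "mat_inverse (1\<^sub>m d - Ti * D * J * T)") auto
  then show ?thesis using mat_inverse(2)[OF c] that by blast
qed

text \<open>On the range of P the matrices C and C' = P C agree, so the inverse \<open>L\<close> of
  I - C' inverts I - C there, even if I - C is singular.\<close>

lemma shift_P:
  assumes L: "L \<in> carrier_mat d d" "(1\<^sub>m d - Ti * D * J * T) * L = 1\<^sub>m d"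
  shows "(1\<^sub>m d - C) * (P * L) = P"
proof -
  have "(1\<^sub>m d - C) * P = P - C * P" using C by (simp add: left_mult_one_mat[of _ d d] minus_mult_distrib_mat[of _ d d _ _ d])
  also have "C * P = (P * P) * C" by (simp add: P_idem P_comm)
  also have "\<dots> = P * (P * C)" using C by (intro assoc_mult_mat[of _ d d _ d _ d]) auto
  also have "P - P * (P * C) = P * (1\<^sub>m d - P * C)"
    using mult_carrier_mat[OF P_carrier C]
    by (subst mult_minus_distrib_mat[of _ d d _ d]) (auto simp: right_mult_one_mat[of _ d d])
  finally have "(1\<^sub>m d - C) * P = P * (1\<^sub>m d - P * C)" .
  moreover have "(1\<^sub>m d - C) * (P * L) = ((1\<^sub>m d - C) * P) * L"
    using C L(1) by (intro assoc_mult_mat[of _ d d _ d _ d, symmetric]) (auto intro!: minus_carrier_mat)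
  moreover have "(P * (1\<^sub>m d - P * C)) * L = P * ((1\<^sub>m d - P * C) * L)"
    using C L(1) mult_carrier_mat[OF P_carrier C]
    by (intro assoc_mult_mat[of _ d d _ d _ d]) (auto intro!: minus_carrier_mat)
  ultimately have "(1\<^sub>m d - C) * (P * L) = P * ((1\<^sub>m d - P * C) * L)" by simp
  then show ?thesis using L by (simp add: PC right_mult_one_mat[OF P_carrier])
qed

end

section \<open>Norms, the joint spectral radius and regular sequences\<close>

text \<open>Bolzano-Weierstrass one coordinate at a time; each further extraction preserves the
  limits found before.\<close>

lemma coordinatewise_convergent_subsequence:
  fixes X :: "nat \<Rightarrow> nat \<Rightarrow> complex"
  assumes "\<And>i. i < d \<Longrightarrow> bounded (range (\<lambda>n. X n i))"
  shows "\<exists>r. strict_mono (r :: nat \<Rightarrow> nat) \<and> (\<forall>i<d. convergent (\<lambda>n. X (r n) i))"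
  using assms
proof (induction d)
  case 0
  then show ?case by (intro exI[of _ id]) (auto simp: strict_mono_def)
next
  case (Suc d)
  then obtain r where r: "strict_mono (r :: nat \<Rightarrow> nat)" "\<And>i. i < d \<Longrightarrow> convergent (\<lambda>n. X (r n) i)"
    using less_Suc_eq by metis
  have "bounded (range (\<lambda>n. X (r n) d))"
    by (rule bounded_subset[OF Suc.prems[of d]]) auto
  then obtain l s where s: "strict_mono (s :: nat \<Rightarrow> nat)" "(\<lambda>n. X (r (s n)) d) \<longlonglongrightarrow> l"
    using bounded_imp_convergent_subsequence[of "\<lambda>n. X (r n) d"] by (auto simp: o_def)
  have "convergent (\<lambda>n. X (r (s n)) i)" if "i < Suc d" for i
  proof (cases "i = d")
    case True
    then show ?thesis using s by (auto intro: convergentI)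
  next
    case False
    then show ?thesis using convergent_subseq_convergent[OF r(2) s(1), of i] that by (simp add: o_def)
  qed
  then show ?case using strict_mono_o[OF r(1) s(1)] by (intro exI[of _ "r \<circ> s"]) (auto simp: o_def)
qed

section \<open>An arbitrary norm compared with the coordinates\<close>

locale vector_norm =
  fixes d :: nat and nv :: "complex vec \<Rightarrow> real"
  assumes norm: "is_vec_norm d nv" and d1: "d \<ge> 1"
begin

lemma nv_eq_0: "x \<in> carrier_vec d \<Longrightarrow> nv x = 0 \<longleftrightarrow> x = 0\<^sub>v d"
  and nv_triangle: "x \<in> carrier_vec d \<Longrightarrow> y \<in> carrier_vec d \<Longrightarrow> nv (x + y) \<le> nv x + nv y"
  and nv_smult: "x \<in> carrier_vec d \<Longrightarrow> nv (c \<cdot>\<^sub>v x) = cmod c * nv x"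
  using norm unfolding is_vec_norm_def by blast+

lemma nv_nonneg:
  assumes "x \<in> carrier_vec d" shows "nv x \<ge> 0"
proof -
  have "x + (-1) \<cdot>\<^sub>v x = 0\<^sub>v d" using assms by (intro eq_vecI) auto
  then have "0 \<le> nv x + nv ((-1) \<cdot>\<^sub>v x)"
    using nv_triangle[of x "(-1) \<cdot>\<^sub>v x"] nv_eq_0[of "0\<^sub>v d"] assms by simp
  then show ?thesis using assms by (simp add: nv_smult)
qed

lemma nv_le_sum:
  assumes x: "x \<in> carrier_vec d"
  shows "nv x \<le> (\<Sum>i<d. cmod (x $ i) * nv (unit_vec d i))"
proof -
  have "nv (vec d (\<lambda>i. if i < k then x $ i else 0)) \<le> (\<Sum>i<k. cmod (x $ i) * nv (unit_vec d i))" if "k \<le> d" for k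
    using that
  proof (induction k)
    case 0
    have "vec d (\<lambda>i. if i < 0 then x $ i else 0) = 0\<^sub>v d" by (intro eq_vecI) auto
    then show ?case using nv_eq_0[of "0\<^sub>v d"] by simp
  next
    case (Suc k)
    have "vec d (\<lambda>i. if i < Suc k then x $ i else 0) = vec d (\<lambda>i. if i < k then x $ i else 0) + x $ k \<cdot>\<^sub>v unit_vec d k"
      using Suc.prems by (intro eq_vecI) (auto simp: unit_vec_def less_Suc_eq)
    then have "nv (vec d (\<lambda>i. if i < Suc k then x $ i else 0)) \<le> nv (vec d (\<lambda>i. if i < k then x $ i else 0)) + cmod (x $ k) * nv (unit_vec d k)"
      using nv_triangle[of "vec d (\<lambda>i. if i < k then x $ i else 0)" "x $ k \<cdot>\<^sub>v unit_vec d k"] by (simp add: nv_smult)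
    then show ?case using Suc by simp
  qed
  from this[of d] have "nv (vec d (\<lambda>i. if i < d then x $ i else 0)) \<le> (\<Sum>i<d. cmod (x $ i) * nv (unit_vec d i))" by simp
  also have "vec d (\<lambda>i. if i < d then x $ i else 0) = x" using x by (intro eq_vecI) auto
  finally show ?thesis .
qed

text \<open>Equivalence of norms by compactness: without such a constant, vectors scaled to absolute
  coordinate sum 1 with norms tending to 0 would have a subsequential limit of coordinate sum 1 and
  norm 0.\<close>

lemma coord_le_nv: "\<exists>c\<ge>0. \<forall>x\<in>carrier_vec d. \<forall>j<d. cmod (x $ j) \<le> c * nv x"
proof (rule ccontr)
  assume neg: "\<not> ?thesis"
  have "\<exists>x\<in>carrier_vec d. (\<Sum>i<d. cmod (x $ i)) = 1 \<and> nv x < 1 / real (Suc n)" for n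
  proof -
    obtain x j where x: "x \<in> carrier_vec d" "j < d" "cmod (x $ j) > real (Suc n) * nv x"
      using neg by (metis not_le of_nat_0_le_iff)
    define S where "S = (\<Sum>i<d. cmod (x $ i))"
    have "cmod (x $ j) \<le> S" unfolding S_def using x by (intro member_le_sum) auto
    moreover have "real (Suc n) * nv x \<ge> 0" using nv_nonneg[OF x(1)] by (intro mult_nonneg_nonneg) auto
    ultimately have S: "S > 0" "real (Suc n) * nv x < S" using x by auto
    have "nv (of_real (1 / S) \<cdot>\<^sub>v x) = 1 / S * nv x" using S x by (simp add: nv_smult norm_divide)
    also have "\<dots> < 1 / real (Suc n)" using S by (simp add: field_simps del: of_nat_Suc)
    finally have "nv (of_real (1 / S) \<cdot>\<^sub>v x) < 1 / real (Suc n)" .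
    moreover have "(\<Sum>i<d. cmod ((of_real (1 / S) \<cdot>\<^sub>v x) $ i)) = (\<Sum>i<d. cmod (x $ i) / S)"
      using x S by (intro sum.cong) (auto simp: norm_mult norm_divide)
    then have "(\<Sum>i<d. cmod ((of_real (1 / S) \<cdot>\<^sub>v x) $ i)) = 1"
      using S by (simp add: sum_divide_distrib[symmetric] S_def[symmetric])
    ultimately show ?thesis using x by (intro bexI[of _ "of_real (1 / S) \<cdot>\<^sub>v x"]) auto
  qed
  then obtain X where X: "\<And>n. X n \<in> carrier_vec d" "\<And>n. (\<Sum>i<d. cmod (X n $ i)) = 1" "\<And>n. nv (X n) < 1 / real (Suc n)"
    by metis
  have "bounded (range (\<lambda>n. X n $ i))" if "i < d" for i
    unfolding bounded_iff
  proof (intro exI ballI)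
    fix y assume "y \<in> range (\<lambda>n. X n $ i)"
    then obtain n where "y = X n $ i" by auto
    then show "cmod y \<le> 1" using member_le_sum[of i "{..<d}" "\<lambda>i. cmod (X n $ i)"] X(2)[of n] that by simp
  qed
  then obtain r where r: "strict_mono (r :: nat \<Rightarrow> nat)" "\<And>i. i < d \<Longrightarrow> convergent (\<lambda>n. X (r n) $ i)"
    using coordinatewise_convergent_subsequence[of d "\<lambda>n i. X n $ i"] by blast
  define L where "L = vec d (\<lambda>i. lim (\<lambda>n. X (r n) $ i))"
  have L: "L \<in> carrier_vec d" "\<And>i. i < d \<Longrightarrow> (\<lambda>n. X (r n) $ i) \<longlonglongrightarrow> L $ i"
    using r(2) by (auto simp: L_def convergent_LIMSEQ_iff)
  have "(\<lambda>n. \<Sum>i<d. cmod (X (r n) $ i)) \<longlonglongrightarrow> (\<Sum>i<d. cmod (L $ i))"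
    by (intro tendsto_sum tendsto_norm L) auto
  then have L1: "(\<Sum>i<d. cmod (L $ i)) = 1" by (simp add: X LIMSEQ_const_iff)
  \<comment> \<open>By \<open>nv_le_sum\<close> the norm is continuous under coordinatewise
    convergence; this null sequence will dominate the norm of the limit.\<close>
  have "(\<lambda>n. 1 / real (Suc n) + (\<Sum>i<d. cmod (L $ i - X (r n) $ i) * nv (unit_vec d i))) \<longlonglongrightarrow> 0 + (\<Sum>i<d. cmod (L $ i - L $ i) * nv (unit_vec d i))"
    by (intro tendsto_add tendsto_sum tendsto_mult tendsto_norm tendsto_diff tendsto_const L LIMSEQ_Suc[OF lim_1_over_n]) auto
  then have lim0: "(\<lambda>n. 1 / real (Suc n) + (\<Sum>i<d. cmod (L $ i - X (r n) $ i) * nv (unit_vec d i))) \<longlonglongrightarrow> 0" by simp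
  have "nv L \<le> 1 / real (Suc n) + (\<Sum>i<d. cmod (L $ i - X (r n) $ i) * nv (unit_vec d i))" for n
  proof -
    have "L = X (r n) + (L - X (r n))" using L(1) X(1)[of "r n"] by (intro eq_vecI) auto
    then have "nv L \<le> nv (X (r n)) + nv (L - X (r n))"
      using nv_triangle[OF X(1)[of "r n"], of "L - X (r n)"] L(1) X(1)[of "r n"] by simp
    moreover have "nv (X (r n)) \<le> 1 / real (Suc n)"
    proof -
      have "nv (X (r n)) \<le> 1 / real (Suc (r n))" using X(3)[of "r n"] by simp
      also have "\<dots> \<le> 1 / real (Suc n)" using seq_suble[OF r(1), of n] by (intro divide_left_mono) auto
      finally show ?thesis .
    qed
    moreover have "nv (L - X (r n)) \<le> (\<Sum>i<d. cmod ((L - X (r n)) $ i) * nv (unit_vec d i))"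
      using L(1) X(1)[of "r n"] by (intro nv_le_sum) auto
    moreover have "(\<Sum>i<d. cmod ((L - X (r n)) $ i) * nv (unit_vec d i)) = (\<Sum>i<d. cmod (L $ i - X (r n) $ i) * nv (unit_vec d i))"
      using L(1) X(1)[of "r n"] by (intro sum.cong) auto
    ultimately show ?thesis by linarith
  qed
  then have "nv L \<le> 0" using LIMSEQ_le_const[OF lim0] by blast
  then have "L = 0\<^sub>v d" using nv_nonneg[OF L(1)] nv_eq_0[OF L(1)] by simp
  then show False using L1 by simp
qed

lemma nv_le_coords:
  obtains c where "c \<ge> 0" "\<And>(x::complex vec) B. x \<in> carrier_vec d \<Longrightarrow> (\<And>j. j < d \<Longrightarrow> cmod (x $ j) \<le> B) \<Longrightarrow> nv x \<le> c * B"
proof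
  show "(\<Sum>i<d. nv (unit_vec d i)) \<ge> 0" by (intro sum_nonneg nv_nonneg) auto
  fix x :: "complex vec" and B assume x: "x \<in> carrier_vec d" and B: "\<And>j. j < d \<Longrightarrow> cmod (x $ j) \<le> B"
  have "nv x \<le> (\<Sum>i<d. cmod (x $ i) * nv (unit_vec d i))" by (rule nv_le_sum[OF x])
  also have "\<dots> \<le> (\<Sum>i<d. B * nv (unit_vec d i))" by (intro sum_mono mult_right_mono B nv_nonneg) auto
  finally show "nv x \<le> (\<Sum>i<d. nv (unit_vec d i)) * B" by (simp add: sum_distrib_left mult.commute)
qed

lemma rvmult_bounded:
  assumes M: "M \<in> carrier_mat d d"
  shows "\<exists>K\<ge>0. \<forall>x\<in>carrier_vec d. nv (rvmult x M) \<le> K * nv x"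
proof -
  obtain c where c: "c \<ge> 0" "\<And>(x::complex vec) j. x \<in> carrier_vec d \<Longrightarrow> j < d \<Longrightarrow> cmod (x $ j) \<le> c * nv x"
    using coord_le_nv by blast
  obtain b where b: "b \<ge> 0" "\<And>(x::complex vec) B. x \<in> carrier_vec d \<Longrightarrow> (\<And>j. j < d \<Longrightarrow> cmod (x $ j) \<le> B) \<Longrightarrow> nv x \<le> b * B"
    using nv_le_coords by blast
  define S where "S = (\<Sum>i<d. \<Sum>j<d. cmod (M $$ (i,j)))"
  have S0: "S \<ge> 0" unfolding S_def by (intro sum_nonneg) auto
  have "nv (rvmult x M) \<le> b * (c * S * nv x)" if x: "x \<in> carrier_vec d" for x
  proof (rule b(2))
    fix j assume j: "j < d"
    have "rvmult x M $ j = (\<Sum>i<d. x $ i * M $$ (i,j))" by (rule rvmult_index[OF x M j])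
    also have "cmod \<dots> \<le> (\<Sum>i<d. (c * nv x) * (\<Sum>j<d. cmod (M $$ (i,j))))"
    proof (rule sum_norm_le)
      fix i assume "i \<in> {..<d}"
      then show "cmod (x $ i * M $$ (i,j)) \<le> (c * nv x) * (\<Sum>j<d. cmod (M $$ (i,j)))"
        unfolding norm_mult using c(2)[OF x, of i] j c(1) nv_nonneg[OF x]
        by (intro mult_mono member_le_sum) auto
    qed
    also have "\<dots> = c * S * nv x" by (simp add: S_def sum_distrib_left ac_simps)
    finally show "cmod (rvmult x M $ j) \<le> c * S * nv x" .
  qed (use M in simp)
  then show ?thesis using b(1) c(1) S0 by (intro exI[of _ "b * (c * S)"]) (auto simp: mult.assoc)
qed

lemma ind_norm_bdd:
  assumes M: "M \<in> carrier_mat d d"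
  shows "bdd_above ((\<lambda>x. nv (rvmult x M) / nv x) ` (carrier_vec d - {0\<^sub>v d}))"
proof -
  obtain K where K: "\<And>x::complex vec. x \<in> carrier_vec d \<Longrightarrow> nv (rvmult x M) \<le> K * nv x" using rvmult_bounded[OF M] by blast
  show ?thesis
  proof (rule bdd_aboveI2)
    fix x :: "complex vec" assume x: "x \<in> carrier_vec d - {0\<^sub>v d}"
    then have "nv x > 0" using nv_nonneg[of x] nv_eq_0[of x] by simp
    then show "nv (rvmult x M) / nv x \<le> K" using K[of x] x by (simp add: divide_le_eq)
  qed
qed

lemma ind_norm_ge:
  assumes M: "M \<in> carrier_mat d d" and x: "x \<in> carrier_vec d"
  shows "nv (rvmult x M) \<le> ind_norm d nv M * nv x"
proof (cases "x = 0\<^sub>v d")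
  case True
  then show ?thesis using M nv_eq_0[of "0\<^sub>v d"] by simp
next
  case False
  then have "nv x > 0" using nv_nonneg[OF x] nv_eq_0[OF x] by linarith
  moreover have "nv (rvmult x M) / nv x \<le> ind_norm d nv M"
    unfolding ind_norm_def using False x by (intro cSUP_upper ind_norm_bdd[OF M]) auto
  ultimately show ?thesis by (simp add: divide_le_eq)
qed

lemma ind_norm_nonneg:
  assumes M: "M \<in> carrier_mat d d"
  shows "ind_norm d nv M \<ge> 0"
proof -
  let ?x = "unit_vec d 0 :: complex vec"
  have x: "?x \<in> carrier_vec d" by simp
  have "?x \<noteq> 0\<^sub>v d"
  proof
    assume "?x = 0\<^sub>v d"
    then have "?x $ 0 = 0\<^sub>v d $ 0" by simp
    then show False using d1 by simp
  qed
  then have "nv ?x > 0" using nv_nonneg[OF x] nv_eq_0[OF x] by linarith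
  moreover have "0 \<le> ind_norm d nv M * nv ?x"
    by (rule order_trans[OF nv_nonneg ind_norm_ge[OF M x]]) (use M in simp)
  ultimately show ?thesis by (simp add: zero_le_mult_iff)
qed

end

section \<open>Digit products and the growth of the regular sequence\<close>

locale regular_seq = vector_norm +
  fixes q :: nat and A :: "nat \<Rightarrow> complex mat"
  assumes q: "q \<ge> 2" and A: "\<And>r. r < q \<Longrightarrow> A r \<in> carrier_mat d d"
begin

abbreviation "f \<equiv> regf q d A"

lemma regf_0 [simp]: "f 0 = 1\<^sub>m d" by (subst regf.simps) simp

lemma regf_rec: "n > 0 \<Longrightarrow> f n = A (n mod q) * f (n div q)"
  using q by (subst regf.simps) simp

declare regf.simps [simp del]

lemma regf_carrier: "f n \<in> carrier_mat d d"
proof (induction n rule: less_induct)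
  case (less n)
  show ?case
  proof (cases "n = 0")
    case False
    then have "f (n div q) \<in> carrier_mat d d" using q by (intro less) simp
    then show ?thesis using False q A[of "n mod q"] by (simp add: regf_rec)
  qed simp
qed

lemma prods_carrier: "P \<in> prods q d A l \<Longrightarrow> P \<in> carrier_mat d d"
proof -
  assume "P \<in> prods q d A l"
  then obtain rs where rs: "P = foldr (*) (map A rs) (1\<^sub>m d)" "set rs \<subseteq> {..<q}" by (auto simp: prods_def)
  have "foldr (*) (map A rs) (1\<^sub>m d) \<in> carrier_mat d d" using rs(2)
    by (induction rs) (auto intro!: mult_carrier_mat[of _ d d] A)
  then show ?thesis by (simp add: rs)
qed

lemma prods_0: "prods q d A 0 = {1\<^sub>m d}" by (auto simp: prods_def)

lemma prods_Suc: "r < q \<Longrightarrow> P \<in> prods q d A l \<Longrightarrow> A r * P \<in> prods q d A (Suc l)"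
proof -
  assume r: "r < q" and "P \<in> prods q d A l"
  then obtain rs where rs: "P = foldr (*) (map A rs) (1\<^sub>m d)" "length rs = l" "set rs \<subseteq> {..<q}" by (auto simp: prods_def)
  then show ?thesis using r unfolding prods_def by (intro CollectI exI[of _ "r # rs"]) auto
qed

lemma prods_finite: "finite (prods q d A l)"
proof -
  have "prods q d A l = (\<lambda>rs. foldr (*) (map A rs) (1\<^sub>m d)) ` {rs. set rs \<subseteq> {..<q} \<and> length rs = l}"
    by (auto simp: prods_def)
  then show ?thesis by (simp add: finite_lists_length_eq)
qed

lemma prods_nonempty: "prods q d A l \<noteq> {}"
proof (induction l)
  case (Suc l)
  then show ?case using prods_Suc[of 0] q by fastforce
qed (simp add: prods_0)

lemma jsr_l_upper: "P \<in> prods q d A l \<Longrightarrow> root l (ind_norm d nv P) \<le> jsr_l q d A nv l"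
  unfolding jsr_l_def by (intro cSUP_upper bdd_above_finite finite_imageI prods_finite)

lemma jsr_l_nonneg: "l > 0 \<Longrightarrow> jsr_l q d A nv l \<ge> 0"
proof -
  assume "l > 0"
  obtain P where P: "P \<in> prods q d A l" using prods_nonempty by blast
  have "0 \<le> root l (ind_norm d nv P)"
    using ind_norm_nonneg[OF prods_carrier[OF P]] \<open>l > 0\<close> by simp
  then show ?thesis using jsr_l_upper[OF P] by linarith
qed

text \<open>If the infimum is below R, some length l already has its value below R; if it equals R,
  the finiteness property supplies a length attaining it.\<close>

lemma jsr_bound:
  assumes "(finiteness_property q d A nv \<and> R = jsr q d A nv) \<or> jsr q d A nv < R"
  obtains l where "l > 0" "R \<ge> 0" "\<And>P (x::complex vec). P \<in> prods q d A l \<Longrightarrow> x \<in> carrier_vec d \<Longrightarrow> nv (rvmult x P) \<le> R ^ l * nv x"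
proof -
  have "\<exists>l>0. jsr_l q d A nv l \<le> R"
  proof (cases "jsr q d A nv < R")
    case True
    moreover have "bdd_below (jsr_l q d A nv ` {1..})"
      by (rule bdd_belowI2[where m = 0]) (auto intro: jsr_l_nonneg)
    ultimately obtain l where "l \<in> {1..}" "jsr_l q d A nv l < R"
      unfolding jsr_def using cINF_less_iff[of "{1..}" "jsr_l q d A nv" R] by fastforce
    then show ?thesis by (intro exI[of _ l]) auto
  next
    case False
    then show ?thesis using assms unfolding finiteness_property_def by auto
  qed
  then obtain l where l: "l > 0" "jsr_l q d A nv l \<le> R" by blast
  show ?thesis
  proof (rule that[OF l(1)])
    show R0: "R \<ge> 0" using jsr_l_nonneg[OF l(1)] l(2) by linarith
    fix P and x :: "complex vec" assume P: "P \<in> prods q d A l" and x: "x \<in> carrier_vec d"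
    note Pc = prods_carrier[OF P]
    have "ind_norm d nv P = root l (ind_norm d nv P) ^ l"
      using l(1) ind_norm_nonneg[OF Pc] by simp
    also have "\<dots> \<le> R ^ l"
      using jsr_l_upper[OF P] l ind_norm_nonneg[OF Pc] by (intro power_mono) auto
    finally have "ind_norm d nv P * nv x \<le> R ^ l * nv x" using nv_nonneg[OF x] by (intro mult_right_mono)
    then show "nv (rvmult x P) \<le> R ^ l * nv x" using ind_norm_ge[OF Pc x] by linarith
  qed
qed

text \<open>Low digits contribute the leftmost factors, so the last l digits of N split off as a
  product on the left.\<close>

lemma regf_split:
  assumes "N \<ge> q ^ l"
  shows "\<exists>P\<in>prods q d A l. f N = P * f (N div q ^ l)"
  using assms
proof (induction l arbitrary: N)
  case 0
  then show ?case using regf_carrier[of N] by (simp add: prods_0)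
next
  case (Suc l)
  have N: "N > 0" using Suc.prems q by (metis gr0I not_less power_eq_0_iff not_numeral_le_zero zero_less_power le_0_eq)
  have "N div q \<ge> q ^ l" using div_le_mono[OF Suc.prems, of q] q by simp
  then obtain P where P: "P \<in> prods q d A l" "f (N div q) = P * f (N div q div q ^ l)" using Suc.IH by blast
  have "f N = A (N mod q) * (P * f (N div q div q ^ l))" using N P by (simp add: regf_rec)
  also have "\<dots> = (A (N mod q) * P) * f (N div q ^ Suc l)"
    using A[of "N mod q"] q prods_carrier[OF P(1)] regf_carrier
    by (simp add: div_mult2_eq assoc_mult_mat[of _ d d _ d _ d])
  finally show ?case using prods_Suc[OF _ P(1), of "N mod q"] q by auto
qed

text \<open>Strip l digits at a time: each block costs a factor R^l and lowers the level by l. The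
  finitely many indices below q^l go into the constant.\<close>

lemma regf_growth:
  assumes l: "l > 0" and R: "R > 0"
    and bnd: "\<And>P x. P \<in> prods q d A l \<Longrightarrow> x \<in> carrier_vec d \<Longrightarrow> nv (rvmult x P) \<le> R ^ l * nv x"
  obtains K where "K \<ge> 0" "\<And>n N (x::complex vec). q ^ n \<le> N \<Longrightarrow> N < q ^ Suc n \<Longrightarrow> x \<in> carrier_vec d \<Longrightarrow> nv (rvmult x (f N)) \<le> K * R ^ n * nv x"
proof -
  have "\<exists>K\<ge>0. \<forall>x\<in>carrier_vec d. nv (rvmult x (f N)) \<le> K * nv x" for N
    by (rule rvmult_bounded[OF regf_carrier])
  then obtain k where k: "\<And>N. k N \<ge> 0" "\<And>N (x::complex vec). x \<in> carrier_vec d \<Longrightarrow> nv (rvmult x (f N)) \<le> k N * nv x" by metis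
  define K0 where "K0 = (\<Sum>N<q ^ l. k N)"
  \<comment> \<open>A lower bound for R^n over all n < l, which matters when R < 1; it is not the
    joint spectral radius.\<close>
  define \<rho> where "\<rho> = min 1 R ^ l"
  have \<rho>: "\<rho> > 0" using R by (simp add: \<rho>_def)
  have K0: "K0 \<ge> 0" unfolding K0_def by (intro sum_nonneg k)
  define K where "K = K0 / \<rho>"
  have K: "K \<ge> 0" using K0 \<rho> by (simp add: K_def)
  have "nv (rvmult x (f N)) \<le> K * R ^ n * nv x" if "q ^ n \<le> N" "N < q ^ Suc n" "x \<in> carrier_vec d" for n N x
    using that
  proof (induction n arbitrary: N x rule: less_induct)
    case (less n)
    note x = less.prems(3)
    show ?case
    proof (cases "N < q ^ l")
      case True
      then have "q ^ n < q ^ l" using less.prems by linarith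
      then have nl: "n < l" using q by (simp add: power_strict_increasing_iff)
      have "\<rho> \<le> min 1 R ^ n" unfolding \<rho>_def using R nl by (intro power_decreasing) auto
      also have "\<dots> \<le> R ^ n" using R by (intro power_mono) auto
      finally have "K0 \<le> K * R ^ n" using \<rho> K0 by (simp add: K_def field_simps mult_left_mono)
      moreover have "k N \<le> K0" unfolding K0_def using True k by (intro member_le_sum) auto
      ultimately have "k N * nv x \<le> K * R ^ n * nv x" using nv_nonneg[OF x] by (intro mult_right_mono) auto
      then show ?thesis using k(2)[OF x, of N] by linarith
    next
      case False
      then have Nl: "q ^ l \<le> N" by simp
      then have "q ^ l < q ^ Suc n" using less.prems by linarith
      then have "l < Suc n" using q by (simp only: power_strict_increasing_iff)
      then obtain i where n: "n = l + i" using le_Suc_ex by (metis less_Suc_eq_le)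
      obtain P where P: "P \<in> prods q d A l" "f N = P * f (N div q ^ l)" using regf_split[OF Nl] by blast
      note Pc = prods_carrier[OF P(1)]
      have ql: "q ^ l > 0" using q by simp
      have "q ^ i \<le> N div q ^ l" using div_le_mono[OF less.prems(1), of "q ^ l"] ql q by (simp add: n power_add)
      moreover have "N div q ^ l < q ^ Suc i"
        using less.prems(2) by (intro less_mult_imp_div_less) (simp add: n power_add ac_simps)
      ultimately have "nv (rvmult (rvmult x P) (f (N div q ^ l))) \<le> K * R ^ i * nv (rvmult x P)"
        using n l Pc by (intro less.IH) auto
      also have "\<dots> \<le> K * R ^ i * (R ^ l * nv x)" using K R bnd[OF P(1) x] by (intro mult_left_mono) auto
      also have "\<dots> = K * R ^ n * nv x" by (simp add: n power_add)
      finally show ?thesis using P(2) rvmult_mult[OF x Pc regf_carrier] by simp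
    qed
  qed
  then show ?thesis using K that by blast
qed

text \<open>For R = 0 every product of length l annihilates all vectors, and f N has such a product
  as its left factor as soon as N >= q^l.\<close>

lemma regf_eventually_zero:
  assumes l: "l > 0"
    and bnd: "\<And>P x. P \<in> prods q d A l \<Longrightarrow> x \<in> carrier_vec d \<Longrightarrow> nv (rvmult x P) \<le> 0 ^ l * nv x"
    and x: "x \<in> carrier_vec d" and N: "N \<ge> q ^ l"
  shows "rvmult x (f N) = 0\<^sub>v d"
proof -
  obtain P where P: "P \<in> prods q d A l" "f N = P * f (N div q ^ l)" using regf_split[OF N] by blast
  note Pc = prods_carrier[OF P(1)]
  have "nv (rvmult x P) = 0" using bnd[OF P(1) x] l nv_nonneg[of "rvmult x P"] Pc by (simp add: zero_power)
  then have "rvmult x P = 0\<^sub>v d" using nv_eq_0[of "rvmult x P"] Pc by simp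
  then show ?thesis using P(2) rvmult_mult[OF x Pc regf_carrier] regf_carrier by simp
qed

section \<open>The matrix C and the dilation equation for F\<close>

abbreviation "C \<equiv> sumC q d A"

lemma foldr_add_carrier:
  "(\<And>i. i \<in> set xs \<Longrightarrow> g i \<in> carrier_mat d d) \<Longrightarrow> foldr (\<lambda>i acc. g i + acc) xs (0\<^sub>m d d) \<in> carrier_mat d d"
  by (induction xs) auto

lemma sumC_carrier [simp]: "C \<in> carrier_mat d d"
  unfolding sumC_def msum_def by (rule foldr_add_carrier) (use A in auto)

lemma regF_carrier [simp]: "regF q d A N \<in> carrier_mat d d"
  unfolding regF_def msum_def by (rule foldr_add_carrier) (use regf_carrier in auto)

lemmas rvmult_carriers [simp] =
  rvmult_carrier[OF sumC_carrier] rvmult_carrier[OF regF_carrier] rvmult_carrier[OF regf_carrier]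

lemma rvmult_msum_index:
  assumes g: "\<And>i. i < n \<Longrightarrow> g i \<in> carrier_mat d d" and x: "x \<in> carrier_vec d" and j: "j < d"
  shows "rvmult x (msum d g n) $ j = (\<Sum>i<n. rvmult x (g i) $ j)"
proof -
  have "rvmult x (foldr (\<lambda>i acc. g i + acc) xs (0\<^sub>m d d)) $ j = (\<Sum>i\<leftarrow>xs. rvmult x (g i) $ j)" if "set xs \<subseteq> {..<n}" for xs
    using that
  proof (induction xs)
    case Nil
    then show ?case using x j by (simp add: rvmult_index[of _ d _ d])
  next
    case (Cons i xs)
    have "foldr (\<lambda>i acc. g i + acc) xs (0\<^sub>m d d) \<in> carrier_mat d d"
      using Cons.prems g by (intro foldr_add_carrier) auto
    then show ?case using Cons x j g[of i]
      by (simp add: rvmult_add_mat[of _ d] carrier_vecD[OF rvmult_carrier[of _ d d]])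
  qed
  from this[of "[0..<n]"] show ?thesis
    by (simp add: msum_def interv_sum_list_conv_sum_set_nat atLeast0LessThan)
qed

text \<open>C^l is the sum of all q^l products of length l; the induction splits off the first
  factor and sums over its digit.\<close>

lemma nv_sumC_pow:
  assumes "x \<in> carrier_vec d" "\<And>P. P \<in> prods q d A l \<Longrightarrow> nv (rvmult x P) \<le> B"
  shows "nv (rvmult x (C ^\<^sub>m l)) \<le> real q ^ l * B"
  using assms
proof (induction l arbitrary: x)
  case 0
  then show ?case by (simp add: prods_0 carrier_matD[OF sumC_carrier])
next
  case (Suc l)
  note x = Suc.prems(1)
  have M: "C ^\<^sub>m l \<in> carrier_mat d d" by (rule pow_carrier_mat) simp
  have step: "nv (rvmult (rvmult x (foldr (\<lambda>i acc. A i + acc) xs (0\<^sub>m d d))) (C ^\<^sub>m l)) \<le> (\<Sum>i\<leftarrow>xs. real q ^ l * B)"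
    if "set xs \<subseteq> {..<q}" for xs
    using that
  proof (induction xs)
    case Nil
    have "rvmult x (0\<^sub>m d d) = 0\<^sub>v d" using x by (intro eq_vecI) (auto simp: rvmult_def)
    then show ?case using M nv_eq_0[of "0\<^sub>v d"] by simp
  next
    case (Cons i xs)
    let ?F = "foldr (\<lambda>i acc. A i + acc) xs (0\<^sub>m d d)"
    have Fc: "?F \<in> carrier_mat d d" using Cons.prems A by (intro foldr_add_carrier) auto
    have Ai: "A i \<in> carrier_mat d d" using Cons.prems A by auto
    have "rvmult (rvmult x (A i + ?F)) (C ^\<^sub>m l) = rvmult (rvmult x (A i)) (C ^\<^sub>m l) + rvmult (rvmult x ?F) (C ^\<^sub>m l)"
      using x Fc Ai M by (simp add: rvmult_add_mat[of _ d] rvmult_add_vec[of _ d])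
    then have "nv (rvmult (rvmult x (A i + ?F)) (C ^\<^sub>m l)) \<le> nv (rvmult (rvmult x (A i)) (C ^\<^sub>m l)) + nv (rvmult (rvmult x ?F) (C ^\<^sub>m l))"
      by (simp only: nv_triangle[OF rvmult_carrier[OF M] rvmult_carrier[OF M]])
    moreover have "nv (rvmult (rvmult x (A i)) (C ^\<^sub>m l)) \<le> real q ^ l * B"
    proof (rule Suc.IH)
      fix P assume P: "P \<in> prods q d A l"
      have "nv (rvmult x (A i * P)) \<le> B" using Cons.prems P by (intro Suc.prems prods_Suc) auto
      then show "nv (rvmult (rvmult x (A i)) P) \<le> B" using rvmult_mult[OF x Ai prods_carrier[OF P]] by simp
    qed (use Ai in simp)
    ultimately show ?case using Cons by simp
  qed
  have "rvmult x (C ^\<^sub>m Suc l) = rvmult (rvmult x C) (C ^\<^sub>m l)"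
    using rvmult_intertwine[OF x sumC_carrier sumC_carrier sumC_carrier refl, of l] x
    by (simp add: rvmult_pow_Suc[of _ d] del: pow_mat.simps)
  also have "nv \<dots> \<le> (\<Sum>i\<leftarrow>[0..<q]. real q ^ l * B)"
    using step[of "[0..<q]"] by (simp add: sumC_def msum_def atLeast0LessThan)
  finally show ?case by (simp add: sum_list_triv)
qed

text \<open>Compare norms in x C^l = lam^l x, expand C^l into q^l products, each bounded by R^l, and
  take l-th roots.\<close>

lemma eigenvalue_le:
  assumes x: "x \<in> carrier_vec d" "x \<noteq> 0\<^sub>v d" "rvmult x C = lam \<cdot>\<^sub>v x" and l: "l > 0" and R: "R \<ge> 0"
    and bnd: "\<And>P x. P \<in> prods q d A l \<Longrightarrow> x \<in> carrier_vec d \<Longrightarrow> nv (rvmult x P) \<le> R ^ l * nv x"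
  shows "cmod lam \<le> real q * R"
proof -
  have "rvmult x (C ^\<^sub>m k) = lam ^ k \<cdot>\<^sub>v x" for k
  proof (induction k)
    case 0
    then show ?case using x(1) by (simp add: carrier_matD[OF sumC_carrier])
  next
    case (Suc k)
    have "rvmult x (C ^\<^sub>m Suc k) = rvmult (lam ^ k \<cdot>\<^sub>v x) C"
      using Suc x(1) by (simp only: rvmult_pow_Suc[OF _ sumC_carrier])
    then show ?case using x by (simp add: rvmult_smult_vec[of _ d] smult_smult_assoc mult.commute)
  qed
  then have "cmod lam ^ l * nv x = nv (rvmult x (C ^\<^sub>m l))" using x(1) by (simp add: nv_smult norm_power)
  also have "\<dots> \<le> real q ^ l * (R ^ l * nv x)" by (rule nv_sumC_pow[OF x(1)]) (use bnd x(1) in auto)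
  finally have "cmod lam ^ l * nv x \<le> (real q * R) ^ l * nv x" by (simp add: power_mult_distrib)
  moreover have "nv x > 0" using nv_nonneg[OF x(1)] nv_eq_0[OF x(1)] x(2) by linarith
  ultimately have "cmod lam ^ l \<le> (real q * R) ^ l" by simp
  then show ?thesis using l R by (simp add: power_mono_iff)
qed

text \<open>Write the indices below q N as q n + r and use f (q n + r) = A r f n. The only defect is
  at n = r = 0, where f 0 = I stands in place of A 0 f 0; it contributes I - A 0.\<close>

lemma regF_dilate:
  assumes x: "x \<in> carrier_vec d" and N: "N \<ge> 1" and j: "j < d"
  shows "rvmult x (regF q d A (q * N)) $ j = rvmult (rvmult x C) (regF q d A N) $ j + (x $ j - rvmult x (A 0) $ j)"
proof -
  have xC: "rvmult x C \<in> carrier_vec d" by (rule rvmult_carrier[OF sumC_carrier])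
  define g where "g n = rvmult x (f n) $ j" for n
  define h where "h n r = rvmult (rvmult x (A r)) (f n) $ j" for n r
  have gh: "g (q * n + r) = h n r + (if n = 0 \<and> r = 0 then g 0 - h 0 0 else 0)" if "r < q" for n r
  proof (cases "n = 0 \<and> r = 0")
    case False
    then have "q * n + r > 0" using q by auto
    then have "f (q * n + r) = A r * f n" using that by (simp add: regf_rec)
    then show ?thesis using rvmult_mult[OF x A[OF that] regf_carrier]
      unfolding if_not_P[OF False] by (simp add: g_def h_def)
  qed auto
  have hC: "(\<Sum>r<q. h n r) = rvmult (rvmult x C) (f n) $ j" for n
  proof -
    have "rvmult (rvmult x C) (f n) $ j = (\<Sum>i<d. (\<Sum>r<q. rvmult x (A r) $ i) * f n $$ (i,j))"
      unfolding rvmult_index[OF xC regf_carrier j]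
      using x A by (intro sum.cong refl) (auto simp: sumC_def rvmult_msum_index)
    also have "\<dots> = (\<Sum>r<q. \<Sum>i<d. rvmult x (A r) $ i * f n $$ (i,j))"
      unfolding sum_distrib_right by (rule sum.swap)
    also have "\<dots> = (\<Sum>r<q. h n r)"
    proof (rule sum.cong[OF refl])
      fix r assume "r \<in> {..<q}"
      then have "rvmult x (A r) \<in> carrier_vec d" using A by (intro rvmult_carrier[of _ d]) auto
      then show "(\<Sum>i<d. rvmult x (A r) $ i * f n $$ (i,j)) = h n r"
        unfolding h_def by (rule rvmult_index[OF _ regf_carrier j, symmetric])
    qed
    finally show ?thesis by simp
  qed
  have "rvmult x (regF q d A (q * N)) $ j = (\<Sum>n<N * q. g n)"
    unfolding regF_def g_def using x j regf_carrier by (subst rvmult_msum_index) (auto simp: mult.commute)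
  also have "\<dots> = (\<Sum>n<N. \<Sum>r<q. g (q * n + r))"
  proof -
    have "sum g {n * q..<n * q + q} = (\<Sum>r<q. g (q * n + r))" for n
      using sum.shift_bounds_nat_ivl[of g 0 "n * q" q] by (simp add: atLeast0LessThan ac_simps)
    then show ?thesis using sum.nat_group[of g q N] by simp
  qed
  also have "\<dots> = (\<Sum>n<N. (\<Sum>r<q. h n r) + (if n = 0 then g 0 - h 0 0 else 0))"
  proof (rule sum.cong[OF refl])
    fix n :: nat
    have "(\<Sum>r<q. if n = 0 \<and> r = 0 then g 0 - h 0 0 else 0) = (if n = 0 then g 0 - h 0 0 else 0)"
      using q by (cases "n = 0") (auto simp: sum.delta)
    then show "(\<Sum>r<q. g (q * n + r)) = (\<Sum>r<q. h n r) + (if n = 0 then g 0 - h 0 0 else 0)"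
      by (simp add: gh sum.distrib)
  qed
  also have "\<dots> = (\<Sum>n<N. rvmult (rvmult x C) (f n) $ j) + (g 0 - h 0 0)"
    using N by (simp add: sum.distrib hC sum.delta)
  also have "(\<Sum>n<N. rvmult (rvmult x C) (f n) $ j) = rvmult (rvmult x C) (regF q d A N) $ j"
    unfolding regF_def using j regf_carrier xC by (intro rvmult_msum_index[symmetric]) auto
  also have "g 0 - h 0 0 = x $ j - rvmult x (A 0) $ j"
    using x A[of 0] q by (simp add: g_def h_def rvmult_one[of _ d])
  finally show ?thesis .
qed

lemma regF_Suc:
  assumes x: "x \<in> carrier_vec d" and j: "j < d"
  shows "rvmult x (regF q d A (Suc N)) $ j = rvmult x (regF q d A N) $ j + rvmult x (f N) $ j"
  unfolding regF_def using x j regf_carrier by (simp add: rvmult_msum_index)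

end

lemma vsum_index:
  assumes "\<And>k. k < m \<Longrightarrow> g k \<in> carrier_vec d" and "j < d"
  shows "vsum d g m $ j = (\<Sum>k<m. g k $ j)" "vsum d g m \<in> carrier_vec d"
proof -
  have "foldr (\<lambda>i acc. g i + acc) xs (0\<^sub>v d) \<in> carrier_vec d \<and> foldr (\<lambda>i acc. g i + acc) xs (0\<^sub>v d) $ j = (\<Sum>i\<leftarrow>xs. g i $ j)"
    if "set xs \<subseteq> {..<m}" for xs
    using that assms by (induction xs) auto
  from this[of "[0..<m]"] show "vsum d g m $ j = (\<Sum>k<m. g k $ j)" "vsum d g m \<in> carrier_vec d"
    by (auto simp: vsum_def interv_sum_list_conv_sum_set_nat atLeast0LessThan)
qed

section \<open>The chain of a generalised eigenvector\<close>

text \<open>Needed when lam = 1 < R: the theta term, a power of the logarithm, is then itself within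
  the error.\<close>

lemma power_le_geometric:
  fixes R :: real
  assumes "R > 1"
  obtains P where "P \<ge> 0" "\<And>n. (real n + 1) ^ m \<le> P * R ^ n"
proof -
  have b: "0 < 1 / R" "1 / R < 1" using assms by auto
  obtain P where P: "\<And>n. 1 * (1 / R) ^ n * real n ^ m \<le> P"
    using poly_exp_constant_bound[OF b, of 1 m] by blast
  have "(real n + 1) ^ m \<le> (max P 0 * R) * R ^ n" for n
  proof -
    have "real (Suc n) ^ m = (1 * (1 / R) ^ Suc n * real (Suc n) ^ m) * R ^ Suc n"
      using assms by (simp add: power_one_over)
    also have "\<dots> \<le> max P 0 * R ^ Suc n"
      using P[of "Suc n"] assms by (intro mult_right_mono) auto
    finally show ?thesis by (simp add: algebra_simps)
  qed
  then show ?thesis using that[of "max P 0 * R"] assms by simp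
qed

lemma level_O_log_power:
  assumes q: "q \<ge> 2"
  shows "level_O q (\<lambda>n. (real n + 1) ^ m) (\<lambda>N. complex_of_real (log (real q) (real N) ^ m))"
proof (rule level_OI[where B = 1])
  fix n N assume N: "q ^ n \<le> N" "N < q ^ Suc n"
  have "\<bar>log (real q) (real N)\<bar> ^ m \<le> (real n + 1) ^ m"
    using level_log[OF q N] by (intro power_mono) auto
  then show "cmod (complex_of_real (log (real q) (real N) ^ m)) \<le> 1 * (real n + 1) ^ m"
    by (simp add: power_abs norm_power)
qed simp

text \<open>Translates R^n back into N^(log_q R), written as R^(log_q N). The exponents differ by
  less than 1, which for R < 1 costs a factor 1/R.\<close>

lemma level_power_le_powr:
  assumes q: "q \<ge> 2" and R: "R > 0" and N: "q ^ n \<le> N" "N < q ^ Suc n"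
  shows "R ^ n \<le> max 1 (1 / R) * R powr log (real q) (real N)"
proof -
  define t where "t = log (real q) (real N)"
  have t: "real n \<le> t" "t < real n + 1" using level_log[OF q N] by (auto simp: t_def)
  have "R ^ n = R powr (real n - t) * R powr t" using R by (simp add: powr_realpow powr_add[symmetric])
  also have "R powr (real n - t) \<le> max 1 (1 / R)"
  proof (cases "R \<ge> 1")
    case True
    then have "R powr (real n - t) \<le> R powr 0" using t by (intro powr_mono) auto
    then show ?thesis using R by simp
  next
    case False
    then have "R powr (real n - t) \<le> R powr (- 1)" using t R by (intro powr_mono') auto
    then have "R powr (real n - t) \<le> 1 / R" using R by (simp add: powr_minus field_simps)
    then show ?thesis by simp
  qed
  finally show ?thesis by (simp add: t_def mult_right_mono)
qed

lemma periodic_frac: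
  fixes g :: "real \<Rightarrow> 'a"
  assumes "\<And>u. g (u + 1) = g u"
  shows "g (frac u) = g u"
proof -
  have "g (v + of_int i) = g v" for v i
  proof (induction i rule: int_induct[where k = 0])
    case (step1 i) then show ?case using assms[of "v + of_int i"] by (simp add: algebra_simps)
  next
    case (step2 i) then show ?case using assms[of "v + of_int (i - 1)"] by (simp add: algebra_simps)
  qed simp
  from this[of "frac u" "\<lfloor>u\<rfloor>"] show ?thesis by (simp add: frac_def)
qed

text \<open>\<open>dd\<close> and \<open>th\<close> are left arbitrary here: the relations they have
  to satisfy involve \<open>v\<close>, and verifying them uses the facts about \<open>v\<close>
  proved in this locale.\<close>

locale eigen_chain = regular_seq +
  fixes w :: "complex vec" and m :: nat and lam :: complex and dd :: "nat \<Rightarrow> complex vec" and th :: "complex vec"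
  assumes m1: "m \<ge> 1" and w: "w \<in> carrier_vec d"
    and w_ev: "rvmult w ((C - lam \<cdot>\<^sub>m 1\<^sub>m d) ^\<^sub>m m) = 0\<^sub>v d"
    and w_nz: "rvmult w ((C - lam \<cdot>\<^sub>m 1\<^sub>m d) ^\<^sub>m (m - 1)) \<noteq> 0\<^sub>v d"
begin

definition "v k = rvmult w ((C - lam \<cdot>\<^sub>m 1\<^sub>m d) ^\<^sub>m k)"

lemma shift_carrier: "C - lam \<cdot>\<^sub>m 1\<^sub>m d \<in> carrier_mat d d"
  by (intro minus_carrier_mat) simp

lemma v_carrier [simp]: "v k \<in> carrier_vec d"
  unfolding v_def by (rule rvmult_carrier[OF pow_carrier_mat[OF shift_carrier]])

lemma v_0: "v 0 = w"
  using w by (simp add: v_def carrier_matD[OF shift_carrier])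

lemma v_Suc: "v (Suc k) = rvmult (v k) C - lam \<cdot>\<^sub>v v k"
  unfolding v_def rvmult_pow_Suc[OF w shift_carrier]
  by (simp add: v_def[symmetric] rvmult_minus_mat[of _ d] rvmult_smult_mat[of _ d])

lemma v_C: "j < d \<Longrightarrow> rvmult (v k) C $ j = lam * v k $ j + v (Suc k) $ j"
  by (simp add: v_Suc carrier_vecD[OF v_carrier])

lemma v_C_eq: "rvmult (v k) C = lam \<cdot>\<^sub>v v k + v (Suc k)"
  by (rule eq_vecI) (auto simp: v_C carrier_vecD[OF v_carrier] carrier_vecD[OF rvmult_carrier[OF sumC_carrier]])

lemma v_zero: "k \<ge> m \<Longrightarrow> v k = 0\<^sub>v d"
proof (induction k rule: dec_induct)
  case base
  then show ?case using w_ev by (simp add: v_def)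
next
  case (step k)
  then have "v (Suc k) = rvmult (0\<^sub>v d) (C - lam \<cdot>\<^sub>m 1\<^sub>m d)"
    unfolding v_def rvmult_pow_Suc[OF w shift_carrier] by simp
  then show ?case using rvmult_zero_vec[OF shift_carrier] by simp
qed

lemma v_last: "v (m - 1) \<noteq> 0\<^sub>v d" "rvmult (v (m - 1)) C = lam \<cdot>\<^sub>v v (m - 1)"
proof -
  show "v (m - 1) \<noteq> 0\<^sub>v d" using w_nz by (simp add: v_def)
  have "v (Suc (m - 1)) = 0\<^sub>v d" using m1 by (intro v_zero) simp
  then show "rvmult (v (m - 1)) C = lam \<cdot>\<^sub>v v (m - 1)" unfolding v_C_eq by simp
qed

definition "a j k N = rvmult (v k) (regF q d A N) $ j - dd k $ j"

end

text \<open>The vectors \<open>dd k\<close> are the constant terms which make the dilation recursion homogeneous: \<open>v k K\<close>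
  if \<open>\<lambda> \<noteq> 1\<close>, and \<open>- v (k - 1) (I - A 0)\<close> if \<open>\<lambda> = 1\<close>.\<close>

locale eigen_chain_const = eigen_chain +
  assumes dd_rel: "\<And>k j. j < d \<Longrightarrow> v k $ j - rvmult (v k) (A 0) $ j = dd k $ j - lam * dd k $ j - dd (Suc k) $ j"
    and dd_top: "\<And>k j. k > m \<Longrightarrow> j < d \<Longrightarrow> dd k $ j = 0"
    and dd_m: "\<And>j. j < d \<Longrightarrow> - dd m $ j = of_nat (fact m) * th $ j"
    and th_zero: "\<And>j. lam \<noteq> 1 \<Longrightarrow> j < d \<Longrightarrow> th $ j = 0"
begin

text \<open>\<open>dd_rel\<close> is precisely the cancellation of the constant I - A 0 in the
  dilation equation.\<close>

lemma a_scale: "j < d \<Longrightarrow> N \<ge> 1 \<Longrightarrow> a j k (q * N) = lam * a j k N + a j (Suc k) N"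
proof -
  assume j: "j < d" and N: "N \<ge> 1"
  have "rvmult (rvmult (v k) C) (regF q d A N) = lam \<cdot>\<^sub>v rvmult (v k) (regF q d A N) + rvmult (v (Suc k)) (regF q d A N)"
    unfolding v_C_eq by (simp add: rvmult_add_vec[of _ d] rvmult_smult_vec[of _ d])
  then have "rvmult (rvmult (v k) C) (regF q d A N) $ j = lam * rvmult (v k) (regF q d A N) $ j + rvmult (v (Suc k)) (regF q d A N) $ j"
    using j by (simp add: carrier_vecD[OF rvmult_carrier[OF regF_carrier]])
  then show ?thesis
    unfolding a_def regF_dilate[OF v_carrier N j] dd_rel[OF j] by (simp add: algebra_simps)
qed

lemma a_diff: "j < d \<Longrightarrow> a j k (Suc N) - a j k N = rvmult (v k) (f N) $ j"
  by (simp add: a_def regF_Suc)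

lemma a_m: "j < d \<Longrightarrow> a j m N = of_nat (fact m) * th $ j"
  using dd_m[of j] by (simp add: a_def v_zero rvmult_zero_vec[OF regF_carrier])

lemma a_top: "j < d \<Longrightarrow> k > m \<Longrightarrow> a j k N = 0"
  by (simp add: a_def v_zero dd_top rvmult_zero_vec[OF regF_carrier])

definition "err N = rvmult w (regF q d A N) - dd 0 - complex_of_real (log (real q) (real N) ^ m) \<cdot>\<^sub>v th"

context
  assumes dd0: "dd 0 \<in> carrier_vec d" and th: "th \<in> carrier_vec d"
begin

lemma err_carrier: "err N \<in> carrier_vec d"
  using dd0 th by (simp add: err_def)

lemma err_index: "j < d \<Longrightarrow> err N $ j = a j 0 N - of_real (log (real q) (real N) ^ m) * th $ j"
  using dd0 th by (simp add: err_def a_def v_0 carrier_vecD[OF rvmult_carrier[OF regF_carrier]])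

lemma a_inc_level:
  assumes j: "j < d" and l: "l > 0" and R: "R > 0"
    and bnd: "\<And>P x. P \<in> prods q d A l \<Longrightarrow> x \<in> carrier_vec d \<Longrightarrow> nv (rvmult x P) \<le> R ^ l * nv x"
  shows "level_O q (\<lambda>n. R ^ n) (\<lambda>N. a j k (Suc N) - a j k N)"
proof -
  obtain K where K: "K \<ge> 0" "\<And>n N (x::complex vec). q ^ n \<le> N \<Longrightarrow> N < q ^ Suc n \<Longrightarrow> x \<in> carrier_vec d \<Longrightarrow> nv (rvmult x (f N)) \<le> K * R ^ n * nv x"
    using regf_growth[OF l R bnd] by blast
  obtain c where c: "c \<ge> 0" "\<And>(x::complex vec) j. x \<in> carrier_vec d \<Longrightarrow> j < d \<Longrightarrow> cmod (x $ j) \<le> c * nv x"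
    using coord_le_nv by blast
  show ?thesis
  proof (rule level_OI)
    fix n N assume N: "q ^ n \<le> N" "N < q ^ Suc n"
    have "cmod (rvmult (v k) (f N) $ j) \<le> c * nv (rvmult (v k) (f N))"
      using j rvmult_carrier[OF regf_carrier] by (intro c) auto
    also have "\<dots> \<le> c * (K * R ^ n * nv (v k))" using c(1) K(2)[OF N v_carrier] by (intro mult_left_mono)
    finally show "cmod (a j k (Suc N) - a j k N) \<le> (c * K * nv (v k)) * R ^ n"
      using j by (simp add: a_diff algebra_simps)
  qed (use R in simp)
qed

section \<open>The error term for |lam| <= R\<close>

lemma err_nv_level:
  assumes lev: "\<And>j. j < d \<Longrightarrow> level_O q g (\<lambda>N. err N $ j)" and g: "\<And>n. g n \<ge> 0"
  obtains c where "c \<ge> 0" "\<And>n N. q ^ n \<le> N \<Longrightarrow> N < q ^ Suc n \<Longrightarrow> nv (err N) \<le> c * g n"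
proof -
  have "\<exists>B\<ge>0. \<forall>n N. q ^ n \<le> N \<and> N < q ^ Suc n \<longrightarrow> cmod (err N $ j) \<le> B * g n" if "j < d" for j
    using lev[OF that] unfolding level_O_def .
  then obtain B where B: "\<And>j. j < d \<Longrightarrow> B j \<ge> 0"
    "\<And>j n N. j < d \<Longrightarrow> q ^ n \<le> N \<Longrightarrow> N < q ^ Suc n \<Longrightarrow> cmod (err N $ j) \<le> B j * g n" by metis
  define S where "S = (\<Sum>j<d. B j)"
  have S: "S \<ge> 0" unfolding S_def by (intro sum_nonneg B) auto
  obtain b where b: "b \<ge> 0" "\<And>(x::complex vec) B. x \<in> carrier_vec d \<Longrightarrow> (\<And>j. j < d \<Longrightarrow> cmod (x $ j) \<le> B) \<Longrightarrow> nv x \<le> b * B"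
    using nv_le_coords by blast
  show ?thesis
  proof (rule that[of "b * S"])
    fix n N assume N: "q ^ n \<le> N" "N < q ^ Suc n"
    have "nv (err N) \<le> b * (S * g n)"
    proof (rule b(2)[OF err_carrier])
      fix j assume j: "j < d"
      have "B j \<le> S" unfolding S_def using j B(1) by (intro member_le_sum) auto
      then show "cmod (err N $ j) \<le> S * g n" using B(2)[OF j N] mult_right_mono[OF _ g] order_trans by blast
    qed
    then show "nv (err N) \<le> b * S * g n" by (simp add: mult.assoc)
  qed (use b(1) S in simp)
qed

text \<open>\<open>th\<close> can be nonzero only for lam = 1; then |lam| <= R gives R >= 1, and
  inserting R^n merely weakens the bound.\<close>

lemma log_th_level:
  assumes R: "R > 0" and lam: "cmod lam \<le> R" and j: "j < d"
  shows "level_O q (\<lambda>n. R ^ n * (real n + 1) ^ m) (\<lambda>N. of_real (log (real q) (real N) ^ m) * th $ j)"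
proof (cases "lam = 1")
  case True
  then have R1: "R \<ge> 1" using lam by simp
  have "level_O q (\<lambda>n. (real n + 1) ^ m) (\<lambda>N. th $ j * of_real (log (real q) (real N) ^ m))"
    by (intro level_O_const_mult level_O_log_power q)
  then show ?thesis unfolding mult.commute[of _ "th $ j"]
  proof (rule level_O_mono[where K = 1])
    show "(real n + 1) ^ m \<le> 1 * (R ^ n * (real n + 1) ^ m)" for n
      using mult_right_mono[OF one_le_power[OF R1, of n], of "(real n + 1) ^ m"] by simp
  qed (use R in simp)
next
  case False
  then show ?thesis using R j by (intro level_OI[where B = 0]) (auto simp: th_zero)
qed

lemma a_m_level:
  assumes R: "R > 0" and lam: "cmod lam \<le> R" and j: "j < d"
  shows "level_O q (\<lambda>n. R ^ n) (a j m)"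
proof (rule level_OI[where B = "cmod (of_nat (fact m) * th $ j)"])
  fix n N
  show "cmod (a j m N) \<le> cmod (of_nat (fact m) * th $ j) * R ^ n"
  proof (cases "lam = 1")
    case True
    then have "1 \<le> R ^ n" using lam by (intro one_le_power) auto
    from mult_left_mono[OF this norm_ge_zero[of "of_nat (fact m) * th $ j"]] show ?thesis
      unfolding a_m[OF j] by simp
  next
    case False
    then show ?thesis using j th_zero[OF False j] by (simp add: a_m)
  qed
qed (use R in simp)

text \<open>Descend from the constant entry a m; |lam| < R keeps every step free of logarithms. If
  lam = 1, the term with (log_q N)^m is also O(R^n) because R > 1.\<close>

lemma err_less:
  assumes l: "l > 0" and R: "cmod lam < R"
    and bnd: "\<And>P x. P \<in> prods q d A l \<Longrightarrow> x \<in> carrier_vec d \<Longrightarrow> nv (rvmult x P) \<le> R ^ l * nv x"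
  shows "\<exists>c. \<forall>\<^sub>F N in sequentially. nv (err N) \<le> c * R powr log (real q) (real N)"
proof -
  have R0: "R > 0" using R norm_ge_zero[of lam] by linarith
  have errlev: "level_O q (\<lambda>n. R ^ n) (\<lambda>N. err N $ j)" if j: "j < d" for j
  proof -
    have lev: "level_O q (\<lambda>n. R ^ n) (a j (m - i))" if "i \<le> m" for i
      using that
    proof (induction i)
      case 0
      then show ?case using a_m_level[OF R0 _ j] R by simp
    next
      case (Suc i)
      then have e: "Suc (m - Suc i) = m - i" by simp
      show ?case
      proof (rule dilation_growth_less[OF q])
        show "a j (m - Suc i) (q * N) = lam * a j (m - Suc i) N + a j (Suc (m - Suc i)) N" if "N \<ge> 1" for N
          by (rule a_scale[OF j that])
        show "level_O q (\<lambda>n. R ^ n) (\<lambda>N. a j (m - Suc i) (Suc N) - a j (m - Suc i) N)"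
          by (rule a_inc_level[OF j l R0]) (rule bnd)
        show "level_O q (\<lambda>n. R ^ n) (a j (Suc (m - Suc i)))" unfolding e using Suc by simp
      qed (rule R)
    qed
    have "level_O q (\<lambda>n. R ^ n) (\<lambda>N. - th $ j * of_real (log (real q) (real N) ^ m))"
    proof (cases "lam = 1")
      case True
      then have "R > 1" using R by simp
      then obtain P where P: "P \<ge> 0" "\<And>n. (real n + 1) ^ m \<le> P * R ^ n" using power_le_geometric[of R m] by blast
      show ?thesis
        by (rule level_O_mono[OF level_O_const_mult[OF level_O_log_power[OF q]] P(2)]) (use R0 in simp)
    next
      case False
      then show ?thesis using R0 j by (intro level_OI[where B = 0]) (auto simp: th_zero)
    qed
    from level_O_add[OF lev[of m] this] show ?thesis by (simp add: err_index[OF j] mult.commute)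
  qed
  have g: "0 \<le> R ^ n" for n using R0 by simp
  obtain c where c: "c \<ge> 0" "\<And>n N. q ^ n \<le> N \<Longrightarrow> N < q ^ Suc n \<Longrightarrow> nv (err N) \<le> c * R ^ n"
    using err_nv_level[OF errlev g] by blast
  have "nv (err N) \<le> (c * max 1 (1 / R)) * R powr log (real q) (real N)" if N1: "N \<ge> 1" for N
  proof -
    obtain n where n: "q ^ n \<le> N" "N < q ^ Suc n" using level_exists[OF q N1] .
    have "c * R ^ n \<le> c * (max 1 (1 / R) * R powr log (real q) (real N))"
      using c(1) level_power_le_powr[OF q R0 n] by (intro mult_left_mono)
    then show ?thesis using c(2)[OF n] by (simp add: mult.assoc)
  qed
  then show ?thesis by (intro exI eventually_sequentiallyI)
qed

text \<open>Each of the m steps down the chain costs one logarithm, whence the exponent m. For R = 0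
  also lam = 0, and the bound is 0, so the error has to vanish for all large N.\<close>

lemma err_eq:
  assumes l: "l > 0" and R: "cmod lam = R"
    and bnd: "\<And>P x. P \<in> prods q d A l \<Longrightarrow> x \<in> carrier_vec d \<Longrightarrow> nv (rvmult x P) \<le> R ^ l * nv x"
  shows "\<exists>c. \<forall>\<^sub>F N in sequentially. nv (err N) \<le> c * R powr log (real q) (real N) * ln (real N) ^ m"
proof (cases "R = 0")
  case True
  then have lam0: "lam = 0" using R by simp
  have ez: "\<forall>\<^sub>F N in sequentially. a j (m - i) N = 0" if j: "j < d" and "i \<le> m" for i j
    using that(2)
  proof (induction i)
    case 0
    then show ?case using a_m[OF j] th_zero[OF _ j] lam0 by simp
  next
    case (Suc i)
    then have e: "Suc (m - Suc i) = m - i" by simp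
    show ?case
    proof (rule dilation_eventually_zero[OF q])
      show "a j (m - Suc i) (q * N) = a j (m - i) N" if "N \<ge> 1" for N
        using a_scale[OF j that, of "m - Suc i"] unfolding e lam0 by simp
      show "\<forall>\<^sub>F N in sequentially. a j (m - Suc i) (Suc N) = a j (m - Suc i) N"
      proof (rule eventually_sequentiallyI[of "q ^ l"])
        fix N assume "q ^ l \<le> N"
        then have "rvmult (v (m - Suc i)) (f N) = 0\<^sub>v d"
          using bnd True by (intro regf_eventually_zero[OF l _ v_carrier]) auto
        then show "a j (m - Suc i) (Suc N) = a j (m - Suc i) N" using a_diff[OF j, of "m - Suc i" N] j by simp
      qed
    qed (use Suc in simp)
  qed
  have "\<forall>\<^sub>F N in sequentially. \<forall>j\<in>{..<d}. a j 0 N = 0"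
    using ez[of _ m] by (intro eventually_ball_finite) auto
  then have "\<forall>\<^sub>F N in sequentially. nv (err N) \<le> 0 * R powr log (real q) (real N) * ln (real N) ^ m"
  proof eventually_elim
    case (elim N)
    then have "err N = 0\<^sub>v d" using err_carrier[of N] lam0
      by (intro eq_vecI) (auto simp: err_index th_zero)
    then show ?case using nv_eq_0[of "0\<^sub>v d"] by simp
  qed
  then show ?thesis by blast
next
  case False
  then have R0: "R > 0" using R norm_ge_zero[of lam] by linarith
  have Rle: "cmod lam \<le> R" using R by simp
  have errlev: "level_O q (\<lambda>n. R ^ n * (real n + 1) ^ m) (\<lambda>N. err N $ j)" if j: "j < d" for j
  proof -
    have lev: "level_O q (\<lambda>n. R ^ n * (real n + 1) ^ i) (a j (m - i))" if "i \<le> m" for i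
      using that
    proof (induction i)
      case 0
      then show ?case using a_m_level[OF R0 Rle j] by simp
    next
      case (Suc i)
      then have e: "Suc (m - Suc i) = m - i" by simp
      show ?case
      proof (rule dilation_growth_le[OF q])
        show "a j (m - Suc i) (q * N) = lam * a j (m - Suc i) N + a j (Suc (m - Suc i)) N" if "N \<ge> 1" for N
          by (rule a_scale[OF j that])
        show "level_O q (\<lambda>n. R ^ n) (\<lambda>N. a j (m - Suc i) (Suc N) - a j (m - Suc i) N)"
          by (rule a_inc_level[OF j l R0]) (rule bnd)
        show "level_O q (\<lambda>n. R ^ n * (real n + 1) ^ i) (a j (Suc (m - Suc i)))" unfolding e using Suc by simp
      qed (rule Rle R0)+
    qed
    have "level_O q (\<lambda>n. R ^ n * (real n + 1) ^ m) (\<lambda>N. (- 1) * (of_real (log (real q) (real N) ^ m) * th $ j))"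
      by (rule level_O_const_mult[OF log_th_level[OF R0 Rle j]])
    from level_O_add[OF lev[of m] this] show ?thesis by (simp add: err_index[OF j])
  qed
  have g: "0 \<le> R ^ n * (real n + 1) ^ m" for n using R0 by simp
  obtain c where c: "c \<ge> 0" "\<And>n N. q ^ n \<le> N \<Longrightarrow> N < q ^ Suc n \<Longrightarrow> nv (err N) \<le> c * (R ^ n * (real n + 1) ^ m)"
    using err_nv_level[OF errlev g] by blast
  \<comment> \<open>From N >= q on, t = log_q N is at least 1, so n + 1 <= 2 t; the factor 2 / ln q
    converts ln N into 2 t.\<close>
  have "nv (err N) \<le> (c * max 1 (1 / R) * (2 / ln (real q)) ^ m) * R powr log (real q) (real N) * ln (real N) ^ m" if N: "N \<ge> q" for N
  proof -
    have N1: "N \<ge> 1" using N q by simp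
    obtain n where n: "q ^ n \<le> N" "N < q ^ Suc n" using level_exists[OF q N1] .
    define t where "t = log (real q) (real N)"
    have "t \<ge> log (real q) (real q)" unfolding t_def using N q by (subst log_le_cancel_iff) auto
    then have t1: "t \<ge> 1" using q by simp
    have tn: "real n \<le> t" using level_log[OF q n] by (simp add: t_def)
    have tl: "2 * t = 2 / ln (real q) * ln (real N)" by (simp add: t_def log_def)
    have "(real n + 1) ^ m \<le> (2 * t) ^ m" using t1 tn by (intro power_mono) auto
    then have "R ^ n * (real n + 1) ^ m \<le> (max 1 (1 / R) * R powr t) * (2 * t) ^ m"
      using level_power_le_powr[OF q R0 n] t1 by (intro mult_mono) (auto simp: t_def)
    then have "c * (R ^ n * (real n + 1) ^ m) \<le> c * ((max 1 (1 / R) * R powr t) * (2 * t) ^ m)"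
      using c(1) by (intro mult_left_mono)
    then have "nv (err N) \<le> c * ((max 1 (1 / R) * R powr t) * (2 * t) ^ m)" using c(2)[OF n] by linarith
    also have "\<dots> = (c * max 1 (1 / R) * (2 / ln (real q)) ^ m) * R powr t * ln (real N) ^ m"
      unfolding tl power_mult_distrib by simp
    finally show ?thesis by (simp add: t_def)
  qed
  then show ?thesis by (intro exI eventually_sequentiallyI)
qed

section \<open>The fluctuations for |lam| > R\<close>

definition "Phi i u = vec d (\<lambda>j. dil_phi q m lam (a j) i u)"

lemma Phi_index: "j < d \<Longrightarrow> Phi i u $ j = dil_phi q m lam (a j) i u"
  by (simp add: Phi_def)

lemma Phi_carrier: "Phi i u \<in> carrier_vec d" by (simp add: Phi_def)

context
  fixes R :: real and l :: nat
  assumes l: "l > 0" and R: "R \<ge> 0" "R < cmod lam"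
    and bnd: "\<And>P x. P \<in> prods q d A l \<Longrightarrow> x \<in> carrier_vec d \<Longrightarrow> nv (rvmult x P) \<le> R ^ l * nv x"
begin

text \<open>The eigenvector used is the last nonzero vector of the chain.\<close>

lemma lam_le: "cmod lam \<le> real q * R"
  by (rule eigenvalue_le[OF v_carrier v_last l R(1) bnd])

lemma R_pos: "R > 0"
  using lam_le R by (cases "R = 0") auto

lemmas dil_hyps = q a_scale a_inc_level[OF _ l R_pos bnd] a_top R_pos R(2) lam_le

lemma Phi_periodic: "Phi i (u + 1) = Phi i u"
proof (rule eq_vecI)
  fix j assume "j < dim_vec (Phi i u)"
  then have j: "j < d" by (simp add: Phi_def)
  have "dil_phi q m lam (a j) i (u + 1) = dil_phi q m lam (a j) i u"
    by (rule dil_phi_periodic[where R = R]) (use j in \<open>auto intro: dil_hyps\<close>)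
  then show "Phi i (u + 1) $ j = Phi i u $ j" using j by (simp add: Phi_index)
qed (simp add: Phi_def)

lemma Phi_continuous:
  assumes j: "j < d" shows "continuous_on UNIV (\<lambda>u. Phi i u $ j)"
  unfolding Phi_index[OF j] by (rule dil_phi_continuous[where R = R]) (use j in \<open>auto intro: dil_hyps\<close>)

lemma Phi_holder:
  assumes \<alpha>: "\<alpha> > 0" "R * real q powr \<alpha> < cmod lam"
  shows "\<exists>c. \<forall>x y. nv (Phi i x - Phi i y) \<le> c * \<bar>x - y\<bar> powr \<alpha>"
proof -
  have "\<exists>B. \<forall>u v. cmod (dil_phi q m lam (a j) i u - dil_phi q m lam (a j) i v) \<le> B * \<bar>u - v\<bar> powr \<alpha>" if j: "j < d" for j
    by (rule dil_phi_holder[where R = R, OF _ _ _ _ _ _ _ \<alpha>]) (use j in \<open>auto intro: dil_hyps\<close>)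
  then obtain B where B: "\<And>j u v. j < d \<Longrightarrow> cmod (dil_phi q m lam (a j) i u - dil_phi q m lam (a j) i v) \<le> B j * \<bar>u - v\<bar> powr \<alpha>"
    by metis
  define S where "S = (\<Sum>j<d. \<bar>B j\<bar>)"
  obtain b where b: "b \<ge> 0" "\<And>(x::complex vec) B. x \<in> carrier_vec d \<Longrightarrow> (\<And>j. j < d \<Longrightarrow> cmod (x $ j) \<le> B) \<Longrightarrow> nv x \<le> b * B"
    using nv_le_coords by blast
  have "nv (Phi i x - Phi i y) \<le> b * (S * \<bar>x - y\<bar> powr \<alpha>)" for x y
  proof (rule b(2))
    fix j assume j: "j < d"
    have "\<bar>B j\<bar> \<le> S" unfolding S_def using j by (intro member_le_sum) auto
    then have "B j * \<bar>x - y\<bar> powr \<alpha> \<le> S * \<bar>x - y\<bar> powr \<alpha>" by (intro mult_right_mono) auto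
    then show "cmod ((Phi i x - Phi i y) $ j) \<le> S * \<bar>x - y\<bar> powr \<alpha>"
      using B[OF j, of x y] j by (simp add: Phi_def)
  qed (simp add: Phi_def)
  then show ?thesis by (intro exI[of _ "b * S"]) (simp add: mult.assoc)
qed

text \<open>The chain expansion contains the powers 0, ..., m of log_q N. The top one is exactly the
  theta term removed in \<open>err\<close>; the others carry the fluctuations.\<close>

lemma Phi_expansion:
  assumes N: "N \<ge> 1"
  shows "err N = (of_nat N powr (Ln lam / complex_of_real (ln (real q)))) \<cdot>\<^sub>v
    vsum d (\<lambda>k. complex_of_real (log q (real N) ^ k) \<cdot>\<^sub>v Phi k (frac (log q (real N)))) m"
proof (rule eq_vecI)
  define t where "t = log (real q) (real N)"
  let ?g = "\<lambda>k. complex_of_real (t ^ k) \<cdot>\<^sub>v Phi k (frac t)"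
  have g: "?g k \<in> carrier_vec d" for k by (simp add: Phi_def)
  have vc: "vsum d ?g m \<in> carrier_vec d" by (rule vsum_index(2)[of m ?g d 0]) (use g d1 in auto)
  then show "dim_vec (err N) = dim_vec (of_nat N powr (Ln lam / complex_of_real (ln (real q))) \<cdot>\<^sub>v
    vsum d (\<lambda>k. complex_of_real (log q (real N) ^ k) \<cdot>\<^sub>v Phi k (frac (log q (real N)))) m)"
    using err_carrier[of N] by (simp add: t_def)
  fix j assume "j < dim_vec (of_nat N powr (Ln lam / complex_of_real (ln (real q))) \<cdot>\<^sub>v
    vsum d (\<lambda>k. complex_of_real (log q (real N) ^ k) \<cdot>\<^sub>v Phi k (frac (log q (real N)))) m)"
  then have j: "j < d" using vc by (simp add: t_def)
  have "a j 0 N = cpow lam t * (\<Sum>i\<le>m. of_real (t ^ i) * dil_phi q m lam (a j) i t)"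
    unfolding t_def by (rule dil_expansion[where R = R, OF _ _ _ _ _ _ _ N]) (use j in \<open>auto intro: dil_hyps\<close>)
  also have "\<dots> = cpow lam t * (\<Sum>i<m. of_real (t ^ i) * dil_phi q m lam (a j) i t) + of_real (t ^ m) * (cpow lam t * dil_phi q m lam (a j) m t)"
    by (simp add: lessThan_Suc_atMost[symmetric] algebra_simps)
  \<comment> \<open>The entry a m is the constant m! th. For lam = 1 the limit of p m equals it, and
    the leading coefficient 1/m! leaves th; for other lam both sides are 0.\<close>
  also have "cpow lam t * dil_phi q m lam (a j) m t = th $ j"
  proof -
    define b where "b = of_nat (fact m) * th $ j"
    have dp: "dil_phi q m lam (a j) m t = b / fact m"
    proof (rule dil_phi_last[OF q])
      show "cpow lam (- log (real q) (real N)) * (a j m N / lam ^ m) = b" for N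
      proof (cases "lam = 1")
        case True
        then have "cpow lam (- log (real q) (real N)) = 1" "lam ^ m = 1" by (simp_all add: cpow_def)
        then show ?thesis unfolding a_m[OF j] b_def by simp
      next
        case False
        then show ?thesis using th_zero[OF False j] by (simp add: a_m[OF j] b_def)
      qed
    qed (use j a_top in auto)
    show ?thesis unfolding dp using th_zero[OF _ j] by (cases "lam = 1") (auto simp: b_def cpow_def)
  qed
  finally have "err N $ j = cpow lam t * (\<Sum>i<m. of_real (t ^ i) * dil_phi q m lam (a j) i t)"
    by (simp add: err_index[OF j] t_def)
  also have "(\<Sum>i<m. of_real (t ^ i) * dil_phi q m lam (a j) i t) = vsum d ?g m $ j"
  proof -
    have "Phi k (frac t) = Phi k t" for k by (rule periodic_frac) (rule Phi_periodic)
    then show ?thesis using vsum_index(1)[of m ?g d j] g j by (simp add: Phi_def)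
  qed
  finally show "err N $ j = (of_nat N powr (Ln lam / complex_of_real (ln (real q))) \<cdot>\<^sub>v
    vsum d (\<lambda>k. complex_of_real (log q (real N) ^ k) \<cdot>\<^sub>v Phi k (frac (log q (real N)))) m) $ j"
    using vc j cpow_powr[OF N q, of lam] by (simp add: t_def)
qed

text \<open>Summing \<open>fix1\<close> over the digits shows that lam = q. All f n fix v (m - 1),
  so v (m - 1) F N is N times this vector, and N = q^(log_q N) is cancelled by lam^(-log_q N): p (m
  - 1) is constant.\<close>

lemma Phi_const:
  assumes fix1: "\<And>r. r < q \<Longrightarrow> rvmult (v (m - 1)) (A r) = v (m - 1)"
  shows "Phi (m - 1) u = complex_of_real (1 / (real q ^ (m - 1) * fact (m - 1))) \<cdot>\<^sub>v rvmult w ((C - of_nat q \<cdot>\<^sub>m 1\<^sub>m d) ^\<^sub>m (m - 1))"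
proof -
  define M where "M = m - 1"
  have m': "Suc M = m" using m1 by (simp add: M_def)
  note fix1 = fix1[folded M_def] and v_last = v_last[folded M_def]
  let ?v = "v M"
  have vC: "rvmult ?v C $ j = of_nat q * ?v $ j" if j: "j < d" for j
    using j A by (simp add: sumC_def rvmult_msum_index fix1)
  obtain i where i: "i < d" "?v $ i \<noteq> 0"
    using v_last(1) by (metis eq_vecI index_zero_vec carrier_vecD v_carrier)
  have "(lam \<cdot>\<^sub>v ?v) $ i = of_nat q * ?v $ i" using vC[OF i(1)] unfolding v_last(2) .
  then have "lam * ?v $ i = of_nat q * ?v $ i" using i(1) carrier_vecD[OF v_carrier[of M]] by simp
  then have lamq: "lam = of_nat q" using i by simp
  then have lam1: "lam \<noteq> 1" using q by (metis of_nat_1 of_nat_eq_iff not_numeral_le_zero numeral_le_one_iff semiring_norm(69))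
  have vf: "rvmult ?v (f n) = ?v" for n
  proof (induction n rule: less_induct)
    case (less n)
    show ?case
    proof (cases "n = 0")
      case False
      have r: "n mod q < q" "n div q < n" using q False by auto
      have "rvmult ?v (f n) = rvmult (rvmult ?v (A (n mod q))) (f (n div q))"
        using False by (simp add: regf_rec rvmult_mult[OF v_carrier A[OF r(1)] regf_carrier])
      then show ?thesis using fix1[OF r(1)] less[OF r(2)] by simp
    qed simp
  qed
  \<comment> \<open>A 0 fixes the vector and the next constant is zero, so (1 - lam) dd (m - 1) = 0
    and no constant disturbs a (m - 1).\<close>
  have dd0': "dd M $ j = 0" if j: "j < d" for j
  proof -
    have "dd m $ j = 0" using dd_m[OF j] th_zero[OF lam1 j] by simp
    then have "(1 - lam) * dd M $ j = 0"
      using dd_rel[OF j, of "M"] fix1[of 0] q unfolding m' by (simp add: algebra_simps)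
    then show ?thesis using lam1 by simp
  qed
  have a1: "a j M N = of_nat N * ?v $ j" if j: "j < d" for j N
    using j regf_carrier by (simp add: a_def dd0' regF_def rvmult_msum_index vf)
  have dp: "dil_phi q m lam (a j) M u = (?v $ j / of_nat q ^ M) / fact M" if j: "j < d" for j
  proof (rule dil_phi_last[OF q])
    show "a j k N = 0" if "M < k" for k N
      using that m' a_top[OF j, of k N] a_m[OF j, of N] th_zero[OF lam1 j] by (cases "k = m") auto
    fix N :: nat assume N: "N \<ge> 1"
    have cN: "cpow lam (log (real q) (real N)) = of_nat N"
    proof -
      have "Ln lam = of_real (ln (real q))" using Ln_of_real[of "real q"] q by (simp add: lamq)
      then have "of_real (log (real q) (real N)) * Ln lam = of_real (ln (real N))"
        using q by (simp add: log_def)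
      then show ?thesis using N by (simp add: cpow_def exp_of_real)
    qed
    have "lam ^ M = of_nat q ^ M" by (simp add: lamq)
    then show "cpow lam (- log (real q) (real N)) * (a j M N / lam ^ M) = ?v $ j / of_nat q ^ M"
      unfolding cpow_minus cN a1[OF j] using N by simp
  qed (use m' in simp)
  have vq: "rvmult w ((C - of_nat q \<cdot>\<^sub>m 1\<^sub>m d) ^\<^sub>m M) = ?v"
    unfolding lamq[symmetric] v_def ..
  note vdim = carrier_vecD[OF v_carrier[of M]]
  show ?thesis unfolding M_def[symmetric] vq
  proof (rule eq_vecI)
    fix j assume "j < dim_vec (complex_of_real (1 / (real q ^ M * fact M)) \<cdot>\<^sub>v ?v)"
    then have j: "j < d" by (simp add: vdim)
    then show "Phi M u $ j = (complex_of_real (1 / (real q ^ M * fact M)) \<cdot>\<^sub>v ?v) $ j"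
      by (simp add: Phi_index dp vdim)
  qed (simp add: Phi_def vdim)
qed

end
end
end

section \<open>The asymptotic expansion\<close>

context jordan_data
begin

lemma complement_conj: "Ti * (1\<^sub>m d - D) * T = 1\<^sub>m d - P"
proof -
  have "Ti * (1\<^sub>m d - D) = Ti * 1\<^sub>m d - Ti * D"
    using Ti by (intro mult_minus_distrib_mat) auto
  moreover have "(Ti * 1\<^sub>m d - Ti * D) * T = Ti * 1\<^sub>m d * T - Ti * D * T"
    using Ti T mult_carrier_mat[OF Ti Dmat_carrier] by (intro minus_mult_distrib_mat[of _ d d]) auto
  ultimately show ?thesis using Ti by (simp add: TiT P_def)
qed

lemma rvmult_pow_P:
  assumes w: "w \<in> carrier_vec d" "rvmult w P = w"
  shows "rvmult (rvmult w ((C - lam \<cdot>\<^sub>m 1\<^sub>m d) ^\<^sub>m k)) P = rvmult w ((C - lam \<cdot>\<^sub>m 1\<^sub>m d) ^\<^sub>m k)"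
proof -
  have "P * (C - lam \<cdot>\<^sub>m 1\<^sub>m d) = (C - lam \<cdot>\<^sub>m 1\<^sub>m d) * P"
    using C P_comm by (intro shift_comm) auto
  from rvmult_intertwine[OF w(1) P_carrier _ _ this, of k] show ?thesis
    using w C by (simp add: minus_carrier_mat)
qed

text \<open>For B = I - A 0 the matrix P L B is K, and this reads x (I - C) K = x (I - A 0):
  subtracting x K absorbs the constant of the dilation equation.\<close>

lemma fixed_equation:
  assumes L: "L \<in> carrier_mat d d" "(1\<^sub>m d - Ti * D * J * T) * L = 1\<^sub>m d" and B: "B \<in> carrier_mat d d"
    and x: "x \<in> carrier_vec d" "rvmult x P = x"
  shows "rvmult x (P * L * B) - rvmult (rvmult x C) (P * L * B) = rvmult x B"
proof -
  have PL: "P * L \<in> carrier_mat d d" using L(1) by (intro mult_carrier_mat[OF P_carrier])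
  have K: "P * L * B \<in> carrier_mat d d" by (rule mult_carrier_mat[OF PL B])
  have IC: "1\<^sub>m d - C \<in> carrier_mat d d" using C by (intro minus_carrier_mat)
  have "rvmult x (P * L * B) - rvmult (rvmult x C) (P * L * B) = rvmult x (P * L * B) - rvmult x (C * (P * L * B))"
    using x C K by (simp add: rvmult_mult[of _ d])
  also have "\<dots> = rvmult x ((1\<^sub>m d - C) * (P * L * B))"
    using x C K mult_carrier_mat[OF C K]
    by (subst minus_mult_distrib_mat[of _ d d _ _ d]) (auto simp: rvmult_minus_mat[of _ d] left_mult_one_mat[of _ d d])
  also have "(1\<^sub>m d - C) * (P * L * B) = ((1\<^sub>m d - C) * (P * L)) * B"
    using IC PL B by (intro assoc_mult_mat[symmetric])
  also have "\<dots> = P * B" by (simp add: shift_P[OF L])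
  finally show ?thesis using x B by (simp add: rvmult_mult[of _ d])
qed

end

theorem theoremA1:
  fixes q d :: nat and A :: "nat \<Rightarrow> complex mat" and nv :: "complex vec \<Rightarrow> real"
    and R :: real and T Ti J :: "complex mat" and n_as :: "(nat \<times> complex) list"
    and w :: "complex vec" and m :: nat and lam :: complex
  assumes q: "q \<ge> 2" and d: "d \<ge> 1"
    and A: "\<forall>r<q. A r \<in> carrier_mat d d"
    and norm: "is_vec_norm d nv"
    and R: "(finiteness_property q d A nv \<and> R = jsr q d A nv) \<or>
            (\<not> finiteness_property q d A nv \<and> jsr q d A nv < R \<and>
             (\<forall>\<mu>. eigenvalue (sumC q d A) \<mu> \<longrightarrow> \<not> (jsr q d A nv < cmod \<mu> \<and> cmod \<mu> \<le> R)))"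
    and T: "T \<in> carrier_mat d d" "Ti \<in> carrier_mat d d" "T * Ti = 1\<^sub>m d" "Ti * T = 1\<^sub>m d"
    and J: "J = jordan_matrix n_as" "J \<in> carrier_mat d d" "T * sumC q d A * Ti = J"
    and m: "m \<ge> 1"
    and w: "gen_left_eigvec d (sumC q d A) w m lam"
  shows
    "(let C = sumC q d A; K = Kmat d A T Ti J; th = theta q d A T Ti J m;
          err = (\<lambda>N. rvmult w (regF q d A N) - rvmult w K
                      - complex_of_real (log q (real N) ^ m) \<cdot>\<^sub>v rvmult w th)
      in
      (cmod lam < R \<longrightarrow>
         (\<exists>c. \<forall>\<^sub>F N in sequentially. nv (err N) \<le> c * R powr log q (real N))) \<and>
      (cmod lam = R \<longrightarrow>
         (\<exists>c. \<forall>\<^sub>F N in sequentially.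
              nv (err N) \<le> c * R powr log q (real N) * ln (real N) ^ m)) \<and>
      (cmod lam > R \<longrightarrow>
         (\<exists>\<Phi> :: nat \<Rightarrow> real \<Rightarrow> complex vec.
            (\<forall>k<m. \<forall>u. \<Phi> k u \<in> carrier_vec d) \<and>
            (\<forall>k<m. \<forall>u. \<Phi> k (u + 1) = \<Phi> k u) \<and>
            (\<forall>k<m. \<forall>j<d. continuous_on UNIV (\<lambda>u. \<Phi> k u $ j)) \<and>
            (\<forall>N. N \<ge> q ^ (m - 1) \<longrightarrow>
               err N = (of_nat N powr (Ln lam / complex_of_real (ln (real q)))) \<cdot>\<^sub>v
                   vsum d (\<lambda>k. complex_of_real (log q (real N) ^ k) \<cdot>\<^sub>v \<Phi> k (frac (log q (real N)))) m) \<and>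
            (\<forall>k<m. \<forall>\<alpha>. 0 < \<alpha> \<and> R * real q powr \<alpha> < cmod lam \<longrightarrow>
               (\<exists>c. \<forall>x y. nv (\<Phi> k x - \<Phi> k y) \<le> c * \<bar>x - y\<bar> powr \<alpha>)) \<and>
            ((\<forall>r<q. rvmult (rvmult w ((C - lam \<cdot>\<^sub>m 1\<^sub>m d) ^\<^sub>m (m - 1))) (A r)
                      = rvmult w ((C - lam \<cdot>\<^sub>m 1\<^sub>m d) ^\<^sub>m (m - 1))) \<longrightarrow>
               (\<forall>u. \<Phi> (m - 1) u = complex_of_real (1 / (real q ^ (m - 1) * fact (m - 1))) \<cdot>\<^sub>v
                      rvmult w ((C - of_nat q \<cdot>\<^sub>m 1\<^sub>m d) ^\<^sub>m (m - 1)))))) \<and>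
      (lam = 1 \<longrightarrow> rvmult w K = 0\<^sub>v d) \<and>
      (lam \<noteq> 1 \<longrightarrow> rvmult w th = 0\<^sub>v d))"
proof -
  interpret S: regular_seq d nv q A
    by unfold_locales (use q d A norm in auto)
  have dim: "d = sum_list (map fst n_as)" using J(1,2) by auto
  interpret Jd: jordan_data d "sumC q d A" T Ti J
  proof unfold_locales
    show "J $$ (i,j) = 0" if "i < d" "j < i" for i j
      using that unfolding J(1) dim by (rule jordan_matrix_upper_triangular)
    show "J $$ (i,i) = J $$ (j,j)" if "i < d" "j < d" "J $$ (i,j) \<noteq> 0" for i j
      using that unfolding J(1) dim by (rule jordan_matrix_diag_eq)
  qed (rule S.sumC_carrier T J(2,3))+
  obtain l where l: "l > 0" "R \<ge> 0" and bnd: "\<And>P (x::complex vec). P \<in> prods q d A l \<Longrightarrow> x \<in> carrier_vec d \<Longrightarrow> nv (rvmult x P) \<le> R ^ l * nv x"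
    using S.jsr_bound[of R] R by blast
  have wc: "w \<in> carrier_vec d" and wev: "rvmult w ((sumC q d A - lam \<cdot>\<^sub>m 1\<^sub>m d) ^\<^sub>m m) = 0\<^sub>v d"
    and wnz: "rvmult w ((sumC q d A - lam \<cdot>\<^sub>m 1\<^sub>m d) ^\<^sub>m (m - 1)) \<noteq> 0\<^sub>v d"
    using w by (auto simp: gen_left_eigvec_def)
  obtain L where L: "mat_inverse (1\<^sub>m d - Ti * Dmat d J * J * T) = Some L" "L \<in> carrier_mat d d"
    "(1\<^sub>m d - Ti * Dmat d J * J * T) * L = 1\<^sub>m d" using Jd.inverse_exists by blast
  define K where "K = Kmat d A T Ti J"
  define th where "th = rvmult w (theta q d A T Ti J m)"
  have A0: "A 0 \<in> carrier_mat d d" using A q by simp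
  have B: "1\<^sub>m d - A 0 \<in> carrier_mat d d" using A0 by (intro minus_carrier_mat)
  have K_eq: "K = Jd.P * L * (1\<^sub>m d - A 0)"
    by (simp add: K_def Kmat_def Let_def L(1) Jd.P_def)
  have PL: "Jd.P * L \<in> carrier_mat d d" using L(2) by (intro mult_carrier_mat[OF Jd.P_carrier])
  have Kc: "K \<in> carrier_mat d d" unfolding K_eq by (rule mult_carrier_mat[OF PL B])
  have xB: "rvmult x (1\<^sub>m d - A 0) = x - rvmult x (A 0)" if "x \<in> carrier_vec d" for x
    using that A0 by (simp add: rvmult_minus_mat[of _ d])
  have w0: "w - w = 0\<^sub>v d" using wc by (intro eq_vecI) auto
  define vv where "vv k = rvmult w ((sumC q d A - lam \<cdot>\<^sub>m 1\<^sub>m d) ^\<^sub>m k)" for k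
  define dd where "dd k = (if lam = 1 then case k of 0 \<Rightarrow> 0\<^sub>v d | Suc i \<Rightarrow> - rvmult (vv i) (1\<^sub>m d - A 0) else rvmult (vv k) K)" for k

  interpret E: eigen_chain d nv q A w m lam dd th
    by unfold_locales (use m wc wev wnz in auto)
  have vv: "E.v = vv" by (rule ext) (simp add: E.v_def vv_def)
  have vvc: "vv k \<in> carrier_vec d" for k using E.v_carrier by (simp add: vv)

  have M: "(sumC q d A - 1\<^sub>m d) ^\<^sub>m (m - 1) \<in> carrier_mat d d"
    by (intro pow_carrier_mat minus_carrier_mat) simp
  have IP: "1\<^sub>m d - Jd.P \<in> carrier_mat d d" by (intro minus_carrier_mat) simp
  \<comment> \<open>As Ti (I - D) T = I - P, \<open>theta\<close> sees only the part of w in the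
    generalised eigenspace of 1: all of w if lam = 1, nothing otherwise.\<close>
  have th_eq: "th = (1 / of_nat (fact m)) \<cdot>\<^sub>v rvmult (rvmult (w - rvmult w Jd.P) ((sumC q d A - 1\<^sub>m d) ^\<^sub>m (m - 1))) (1\<^sub>m d - A 0)"
    unfolding th_def theta_def Jd.complement_conj
      rvmult_smult_mat[OF wc mult_carrier_mat[OF mult_carrier_mat[OF IP M] B]]
      rvmult_mult[OF wc mult_carrier_mat[OF IP M] B] rvmult_mult[OF wc IP M]
      rvmult_minus_mat[OF wc one_carrier_mat Jd.P_carrier] rvmult_one[OF wc] ..
  have eig1: "rvmult w Jd.P = 0\<^sub>v d" if "lam = 1"
    using Jd.rvmult_P_eig1[OF wc] wev that by simp
  have eig: "rvmult w Jd.P = w" if "lam \<noteq> 1"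
    using Jd.rvmult_P_eig[OF wc wev that] .
  have th0: "th = 0\<^sub>v d" if "lam \<noteq> 1"
    unfolding th_eq eig[OF that] w0 rvmult_zero_vec[OF M] rvmult_zero_vec[OF B] by (intro eq_vecI) auto
  have th1: "th = (1 / of_nat (fact m)) \<cdot>\<^sub>v rvmult (vv (m - 1)) (1\<^sub>m d - A 0)" if "lam = 1"
  proof -
    have "w - 0\<^sub>v d = w" using wc by (intro eq_vecI) auto
    moreover have "(1 :: complex) \<cdot>\<^sub>m 1\<^sub>m d = 1\<^sub>m d" by (intro eq_matI) auto
    ultimately show ?thesis unfolding th_eq eig1[OF that] vv_def that by simp
  qed
  \<comment> \<open>For lam = 1 the projection in K kills w, in accordance with dd 0 = 0.\<close>
  have wK: "rvmult w K = dd 0"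
  proof (cases "lam = 1")
    case True
    have "rvmult w K = rvmult (rvmult (rvmult w Jd.P) L) (1\<^sub>m d - A 0)"
      unfolding K_eq using wc L(2) B PL by (simp add: rvmult_mult[of _ d])
    then show ?thesis using True by (simp add: eig1 dd_def rvmult_zero_vec[OF L(2)] rvmult_zero_vec[OF B])
  next
    case False
    then show ?thesis using E.v_0 by (simp add: dd_def vv)
  qed
  interpret E: eigen_chain_const d nv q A w m lam dd th
  proof unfold_locales
    fix k j assume j: "j < d"
    \<comment> \<open>For lam = 1 the terms in dd k cancel and dd (k + 1) is the constant up to
      sign; otherwise \<open>fixed_equation\<close> is combined with v k C = lam v k + v (k +
      1).\<close>
    have "vv k $ j - rvmult (vv k) (A 0) $ j = dd k $ j - lam * dd k $ j - dd (Suc k) $ j"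
    proof (cases "lam = 1")
      case True
      then show ?thesis using j A0 vvc[of k] by (simp add: dd_def xB carrier_vecD[OF rvmult_carrier[OF A0]])
    next
      case False
      have "rvmult (vv k) Jd.P = vv k" unfolding vv_def by (rule Jd.rvmult_pow_P[OF wc eig[OF False]])
      then have "rvmult (vv k) K - rvmult (rvmult (vv k) (sumC q d A)) K = rvmult (vv k) (1\<^sub>m d - A 0)"
        unfolding K_eq by (intro Jd.fixed_equation L B vvc)
      moreover have "rvmult (rvmult (vv k) (sumC q d A)) K = lam \<cdot>\<^sub>v rvmult (vv k) K + rvmult (vv (Suc k)) K"
        using E.v_C_eq[of k] vvc Kc by (simp add: vv rvmult_add_vec[of _ d] rvmult_smult_vec[of _ d])
      ultimately have "(rvmult (vv k) K - (lam \<cdot>\<^sub>v rvmult (vv k) K + rvmult (vv (Suc k)) K)) $ j = (vv k - rvmult (vv k) (A 0)) $ j"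
        by (simp add: xB vvc)
      then show ?thesis using j False
        by (simp add: diff_diff_eq dd_def carrier_vecD[OF rvmult_carrier[OF Kc]] carrier_vecD[OF rvmult_carrier[OF A0]] carrier_vecD[OF vvc])
    qed
    then show "E.v k $ j - rvmult (E.v k) (A 0) $ j = dd k $ j - lam * dd k $ j - dd (Suc k) $ j"
      unfolding vv .
  next
    fix k j assume k: "k > m" and j: "j < d"
    \<comment> \<open>For lam = 1 the constant dd k involves the vector with index k - 1, so
      vanishing is guaranteed only beyond m; the entry dd m carries theta.\<close>
    then obtain i where i: "k = Suc i" "i \<ge> m" by (cases k) auto
    have "vv i = 0\<^sub>v d" "vv k = 0\<^sub>v d" using E.v_zero[of i] E.v_zero[of k] i by (auto simp: vv)
    then show "dd k $ j = 0" using j by (simp add: dd_def i(1) rvmult_zero_vec[OF B] rvmult_zero_vec[OF Kc])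
  next
    fix j assume j: "j < d"
    obtain i where i: "m = Suc i" using m by (cases m) auto
    show "- dd m $ j = of_nat (fact m) * th $ j"
    proof (cases "lam = 1")
      case True
      then show ?thesis using j by (simp add: th1 dd_def i carrier_vecD[OF rvmult_carrier[OF B]] del: fact_Suc)
    next
      case False
      then show ?thesis using j E.v_zero[of m] by (simp add: th0 dd_def vv rvmult_zero_vec[OF Kc])
    qed
  next
    show "th $ j = 0" if "lam \<noteq> 1" "j < d" for j using that by (simp add: th0)
  qed
  have dd0: "dd 0 \<in> carrier_vec d" unfolding wK[symmetric] by (rule rvmult_carrier[OF Kc])
  have thc: "th \<in> carrier_vec d" unfolding th_eq by (simp add: rvmult_carrier[OF B])
  have err: "rvmult w (regF q d A N) - rvmult w (Kmat d A T Ti J)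
      - complex_of_real (log q (real N) ^ m) \<cdot>\<^sub>v rvmult w (theta q d A T Ti J m) = E.err N" for N
    by (simp add: E.err_def K_def[symmetric] th_def[symmetric] wK)
  show ?thesis unfolding Let_def err
  proof (intro conjI impI)
    assume "cmod lam < R"
    then show "\<exists>c. \<forall>\<^sub>F N in sequentially. nv (E.err N) \<le> c * R powr log q (real N)"
      by (intro E.err_less[OF dd0 thc l(1)] bnd)
  next
    assume "cmod lam = R"
    then show "\<exists>c. \<forall>\<^sub>F N in sequentially. nv (E.err N) \<le> c * R powr log q (real N) * ln (real N) ^ m"
      by (intro E.err_eq[OF dd0 thc l(1)] bnd)
  next
    assume lamR: "cmod lam > R"
    note hyp = dd0 thc l lamR bnd
    show "\<exists>\<Phi> :: nat \<Rightarrow> real \<Rightarrow> complex vec.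
            (\<forall>k<m. \<forall>u. \<Phi> k u \<in> carrier_vec d) \<and>
            (\<forall>k<m. \<forall>u. \<Phi> k (u + 1) = \<Phi> k u) \<and>
            (\<forall>k<m. \<forall>j<d. continuous_on UNIV (\<lambda>u. \<Phi> k u $ j)) \<and>
            (\<forall>N. N \<ge> q ^ (m - 1) \<longrightarrow>
               E.err N = (of_nat N powr (Ln lam / complex_of_real (ln (real q)))) \<cdot>\<^sub>v
                   vsum d (\<lambda>k. complex_of_real (log q (real N) ^ k) \<cdot>\<^sub>v \<Phi> k (frac (log q (real N)))) m) \<and>
            (\<forall>k<m. \<forall>\<alpha>. 0 < \<alpha> \<and> R * real q powr \<alpha> < cmod lam \<longrightarrow>
               (\<exists>c. \<forall>x y. nv (\<Phi> k x - \<Phi> k y) \<le> c * \<bar>x - y\<bar> powr \<alpha>)) \<and>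
            ((\<forall>r<q. rvmult (rvmult w ((sumC q d A - lam \<cdot>\<^sub>m 1\<^sub>m d) ^\<^sub>m (m - 1))) (A r)
                      = rvmult w ((sumC q d A - lam \<cdot>\<^sub>m 1\<^sub>m d) ^\<^sub>m (m - 1))) \<longrightarrow>
               (\<forall>u. \<Phi> (m - 1) u = complex_of_real (1 / (real q ^ (m - 1) * fact (m - 1))) \<cdot>\<^sub>v
                      rvmult w ((sumC q d A - of_nat q \<cdot>\<^sub>m 1\<^sub>m d) ^\<^sub>m (m - 1))))"
    proof (intro exI[of _ E.Phi] conjI allI impI)
      show "E.Phi k u \<in> carrier_vec d" for k u by (rule E.Phi_carrier[OF dd0 thc])
      show "E.Phi k (u + 1) = E.Phi k u" for k u by (rule E.Phi_periodic[OF hyp])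
      show "continuous_on UNIV (\<lambda>u. E.Phi k u $ j)" if "j < d" for k j by (rule E.Phi_continuous[OF hyp that])
      show "E.err N = (of_nat N powr (Ln lam / complex_of_real (ln (real q)))) \<cdot>\<^sub>v
                   vsum d (\<lambda>k. complex_of_real (log q (real N) ^ k) \<cdot>\<^sub>v E.Phi k (frac (log q (real N)))) m"
        if N: "N \<ge> q ^ (m - 1)" for N
      proof (rule E.Phi_expansion[OF hyp])
        have "q ^ (m - 1) \<ge> 1" using q by (intro one_le_power) simp
        then show "N \<ge> 1" using N by (rule order_trans)
      qed
      show "\<exists>c. \<forall>x y. nv (E.Phi k x - E.Phi k y) \<le> c * \<bar>x - y\<bar> powr \<alpha>"
        if "0 < \<alpha> \<and> R * real q powr \<alpha> < cmod lam" for k \<alpha>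
        using that by (intro E.Phi_holder[OF hyp]) auto
      show "E.Phi (m - 1) u = complex_of_real (1 / (real q ^ (m - 1) * fact (m - 1))) \<cdot>\<^sub>v
                      rvmult w ((sumC q d A - of_nat q \<cdot>\<^sub>m 1\<^sub>m d) ^\<^sub>m (m - 1))"
        if fix1: "\<forall>r<q. rvmult (rvmult w ((sumC q d A - lam \<cdot>\<^sub>m 1\<^sub>m d) ^\<^sub>m (m - 1))) (A r)
                      = rvmult w ((sumC q d A - lam \<cdot>\<^sub>m 1\<^sub>m d) ^\<^sub>m (m - 1))" for u
      proof (rule E.Phi_const[OF dd0 thc l lamR])
        show "rvmult (E.v (m - 1)) (A r) = E.v (m - 1)" if r: "r < q" for r
          using fix1 r unfolding E.v_def by blast
      qed (rule bnd)
    qed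
  next
    assume "lam = 1"
    then show "rvmult w (Kmat d A T Ti J) = 0\<^sub>v d" using wK by (simp add: K_def dd_def)
  next
    assume "lam \<noteq> 1"
    then show "rvmult w (theta q d A T Ti J m) = 0\<^sub>v d" using th0 by (simp add: th_def)
  qed
qed

end
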